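(* For $i\in\{1,2\}$ let $G_i=F_{k_i}^{W_i}(K_{n_i})$ be a $k_i$-fan graph of $K_{n_i}$ on the set $W_i\subseteq[n_i]$, with $n_i\ge 2$ and $k_i\ge 1$, let $f_i$ be a leaf of $G_i$ whose neighbor $v_i$ satisfies $\deg_{G_i}(v_i)\ge 2$, and let $G=(G_1,f_1)\circ(G_2,f_2)$. For $i\in\{1,2\}$ let $W_i=W_{i,1}\sqcup\cdots\sqcup W_{i,k_i}$ be the partition of $W_i$ defining $G_i$, indexed so that $v_i\in W_{i,1}$. Let $$T_i=\max\{|W_{i,1}|,|W_{i,2}|,\ldots,|W_{i,k_i}|\},\qquad T'_i=\max\{|W_{i,1}|-1,|W_{i,2}|,\ldots,|W_{i,k_i}|\}$$ for $i\in\{1,2\}$, and let $t=|\{i\in\{1,2\} : T'_i\ne T_i-1\}|$. Then $$\operatorname{depth}(S_G/I_G)=\operatorname{depth}(S_{G_1}/I_{G_1})+\operatorname{depth}(S_{G_2}/I_{G_2})-s,$$ where $s=1$ if $t\le 1$, and $s=2$ otherwise.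
   Context: $\mathbb{K}$ is a field; $[n]=\{1,\dots,n\}$. For a finite simple graph $H$, $S_H=\mathbb{K}[x_u:u\in V(H)]$ and $I_H=(x_ux_v : \{u,v\}\in E(H))\subset S_H$ is the edge ideal. For a finitely generated graded $S$-module $M$, $\operatorname{depth}(M)=\min\{i : \operatorname{Ext}^i_S(\mathbb{K},M)\ne 0\}$. A leaf is a vertex of degree $1$. Fan graphs: let $K_n$ be the complete graph on $[n]$. Given $U=\{u_1,\dots,u_r\}\subseteq[n]$ (with a chosen ordering), suppose that for each $i\in[r]$ a new complete graph $K_{a_i}$ on $a_i>i$ vertices is attached to $K_n$ in such a way that $V(K_n)\cap V(K_{a_i})=\{u_1,\dots,u_i\}$ (the new vertices of different attached cliques are pairwise distinct). The resulting graph is said to be obtained by adding a fan to $K_n$ on $U$, and $\{K_{a_1},\dots,K_{a_r}\}$ is the branch of that fan on $U$. If $W\subseteq[n]$ and $W=W_1\sqcup\cdots\sqcup W_k$ is a partition into nonempty subsets, a $k$-fan graph $F_k^W(K_n)$ of $K_n$ on $W$ is a graph obtained from $K_n$ by adding a fan on each $W_i$. The $\circ$ operation: let $G_1,G_2$ be (vertex-disjoint) graphs, and for $i=1,2$ let $f_i$ be a leaf of $G_i$ with neighbor $v_i$, $\deg_{G_i}(v_i)\ge 2$. Then $(G_1,f_1)\circ(G_2,f_2)$ is the graph obtained from $G_1$ and $G_2$ by first removing the leaves $f_1,f_2$ and then identifying the vertices $v_1$ and $v_2$. *)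

theory Defs
  imports
    "HOL-Algebra.QuotRing"
    "HOL-Algebra.Module"
    "HOL-Algebra.Elementary_Groups"
    "HOL-Library.Poly_Mapping"
    "HOL-Library.Disjoint_Sets"
begin

section \<open>Finite simple graphs\<close>

record 'v ugraph =
  verts :: "'v set"
  edges :: "'v set set"

definition complete_edges :: "'v set \<Rightarrow> 'v set set" where
  "complete_edges A = {e. e \<subseteq> A \<and> card e = 2}"

definition simple_graph :: "'v ugraph \<Rightarrow> bool" where
  "simple_graph G \<longleftrightarrow> finite (verts G) \<and> edges G \<subseteq> complete_edges (verts G)"

definition degree :: "'v ugraph \<Rightarrow> 'v \<Rightarrow> nat" where
  "degree G v = card {e \<in> edges G. v \<in> e}"

definition leaf :: "'v ugraph \<Rightarrow> 'v \<Rightarrow> bool" where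
  "leaf G f \<longleftrightarrow> f \<in> verts G \<and> degree G f = 1"

definition leaf_neighbour :: "'v ugraph \<Rightarrow> 'v \<Rightarrow> 'v" where
  "leaf_neighbour G f = (THE v. {f, v} \<in> edges G)"


section \<open>Fan graphs\<close>

text \<open>\<open>is_fan C U u A\<close>: adding a fan on \<open>U\<close> to the complete graph with vertex set \<open>C\<close>.
  The chosen ordering of \<open>U\<close> is \<open>u 1, \<dots>, u r\<close> with \<open>r = card U\<close>, and \<open>A i\<close> is the vertex set
  of the \<open>i\<close>-th clique of the branch, so that \<open>card (A i)\<close> is the number \<open>a\<^sub>i\<close>.\<close>

definition is_fan :: "'v set \<Rightarrow> 'v set \<Rightarrow> (nat \<Rightarrow> 'v) \<Rightarrow> (nat \<Rightarrow> 'v set) \<Rightarrow> bool" where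
  "is_fan C U u A \<longleftrightarrow>
     bij_betw u {1..card U} U \<and>
     (\<forall>i\<in>{1..card U}. finite (A i) \<and> i < card (A i) \<and> C \<inter> A i = u ` {1..i})"

text \<open>\<open>k_fan_graph n W k P G\<close>: \<open>G\<close> is a \<open>k\<close>-fan graph of the complete graph on \<open>{1..n}\<close> on the
  set \<open>W\<close>, where \<open>W\<close> is partitioned into \<open>P 1, \<dots>, P k\<close>. New vertices of different attached
  cliques, in the same branch or in different ones, are distinct.\<close>

definition k_fan_graph ::
  "nat \<Rightarrow> nat set \<Rightarrow> nat \<Rightarrow> (nat \<Rightarrow> nat set) \<Rightarrow> nat ugraph \<Rightarrow> bool" where
  "k_fan_graph n W k P G \<longleftrightarrow>
     W \<subseteq> {1..n} \<and>
     (\<forall>j\<in>{1..k}. P j \<noteq> {}) \<and> disjoint_family_on P {1..k} \<and> (\<Union>j\<in>{1..k}. P j) = W \<and>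
     (\<exists>u A.
        (\<forall>j\<in>{1..k}. is_fan {1..n} (P j) (u j) (A j)) \<and>
        disjoint_family_on (\<lambda>(j, i). A j i - {1..n}) (SIGMA j:{1..k}. {1..card (P j)}) \<and>
        verts G = {1..n} \<union> (\<Union>j\<in>{1..k}. \<Union>i\<in>{1..card (P j)}. A j i) \<and>
        edges G = complete_edges {1..n} \<union>
          (\<Union>j\<in>{1..k}. \<Union>i\<in>{1..card (P j)}. complete_edges (A j i)))"

lemma k_fan_graph_simple:
  assumes "k_fan_graph n W k P G"
  shows "simple_graph G"
proof -
  from assms obtain u A where
    fan: "\<forall>j\<in>{1..k}. is_fan {1..n} (P j) (u j) (A j)" and
    V: "verts G = {1..n} \<union> (\<Union>j\<in>{1..k}. \<Union>i\<in>{1..card (P j)}. A j i)" and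
    E: "edges G = complete_edges {1..n} \<union>
          (\<Union>j\<in>{1..k}. \<Union>i\<in>{1..card (P j)}. complete_edges (A j i))"
    unfolding k_fan_graph_def by (elim conjE exE)
  have "finite (A j i)" if "j \<in> {1..k}" "i \<in> {1..card (P j)}" for i j
    using bspec[OF fan that(1)] that(2) by (simp add: is_fan_def)
  then have fin: "finite (verts G)"
    unfolding V by (intro finite_UnI finite_UN_I finite_atLeastAtMost)
  have mono: "complete_edges B \<subseteq> complete_edges C" if "B \<subseteq> C" for B C :: "nat set"
    using that unfolding complete_edges_def by (intro Collect_mono impI) (elim conjE, rule conjI, rule subset_trans)
  have "complete_edges {1..n} \<subseteq> complete_edges (verts G)"
    unfolding V by (rule mono[OF Un_upper1])
  moreover have "complete_edges (A j i) \<subseteq> complete_edges (verts G)"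
    if "j \<in> {1..k}" "i \<in> {1..card (P j)}" for i j
    unfolding V by (rule mono, rule le_supI2, rule order_trans[OF UN_upper[OF that(2)]],
      rule UN_upper[OF that(1)])
  ultimately have "edges G \<subseteq> complete_edges (verts G)"
    unfolding E by (intro Un_least UN_least)
  with fin show ?thesis
    by (simp add: simple_graph_def)
qed


section \<open>The operation \<open>(G1, f1) \<circ> (G2, f2)\<close>\<close>

text \<open>The two graphs are made vertex-disjoint by means of the sum type, and \<open>Inr v2\<close> is
  identified with \<open>Inl v1\<close>.\<close>

definition remove_vertex :: "'v ugraph \<Rightarrow> 'v \<Rightarrow> 'v ugraph" where
  "remove_vertex G f = \<lparr>verts = verts G - {f}, edges = {e \<in> edges G. f \<notin> e}\<rparr>"

definition disjoint_union :: "'a ugraph \<Rightarrow> 'b ugraph \<Rightarrow> ('a + 'b) ugraph" where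
  "disjoint_union G H =
     \<lparr>verts = Inl ` verts G \<union> Inr ` verts H, edges = (`) Inl ` edges G \<union> (`) Inr ` edges H\<rparr>"

definition identify_vertices :: "'v \<Rightarrow> 'v \<Rightarrow> 'v ugraph \<Rightarrow> 'v ugraph" where
  "identify_vertices v w G =
     (let q = (\<lambda>x. if x = w then v else x)
      in \<lparr>verts = q ` verts G, edges = (`) q ` edges G\<rparr>)"

definition leaf_circ :: "'a ugraph \<Rightarrow> 'a \<Rightarrow> 'b ugraph \<Rightarrow> 'b \<Rightarrow> ('a + 'b) ugraph" where
  "leaf_circ G1 f1 G2 f2 =
     identify_vertices (Inl (leaf_neighbour G1 f1)) (Inr (leaf_neighbour G2 f2))
       (disjoint_union (remove_vertex G1 f1) (remove_vertex G2 f2))"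


section \<open>Ext of modules over a Noetherian commutative ring\<close>

definition module_hom ::
  "('r, 'x) ring_scheme \<Rightarrow> ('r, 'm, 'y) module_scheme \<Rightarrow> ('r, 'n, 'z) module_scheme \<Rightarrow> ('m \<Rightarrow> 'n) set"
where
  "module_hom R M N =
     {h \<in> carrier M \<rightarrow>\<^sub>E carrier N.
        (\<forall>x\<in>carrier M. \<forall>y\<in>carrier M. h (x \<oplus>\<^bsub>M\<^esub> y) = h x \<oplus>\<^bsub>N\<^esub> h y) \<and>
        (\<forall>r\<in>carrier R. \<forall>x\<in>carrier M. h (r \<odot>\<^bsub>M\<^esub> x) = r \<odot>\<^bsub>N\<^esub> h x)}"

text \<open>In the module records below, the fields \<open>mult\<close> and \<open>one\<close>, which the record type
  inherits from rings, play no role.\<close>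

definition free_module :: "('r, 'x) ring_scheme \<Rightarrow> nat \<Rightarrow> ('r, nat \<Rightarrow> 'r) module" where
  "free_module R b =
     \<lparr>carrier = {..<b} \<rightarrow>\<^sub>E carrier R, mult = (\<lambda>_ _. undefined), one = undefined,
      zero = (\<lambda>j\<in>{..<b}. \<zero>\<^bsub>R\<^esub>),
      add = (\<lambda>x y. \<lambda>j\<in>{..<b}. x j \<oplus>\<^bsub>R\<^esub> y j),
      smult = (\<lambda>r x. \<lambda>j\<in>{..<b}. r \<otimes>\<^bsub>R\<^esub> x j)\<rparr>"

text \<open>A resolution \<open>\<dots> \<rightarrow> R\<^bsup>b 2\<^esup> \<rightarrow> R\<^bsup>b 1\<^esup> \<rightarrow> R\<^bsup>b 0\<^esup> \<rightarrow> N \<rightarrow> 0\<close> by free modules of finite rank, with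
  \<open>d i : R\<^bsup>b (i + 1)\<^esup> \<rightarrow> R\<^bsup>b i\<^esup>\<close> and augmentation \<open>\<epsilon>\<close>. Over a Noetherian ring every finitely
  generated module has one.\<close>

definition free_resolution ::
  "('r, 'x) ring_scheme \<Rightarrow> ('r, 'n, 'y) module_scheme \<Rightarrow>
   (nat \<Rightarrow> nat) \<Rightarrow> (nat \<Rightarrow> (nat \<Rightarrow> 'r) \<Rightarrow> (nat \<Rightarrow> 'r)) \<Rightarrow> ((nat \<Rightarrow> 'r) \<Rightarrow> 'n) \<Rightarrow> bool"
where
  "free_resolution R N b d \<epsilon> \<longleftrightarrow>
     \<epsilon> \<in> module_hom R (free_module R (b 0)) N \<and>
     (\<forall>i. d i \<in> module_hom R (free_module R (b (Suc i))) (free_module R (b i))) \<and>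
     \<epsilon> ` carrier (free_module R (b 0)) = carrier N \<and>
     d 0 ` carrier (free_module R (b 1)) =
       {x \<in> carrier (free_module R (b 0)). \<epsilon> x = \<zero>\<^bsub>N\<^esub>} \<and>
     (\<forall>i. d (Suc i) ` carrier (free_module R (b (Suc (Suc i)))) =
       {x \<in> carrier (free_module R (b (Suc i))). d i x = \<zero>\<^bsub>free_module R (b i)\<^esub>})"

definition hom_group ::
  "('r, 'x) ring_scheme \<Rightarrow> ('r, 'm, 'y) module_scheme \<Rightarrow> ('r, 'n, 'z) module_scheme \<Rightarrow> ('m \<Rightarrow> 'n) monoid"
where
  "hom_group R M N =
     \<lparr>carrier = module_hom R M N,
      mult = (\<lambda>g h. \<lambda>x\<in>carrier M. g x \<oplus>\<^bsub>N\<^esub> h x),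
      one = (\<lambda>x\<in>carrier M. \<zero>\<^bsub>N\<^esub>)\<rparr>"

definition cocycles ::
  "('r, 'x) ring_scheme \<Rightarrow> (nat \<Rightarrow> nat) \<Rightarrow> (nat \<Rightarrow> (nat \<Rightarrow> 'r) \<Rightarrow> (nat \<Rightarrow> 'r)) \<Rightarrow>
   ('r, 'm, 'z) module_scheme \<Rightarrow> nat \<Rightarrow> ((nat \<Rightarrow> 'r) \<Rightarrow> 'm) set"
where
  "cocycles R b d M i =
     {h \<in> module_hom R (free_module R (b i)) M.
        \<forall>x \<in> carrier (free_module R (b (Suc i))). h (d i x) = \<zero>\<^bsub>M\<^esub>}"

fun coboundaries ::
  "('r, 'x) ring_scheme \<Rightarrow> (nat \<Rightarrow> nat) \<Rightarrow> (nat \<Rightarrow> (nat \<Rightarrow> 'r) \<Rightarrow> (nat \<Rightarrow> 'r)) \<Rightarrow>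
   ('r, 'm, 'z) module_scheme \<Rightarrow> nat \<Rightarrow> ((nat \<Rightarrow> 'r) \<Rightarrow> 'm) set"
where
  "coboundaries R b d M 0 = {\<one>\<^bsub>hom_group R (free_module R (b 0)) M\<^esub>}"
| "coboundaries R b d M (Suc i) =
     (\<lambda>h. compose (carrier (free_module R (b (Suc i)))) h (d i))
       ` module_hom R (free_module R (b i)) M"

definition cohomology ::
  "('r, 'x) ring_scheme \<Rightarrow> (nat \<Rightarrow> nat) \<Rightarrow> (nat \<Rightarrow> (nat \<Rightarrow> 'r) \<Rightarrow> (nat \<Rightarrow> 'r)) \<Rightarrow>
   ('r, 'm, 'z) module_scheme \<Rightarrow> nat \<Rightarrow> ((nat \<Rightarrow> 'r) \<Rightarrow> 'm) set monoid"
where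
  "cohomology R b d M i =
     (hom_group R (free_module R (b i)) M)\<lparr>carrier := cocycles R b d M i\<rparr>
       Mod coboundaries R b d M i"

text \<open>\<open>Ext R N M i\<close> is \<open>Ext\<^sup>i\<close> of \<open>N\<close> and \<open>M\<close>, computed from some free resolution of \<open>N\<close>; up to
  isomorphism it does not depend on the choice.\<close>

definition Ext ::
  "('r, 'x) ring_scheme \<Rightarrow> ('r, 'n, 'y) module_scheme \<Rightarrow> ('r, 'm, 'z) module_scheme \<Rightarrow>
   nat \<Rightarrow> ((nat \<Rightarrow> 'r) \<Rightarrow> 'm) set monoid"
where
  "Ext R N M i =
     (let (b, d) = (SOME (b, d). \<exists>\<epsilon>. free_resolution R N b d \<epsilon>) in cohomology R b d M i)"


section \<open>Polynomial rings, edge ideals and depth\<close>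

text \<open>A monomial is a finitely supported exponent vector, and a polynomial is a finitely
  supported family of coefficients indexed by monomials.\<close>

type_synonym ('v, 'k) mpoly = "('v \<Rightarrow>\<^sub>0 nat) \<Rightarrow>\<^sub>0 'k"

definition var :: "'v \<Rightarrow> ('v, 'k::field) mpoly" where
  "var u = Poly_Mapping.single (Poly_Mapping.single u 1) 1"

definition poly_ring :: "'v set \<Rightarrow> ('v, 'k::field) mpoly ring" where
  "poly_ring V =
     \<lparr>carrier = {p. \<forall>m \<in> Poly_Mapping.keys p. Poly_Mapping.keys m \<subseteq> V},
      mult = (*), one = 1, zero = 0, add = (+)\<rparr>"

text \<open>The ground field as a module over the polynomial ring: all variables act as zero.\<close>

definition ground_field :: "(('v, 'k::field) mpoly, 'k) module" where
  "ground_field =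
     \<lparr>carrier = UNIV, mult = (*), one = 1, zero = 0, add = (+),
      smult = (\<lambda>p c. Poly_Mapping.lookup p 0 * c)\<rparr>"

definition quotient_module :: "('r, 'x) ring_scheme \<Rightarrow> 'r set \<Rightarrow> ('r, 'r set) module" where
  "quotient_module R I =
     \<lparr>carrier = carrier (R Quot I), mult = mult (R Quot I), one = one (R Quot I),
      zero = zero (R Quot I), add = add (R Quot I),
      smult = (\<lambda>r X. (I +>\<^bsub>R\<^esub> r) \<otimes>\<^bsub>R Quot I\<^esub> X)\<rparr>"

definition edge_ideal :: "'v ugraph \<Rightarrow> ('v, 'k::field) mpoly set" where
  "edge_ideal G = Idl\<^bsub>poly_ring (verts G)\<^esub> {var u * var v | u v. {u, v} \<in> edges G}"

definition depth ::
  "'v set \<Rightarrow> (('v, 'k::field) mpoly, 'm, 'z) module_scheme \<Rightarrow> nat"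
where
  "depth V M = (LEAST i. \<not> trivial_group (Ext (poly_ring V) ground_field M i))"

definition edge_depth :: "'k::field itself \<Rightarrow> 'v ugraph \<Rightarrow> nat" where
  "edge_depth _ G =
     depth (verts G) (quotient_module (poly_ring (verts G)) (edge_ideal G :: ('v, 'k) mpoly set))"

end

theory Submission
  imports Defs
begin

text \<open>The graphs involved are chordal, and for a chordal graph the depth of \<open>S/I\<close> is the least size of
  a maximal independent set.  This is proved from an arbitrary free resolution of the ground field:
  for a vertex \<open>x\<close>, the long exact sequence of \<open>0 \<rightarrow> S/(I : x) \<rightarrow> S/I \<rightarrow> S/(I + (x)) \<rightarrow> 0\<close> relates
  the graph to the graphs in which the neighbours of \<open>x\<close>, respectively \<open>x\<close> itself, are removed.
  If \<open>x\<close> has a neighbour \<open>v\<close> all of whose neighbours are neighbours of \<open>x\<close> or \<open>x\<close> itself, every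
  maximal independent set of \<open>G - x\<close> is maximal in \<open>G\<close>; this gives the lower bound, and it keeps
  the connecting homomorphism out of the way in the upper bound, provided that the vertices of a
  smallest maximal independent set have suitable private neighbours.  For edgeless graphs
  variables are regular, and multiplication by them is null-homotopic on the resolution.

  A maximal independent set of a fan graph contains at most one vertex \<open>w\<close> of \<open>K\<^bsub>n\<^esub>\<close> and one new
  vertex of every attached clique avoiding \<open>w\<close>, so the minimum is \<open>1 + |W| - T\<close>.  In the composite
  graph either the common vertex \<open>v\<close> is chosen, or one vertex \<open>w\<^sub>i \<noteq> v\<close> on each side, where the
  largest number of cliques met by \<open>w\<^sub>i\<close> is \<open>T'\<^sub>i\<close>.\<close>

section \<open>Free modules and linear functionals\<close>

text \<open>\<open>Ext\<close> is computed from a resolution chosen by \<open>SOME\<close>, so no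
  particular complex can be inspected: vanishing has to be decided for all resolutions alike, and
  the Koszul-type construction only shows that the choice succeeds. The exact sequence is not built
  as an object; each exactness statement is chased with functionals that lift cochains. Deleted
  vertices stay in the ring: their variables join the ideal, so one ring and one resolution serve
  the whole induction.

  The constant s is arithmetic. Removing \<open>f i\<close> costs one attached clique, so card (W i)
  - 1 remain on side i; \<open>v i\<close> lies in card (P i 1) - 1 of them, any other base vertex
  in at most \<open>T' i\<close>. The composite depth is the smaller of card (W 1) + card (W 2) - 1
  - deg v, where deg v adds the two numbers card (P i 1) - 1, and card (W 1) + card (W 2) - T' 1 -
  T' 2. Since T' i = T i - 1 exactly when \<open>P i 1\<close> is the only largest part, and T' i =
  T i otherwise, the first value is the smaller one only if both sides are of the former kind.
  Comparison with the depths 1 + card (W i) - T i gives s.\<close>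

locale class_ring =
  fixes R :: "'r::comm_ring_1 ring"
  assumes add_eq [simp]: "add R = (+)"
    and mult_eq [simp]: "monoid.mult R = (*)"
    and zero_eq [simp]: "zero R = 0"
    and one_eq [simp]: "one R = 1"
    and zero_mem [simp]: "0 \<in> carrier R"
    and one_mem [simp]: "1 \<in> carrier R"
    and add_mem [simp]: "x \<in> carrier R \<Longrightarrow> y \<in> carrier R \<Longrightarrow> x + y \<in> carrier R"
    and mult_mem [simp]: "x \<in> carrier R \<Longrightarrow> y \<in> carrier R \<Longrightarrow> x * y \<in> carrier R"
    and uminus_mem [simp]: "x \<in> carrier R \<Longrightarrow> - x \<in> carrier R"
begin

lemma diff_mem [simp]: "x \<in> carrier R \<Longrightarrow> y \<in> carrier R \<Longrightarrow> x - y \<in> carrier R"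
  using add_mem[of x "- y"] by simp

lemma sum_mem: "(\<And>i. i \<in> A \<Longrightarrow> h i \<in> carrier R) \<Longrightarrow> sum h A \<in> carrier R"
  by (induction A rule: infinite_finite_induct) auto

lemma cring_R: "cring R"
proof (rule cringI)
  show "abelian_group R"
  proof (rule abelian_groupI)
    show "\<exists>y\<in>carrier R. y \<oplus>\<^bsub>R\<^esub> x = \<zero>\<^bsub>R\<^esub>" if "x \<in> carrier R" for x
      using that by (intro bexI[of _ "- x"]) auto
  qed (auto simp: algebra_simps)
  show "comm_monoid R"
    by (rule comm_monoidI) (auto simp: algebra_simps)
qed (auto simp: algebra_simps)

lemma ring_R: "ring R"
  using cring_R by (rule cring.axioms)

lemma a_inv_eq [simp]: "x \<in> carrier R \<Longrightarrow> \<ominus>\<^bsub>R\<^esub> x = - x"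
  using abelian_group.minus_equality[of R "- x" x] ring.is_abelian_group[OF ring_R] by simp

lemma idealD:
  assumes "ideal I R"
  shows "I \<subseteq> carrier R" "0 \<in> I"
    and "\<And>x y. x \<in> I \<Longrightarrow> y \<in> I \<Longrightarrow> x + y \<in> I"
    and "\<And>x y. x \<in> I \<Longrightarrow> y \<in> I \<Longrightarrow> x - y \<in> I"
    and "\<And>r x. r \<in> carrier R \<Longrightarrow> x \<in> I \<Longrightarrow> r * x \<in> I"
proof -
  interpret ideal I R by fact
  show sub: "I \<subseteq> carrier R" by (rule a_subset)
  show "0 \<in> I" using additive_subgroup.zero_closed[OF additive_subgroup_axioms] by simp
  show add: "x + y \<in> I" if "x \<in> I" "y \<in> I" for x y
    using additive_subgroup.a_closed[OF additive_subgroup_axioms that] by simp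
  show l: "r * x \<in> I" if "r \<in> carrier R" "x \<in> I" for r x
    using I_l_closed[OF that(2,1)] by simp
  show "x - y \<in> I" if "x \<in> I" "y \<in> I" for x y
    using add[OF that(1) l[OF _ that(2), of "- 1"]] by simp
qed

lemma class_idealI:
  assumes "I \<subseteq> carrier R" "0 \<in> I"
    and "\<And>x y. x \<in> I \<Longrightarrow> y \<in> I \<Longrightarrow> x + y \<in> I"
    and l: "\<And>r x. r \<in> carrier R \<Longrightarrow> x \<in> I \<Longrightarrow> r * x \<in> I"
  shows "ideal I R"
proof (rule idealI[OF ring_R])
  have "- x \<in> I" if "x \<in> I" for x
    using l[OF _ that, of "- 1"] by simp
  then have "inv\<^bsub>add_monoid R\<^esub> x \<in> I" if "x \<in> I" for x
    using a_inv_eq[of x] assms(1) that unfolding a_inv_def by auto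
  then show "subgroup I (add_monoid R)"
    using assms by (intro subgroup.intro) auto
  show "x \<otimes>\<^bsub>R\<^esub> a \<in> I" "a \<otimes>\<^bsub>R\<^esub> x \<in> I" if "a \<in> I" "x \<in> carrier R" for a x
    using l[OF that(2,1)] by (simp_all add: mult.commute)
qed

abbreviation F :: "nat \<Rightarrow> ('r, nat \<Rightarrow> 'r) module" where
  "F \<equiv> free_module R"

lemma F_simps:
  "carrier (F b) = {..<b} \<rightarrow>\<^sub>E carrier R"
  "zero (F b) = (\<lambda>j\<in>{..<b}. 0)"
  "x \<oplus>\<^bsub>F b\<^esub> y = (\<lambda>j\<in>{..<b}. x j + y j)"
  "r \<odot>\<^bsub>F b\<^esub> x = (\<lambda>j\<in>{..<b}. r * x j)"
  by (simp_all add: free_module_def)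

lemma F_zero_mem [simp]: "zero (F b) \<in> carrier (F b)"
  by (auto simp: F_simps)

lemma F_add_mem [simp]:
  "x \<in> carrier (F b) \<Longrightarrow> y \<in> carrier (F b) \<Longrightarrow> x \<oplus>\<^bsub>F b\<^esub> y \<in> carrier (F b)"
  by (auto simp: F_simps PiE_iff)

lemma F_smult_mem [simp]:
  "r \<in> carrier R \<Longrightarrow> x \<in> carrier (F b) \<Longrightarrow> r \<odot>\<^bsub>F b\<^esub> x \<in> carrier (F b)"
  by (auto simp: F_simps PiE_iff)

lemma F_eqI:
  "x \<in> carrier (F b) \<Longrightarrow> y \<in> carrier (F b) \<Longrightarrow> (\<And>j. j < b \<Longrightarrow> x j = y j) \<Longrightarrow> x = y"
  unfolding F_simps by (rule PiE_ext) auto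

lemma F_coord: "x \<in> carrier (F b) \<Longrightarrow> j < b \<Longrightarrow> x j \<in> carrier R"
  by (auto simp: F_simps)

lemma F_smult_zero: "x \<in> carrier (F b) \<Longrightarrow> 0 \<odot>\<^bsub>F b\<^esub> x = zero (F b)"
  by (auto simp: F_simps)

definition basis_vec :: "nat \<Rightarrow> nat \<Rightarrow> nat \<Rightarrow> 'r" where
  "basis_vec b j = (\<lambda>k\<in>{..<b}. if k = j then 1 else 0)"

lemma basis_vec_mem [simp]: "basis_vec b j \<in> carrier (F b)"
  by (auto simp: basis_vec_def F_simps)

lemma free_module_induct:
  assumes x: "x \<in> carrier (F b)"
    and zero: "Q (zero (F b))"
    and step: "\<And>y r j. y \<in> carrier (F b) \<Longrightarrow> Q y \<Longrightarrow> r \<in> carrier R \<Longrightarrow> j < b \<Longrightarrow>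
      Q (y \<oplus>\<^bsub>F b\<^esub> r \<odot>\<^bsub>F b\<^esub> basis_vec b j)"
  shows "Q x"
proof -
  \<comment> \<open>Switching on one coordinate at a time adds one multiple of a basis vector to the
    truncation.\<close>
  define trunc where "trunc m = (\<lambda>k\<in>{..<b}. if k < m then x k else 0)" for m
  have mem: "trunc m \<in> carrier (F b)" for m
    using x by (simp add: trunc_def F_simps PiE_iff)
  have "m \<le> b \<Longrightarrow> Q (trunc m)" for m
  proof (induction m)
    case 0
    have "trunc 0 = zero (F b)" by (simp add: trunc_def F_simps)
    then show ?case using zero by simp
  next
    case (Suc m)
    have "trunc (Suc m) = trunc m \<oplus>\<^bsub>F b\<^esub> x m \<odot>\<^bsub>F b\<^esub> basis_vec b m"
      unfolding F_simps trunc_def by (rule restrict_ext) (simp add: basis_vec_def less_Suc_eq)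
    moreover have "Q (trunc m \<oplus>\<^bsub>F b\<^esub> x m \<odot>\<^bsub>F b\<^esub> basis_vec b m)"
      using Suc F_coord[OF x, of m] by (intro step mem) auto
    ultimately show ?case by simp
  qed
  moreover have "trunc b = x"
    by (rule F_eqI[OF mem x]) (simp add: trunc_def)
  ultimately show ?thesis by (metis order_refl)
qed

text \<open>Unlike elements of \<open>module_hom\<close>, these are not extensional: values off the
  carrier are arbitrary, so sums, multiples and composites are plain lambda terms.\<close>

definition functionals :: "nat \<Rightarrow> ((nat \<Rightarrow> 'r) \<Rightarrow> 'r) set" where
  "functionals b = {h.
     (\<forall>x\<in>carrier (F b). h x \<in> carrier R) \<and>
     (\<forall>x\<in>carrier (F b). \<forall>y\<in>carrier (F b). h (x \<oplus>\<^bsub>F b\<^esub> y) = h x + h y) \<and>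
     (\<forall>r\<in>carrier R. \<forall>x\<in>carrier (F b). h (r \<odot>\<^bsub>F b\<^esub> x) = r * h x)}"

lemma functionalsD:
  assumes "h \<in> functionals b"
  shows "x \<in> carrier (F b) \<Longrightarrow> h x \<in> carrier R"
    and "x \<in> carrier (F b) \<Longrightarrow> y \<in> carrier (F b) \<Longrightarrow> h (x \<oplus>\<^bsub>F b\<^esub> y) = h x + h y"
    and "r \<in> carrier R \<Longrightarrow> x \<in> carrier (F b) \<Longrightarrow> h (r \<odot>\<^bsub>F b\<^esub> x) = r * h x"
  using assms by (auto simp: functionals_def)

lemma functional_zero: "h \<in> functionals b \<Longrightarrow> h (zero (F b)) = 0"
  using functionalsD(3)[of h b 0 "zero (F b)"] by (simp add: F_smult_zero)

lemma functionals_diff: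
  "g \<in> functionals b \<Longrightarrow> h \<in> functionals b \<Longrightarrow> (\<lambda>x. g x - h x) \<in> functionals b"
  by (auto simp: functionals_def algebra_simps)

lemma functionals_add:
  "g \<in> functionals b \<Longrightarrow> h \<in> functionals b \<Longrightarrow> (\<lambda>x. g x + h x) \<in> functionals b"
  by (auto simp: functionals_def algebra_simps)

lemma functionals_scale:
  "r \<in> carrier R \<Longrightarrow> h \<in> functionals b \<Longrightarrow> (\<lambda>x. r * h x) \<in> functionals b"
  by (auto simp: functionals_def algebra_simps)

lemma functionals_zero: "(\<lambda>_. 0) \<in> functionals b"
  by (auto simp: functionals_def)

lemma module_homD:
  assumes "d \<in> module_hom R M N"
  shows "x \<in> carrier M \<Longrightarrow> d x \<in> carrier N"
    and "x \<in> carrier M \<Longrightarrow> y \<in> carrier M \<Longrightarrow> d (x \<oplus>\<^bsub>M\<^esub> y) = d x \<oplus>\<^bsub>N\<^esub> d y"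
    and "r \<in> carrier R \<Longrightarrow> x \<in> carrier M \<Longrightarrow> d (r \<odot>\<^bsub>M\<^esub> x) = r \<odot>\<^bsub>N\<^esub> d x"
    and "d \<in> extensional (carrier M)"
  using assms by (auto simp: module_hom_def PiE_iff)

lemma functionals_compose:
  "h \<in> functionals a \<Longrightarrow> d \<in> module_hom R (F b) (F a) \<Longrightarrow> (\<lambda>x. h (d x)) \<in> functionals b"
  unfolding functionals_def by (auto simp: module_homD)

lemma F_hom_zero:
  assumes "d \<in> module_hom R (F b) (F a)"
  shows "d (zero (F b)) = zero (F a)"
proof -
  have "d (0 \<odot>\<^bsub>F b\<^esub> zero (F b)) = 0 \<odot>\<^bsub>F a\<^esub> d (zero (F b))"
    using assms by (intro module_homD(3)[OF assms]) auto
  then show ?thesis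
    using module_homD(1)[OF assms, of "zero (F b)"] by (simp add: F_smult_zero)
qed

lemma functional_mem_ideal:
  assumes I: "ideal I R" and h: "h \<in> functionals b"
    and basis: "\<And>j. j < b \<Longrightarrow> h (basis_vec b j) \<in> I" and x: "x \<in> carrier (F b)"
  shows "h x \<in> I"
  using x
  by (rule free_module_induct)
    (simp_all add: functional_zero[OF h] functionalsD[OF h] idealD[OF I] basis)

definition dot :: "nat \<Rightarrow> (nat \<Rightarrow> 'r) \<Rightarrow> (nat \<Rightarrow> 'r) \<Rightarrow> 'r" where
  "dot b c x = (\<Sum>j<b. c j * x j)"

lemma dot_functional: "(\<And>j. j < b \<Longrightarrow> c j \<in> carrier R) \<Longrightarrow> dot b c \<in> functionals b"
  unfolding functionals_def dot_def
  by (auto simp: F_simps algebra_simps sum.distrib sum_distrib_left PiE_iff intro!: sum_mem mult_mem)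

lemma dot_basis [simp]: "j < b \<Longrightarrow> dot b c (basis_vec b j) = c j"
  by (simp add: dot_def basis_vec_def if_distrib[where f = "\<lambda>z. c _ * z"] sum.delta cong: if_cong)

lemma module_hom_dotI:
  assumes "\<And>j. j < b \<Longrightarrow> c j \<in> carrier (F a)"
  shows "(\<lambda>x\<in>carrier (F b). \<lambda>k\<in>{..<a}. dot b (\<lambda>j. c j k) x) \<in> module_hom R (F b) (F a)"
    (is "?h \<in> _")
    and "j < b \<Longrightarrow>
      (\<lambda>x\<in>carrier (F b). \<lambda>k\<in>{..<a}. dot b (\<lambda>j. c j k) x) (basis_vec b j) = c j"
proof -
  have fn: "dot b (\<lambda>j. c j k) \<in> functionals b" if "k < a" for k
    using assms that by (intro dot_functional F_coord) auto
  have mem: "(\<lambda>k\<in>{..<a}. dot b (\<lambda>j. c j k) x) \<in> carrier (F a)" if "x \<in> carrier (F b)" for x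
    using functionalsD(1)[OF fn that] by (auto simp: F_simps)
  have 1: "?h x \<in> carrier (F a)" if "x \<in> carrier (F b)" for x
    using mem[OF that] that by simp
  have 2: "?h (x \<oplus>\<^bsub>F b\<^esub> y) = ?h x \<oplus>\<^bsub>F a\<^esub> ?h y" if "x \<in> carrier (F b)" "y \<in> carrier (F b)" for x y
    using that functionalsD(2)[OF fn that] by (auto simp: F_simps(3)[of a])
  have 3: "?h (r \<odot>\<^bsub>F b\<^esub> x) = r \<odot>\<^bsub>F a\<^esub> ?h x" if "r \<in> carrier R" "x \<in> carrier (F b)" for r x
    using that functionalsD(3)[OF fn that] by (auto simp: F_simps(4)[of a])
  show "?h \<in> module_hom R (F b) (F a)"
    using 1 2 3 by (simp add: module_hom_def PiE_iff)
  show "?h (basis_vec b j) = c j" if "j < b"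
    by (rule F_eqI[of _ a]) (use assms mem[OF basis_vec_mem, of j] that in auto)
qed

text \<open>Projectivity of \<open>F b\<close> in the form used for lifting: if a condition can be
  met for each basis vector separately, a linear map meets it on all of them.\<close>

lemma module_hom_basis_exists:
  assumes "\<And>j. j < b \<Longrightarrow> \<exists>y\<in>carrier (F a). Q j y"
  obtains h where "h \<in> module_hom R (F b) (F a)" "\<And>j. j < b \<Longrightarrow> Q j (h (basis_vec b j))"
proof -
  obtain c where c: "\<And>j. j < b \<Longrightarrow> c j \<in> carrier (F a) \<and> Q j (c j)"
    using assms by metis
  show thesis
    using that[OF module_hom_dotI(1)[of b c a]] c module_hom_dotI(2)[of b c a] by auto
qed

end

section \<open>Vanishing of Ext with coefficients in a cyclic module\<close>

text \<open>Functionals on free modules lift along \<open>R \<rightarrow> R/I\<close>, so cochains with values in \<open>R/I\<close> are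
  represented by functionals modulo \<open>I\<close>.  The convention \<open>F\<^sub>-\<^sub>1 = 0\<close> makes degree 0 uniform.\<close>

locale free_complex = class_ring R for R :: "'r::comm_ring_1 ring" +
  fixes b :: "nat \<Rightarrow> nat" and d :: "nat \<Rightarrow> (nat \<Rightarrow> 'r) \<Rightarrow> (nat \<Rightarrow> 'r)"
  assumes d_hom: "d i \<in> module_hom R (F (b (Suc i))) (F (b i))"
    and d_d: "y \<in> carrier (F (b (Suc (Suc i)))) \<Longrightarrow> d i (d (Suc i) y) = zero (F (b i))"
begin

definition pre_rank :: "nat \<Rightarrow> nat" where
  "pre_rank i = (case i of 0 \<Rightarrow> 0 | Suc j \<Rightarrow> b j)"

definition pre_map :: "nat \<Rightarrow> (nat \<Rightarrow> 'r) \<Rightarrow> (nat \<Rightarrow> 'r)" where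
  "pre_map i = (case i of 0 \<Rightarrow> (\<lambda>x\<in>carrier (F (b 0)). zero (F 0)) | Suc j \<Rightarrow> d j)"

lemma pre_simps [simp]:
  "pre_rank 0 = 0" "pre_rank (Suc j) = b j"
  "pre_map (Suc j) = d j" "x \<in> carrier (F (b 0)) \<Longrightarrow> pre_map 0 x = zero (F 0)"
  by (auto simp: pre_rank_def pre_map_def)

lemma pre_map_hom: "pre_map i \<in> module_hom R (F (b i)) (F (pre_rank i))"
proof (cases i)
  case 0
  have z: "zero (F 0) \<oplus>\<^bsub>F 0\<^esub> zero (F 0) = zero (F 0)" "r \<odot>\<^bsub>F 0\<^esub> zero (F 0) = zero (F 0)" for r
    by (simp_all add: F_simps restrict_def)
  show ?thesis
    unfolding 0 using z by (simp add: pre_map_def module_hom_def PiE_iff)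
qed (simp add: d_hom)

lemma pre_map_d: "y \<in> carrier (F (b (Suc i))) \<Longrightarrow> pre_map i (d i y) = zero (F (pre_rank i))"
  using module_homD(1)[OF d_hom] d_d by (cases i) auto

definition cocycle_mod :: "'r set \<Rightarrow> nat \<Rightarrow> ((nat \<Rightarrow> 'r) \<Rightarrow> 'r) \<Rightarrow> bool" where
  "cocycle_mod I i h \<longleftrightarrow> h \<in> functionals (b i) \<and> (\<forall>y\<in>carrier (F (b (Suc i))). h (d i y) \<in> I)"

definition coboundary_mod :: "'r set \<Rightarrow> nat \<Rightarrow> ((nat \<Rightarrow> 'r) \<Rightarrow> 'r) \<Rightarrow> bool" where
  "coboundary_mod I i h \<longleftrightarrow>
     (\<exists>g\<in>functionals (pre_rank i). \<forall>y\<in>carrier (F (b i)). h y - g (pre_map i y) \<in> I)"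

text \<open>The lifted form of the statement that the \<open>i\<close>-th cohomology with
  coefficients in R/I is zero; \<open>trivial_cohomology_vanishing\<close> is the
  translation.\<close>

definition vanishing :: "'r set \<Rightarrow> nat \<Rightarrow> bool" where
  "vanishing I i \<longleftrightarrow> (\<forall>h. cocycle_mod I i h \<longrightarrow> coboundary_mod I i h)"

text \<open>Here \<open>I'\<close> is the colon ideal (I : x) and \<open>I''\<close> is I + (x).
  Both are given by membership tests, so that combinatorial descriptions of monomial ideals can be
  inserted directly.\<close>

context
  fixes I I' I'' :: "'r set" and x :: 'r
  assumes I: "ideal I R" and x: "x \<in> carrier R"
    and colon: "\<And>r. r \<in> carrier R \<Longrightarrow> r \<in> I' \<longleftrightarrow> x * r \<in> I"
    and plus: "\<And>r. r \<in> carrier R \<Longrightarrow> r \<in> I'' \<longleftrightarrow> (\<exists>s\<in>carrier R. r - x * s \<in> I)"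
begin

text \<open>Division by \<open>x\<close> modulo \<open>I\<close> is chosen on basis vectors only,
  which makes the quotient linear.\<close>

lemma lift_functional:
  assumes k: "k \<in> functionals n" and mem: "\<And>y. y \<in> carrier (F n) \<Longrightarrow> k y \<in> I''"
  obtains h where "h \<in> functionals n" "\<And>y. y \<in> carrier (F n) \<Longrightarrow> k y - x * h y \<in> I"
proof -
  have "\<exists>s\<in>carrier R. k (basis_vec n j) - x * s \<in> I" if "j < n" for j
    using plus[OF functionalsD(1)[OF k]] mem by auto
  then obtain c where c: "\<And>j. j < n \<Longrightarrow> c j \<in> carrier R \<and> k (basis_vec n j) - x * c j \<in> I"
    by metis
  have f: "dot n c \<in> functionals n" using c by (intro dot_functional) auto
  have "k y - x * dot n c y \<in> I" if "y \<in> carrier (F n)" for y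
    by (rule functional_mem_ideal[OF I functionals_diff[OF k functionals_scale[OF x f]] _ that])
      (simp add: c)
  with f show thesis by (rule that)
qed

text \<open>Exactness of the long sequence at the Ext of R/I. A cocycle is a coboundary modulo
  \<open>I''\<close>; what is left is \<open>x\<close> times a functional, and that functional is a
  cocycle modulo \<open>I'\<close>.\<close>

lemma vanishing_middle:
  assumes "vanishing I' i" "vanishing I'' i"
  shows "vanishing I i"
  unfolding vanishing_def
proof (intro allI impI)
  fix h assume h: "cocycle_mod I i h"
  then have hf: "h \<in> functionals (b i)" and hd: "\<And>y. y \<in> carrier (F (b (Suc i))) \<Longrightarrow> h (d i y) \<in> I"
    by (auto simp: cocycle_mod_def)
  have "h (d i y) \<in> I''" if y: "y \<in> carrier (F (b (Suc i)))" for y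
    using plus[OF functionalsD(1)[OF functionals_compose[OF hf d_hom] y]] hd[OF y]
    by (auto intro: bexI[of _ 0])
  then have "coboundary_mod I'' i h"
    using assms(2) hf by (auto simp: vanishing_def cocycle_mod_def)
  then obtain g where g: "g \<in> functionals (pre_rank i)"
    and hg: "\<And>y. y \<in> carrier (F (b i)) \<Longrightarrow> h y - g (pre_map i y) \<in> I''"
    by (auto simp: coboundary_mod_def)
  note gp = functionals_compose[OF g pre_map_hom]
  obtain h' where h': "h' \<in> functionals (b i)"
    and hh': "\<And>y. y \<in> carrier (F (b i)) \<Longrightarrow> h y - g (pre_map i y) - x * h' y \<in> I"
    using lift_functional[OF functionals_diff[OF hf gp] hg] by auto
  have "cocycle_mod I' i h'"
    unfolding cocycle_mod_def
  proof (intro conjI ballI h')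
    fix y assume y: "y \<in> carrier (F (b (Suc i)))"
    note dy = module_homD(1)[OF d_hom y]
    \<comment> \<open>The composite of consecutive differentials kills the \<open>g\<close> term, so
      the difference is x * h' (d i y).\<close>
    have "h (d i y) - (h (d i y) - g (pre_map i (d i y)) - x * h' (d i y)) \<in> I"
      by (intro idealD(4)[OF I] hd y hh' dy)
    then show "h' (d i y) \<in> I'"
      using colon[OF functionalsD(1)[OF h' dy]] by (simp add: pre_map_d y functional_zero[OF g])
  qed
  then obtain g' where g': "g' \<in> functionals (pre_rank i)"
    and hg': "\<And>y. y \<in> carrier (F (b i)) \<Longrightarrow> h' y - g' (pre_map i y) \<in> I'"
    using assms(1) by (auto simp: vanishing_def coboundary_mod_def)
  show "coboundary_mod I i h"
    unfolding coboundary_mod_def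
  proof (intro bexI ballI)
    show "(\<lambda>z. g z + x * g' z) \<in> functionals (pre_rank i)"
      by (intro functionals_add functionals_scale g g' x)
    fix y assume y: "y \<in> carrier (F (b i))"
    have "x * (h' y - g' (pre_map i y)) \<in> I"
      using hg'[OF y] colon
        functionalsD(1)[OF functionals_diff[OF h' functionals_compose[OF g' pre_map_hom]] y] by auto
    from idealD(3)[OF I hh'[OF y] this]
    show "h y - (g (pre_map i y) + x * g' (pre_map i y)) \<in> I"
      by (simp add: algebra_simps)
  qed
qed

text \<open>Injectivity of \<open>Ext\<^sup>i(R/I') \<rightarrow> Ext\<^sup>i(R/I)\<close> when \<open>Ext\<^sup>i\<^sup>-\<^sup>1(R/I'') = 0\<close>.\<close>

lemma coboundary_mod_colon:
  assumes van: "\<And>j. i = Suc j \<Longrightarrow> vanishing I'' j"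
    and h: "h \<in> functionals (b i)" and xh: "coboundary_mod I i (\<lambda>y. x * h y)"
  shows "coboundary_mod I' i h"
proof (cases i)
  case 0
  have "x * h y \<in> I" if "y \<in> carrier (F (b 0))" for y
    using xh that functional_zero unfolding coboundary_mod_def 0 by fastforce
  then show ?thesis
    unfolding coboundary_mod_def 0
    by (intro bexI[of _ "\<lambda>_. 0"]) (use h 0 colon in \<open>auto simp: functionals_zero functionalsD\<close>)
next
  case (Suc j)
  obtain g where g: "g \<in> functionals (b j)"
    and hg: "\<And>y. y \<in> carrier (F (b i)) \<Longrightarrow> x * h y - g (d j y) \<in> I"
    using xh by (auto simp: coboundary_mod_def Suc)
  \<comment> \<open>The functional \<open>g\<close> that bounds \<open>x * h\<close> satisfies g (d
    j y) = x * h y modulo \<open>I\<close>, so it is a cocycle modulo \<open>I''\<close>. Corrected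
    by a coboundary it becomes divisible by \<open>x\<close>, and the quotient bounds
    \<open>h\<close>.\<close>
  have "cocycle_mod I'' j g"
    unfolding cocycle_mod_def
  proof (intro conjI ballI g)
    fix y assume y: "y \<in> carrier (F (b (Suc j)))"
    have "0 - (x * h y - g (d j y)) \<in> I"
      by (intro idealD(4)[OF I] idealD(2)[OF I] hg) (simp add: Suc y)
    then have "\<exists>s\<in>carrier R. g (d j y) - x * s \<in> I"
      using y Suc by (intro bexI[of _ "h y"]) (auto intro: functionalsD(1)[OF h])
    then show "g (d j y) \<in> I''"
      using plus functionalsD(1)[OF functionals_compose[OF g d_hom] y] by simp
  qed
  then obtain k where k: "k \<in> functionals (pre_rank j)"
    and gk: "\<And>y. y \<in> carrier (F (b j)) \<Longrightarrow> g y - k (pre_map j y) \<in> I''"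
    using van[OF Suc] by (auto simp: vanishing_def coboundary_mod_def)
  obtain g' where g': "g' \<in> functionals (b j)"
    and gg': "\<And>y. y \<in> carrier (F (b j)) \<Longrightarrow> g y - k (pre_map j y) - x * g' y \<in> I"
    using lift_functional[OF functionals_diff[OF g functionals_compose[OF k pre_map_hom]] gk] by auto
  have "h y - g' (d j y) \<in> I'" if y: "y \<in> carrier (F (b i))" for y
  proof -
    have y': "y \<in> carrier (F (b (Suc j)))" using y Suc by simp
    from idealD(3)[OF I hg[OF y] gg'[OF module_homD(1)[OF d_hom y']]]
    have "x * (h y - g' (d j y)) \<in> I"
      by (simp add: algebra_simps pre_map_d y' functional_zero[OF k])
    then show ?thesis
      using colon functionalsD(1)[OF h y] functionalsD(1)[OF g' module_homD(1)[OF d_hom y']] by simp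
  qed
  then show ?thesis
    unfolding coboundary_mod_def Suc using g' Suc by auto
qed

text \<open>Used contrapositively: if the Ext of R/I'' vanishes in the preceding degree, a nonzero
  class over the colon ideal stays nonzero over \<open>I\<close>.\<close>

lemma vanishing_colon:
  assumes "\<And>j. i = Suc j \<Longrightarrow> vanishing I'' j" and "vanishing I i"
  shows "vanishing I' i"
  unfolding vanishing_def
proof (intro allI impI)
  fix h assume h: "cocycle_mod I' i h"
  then have hf: "h \<in> functionals (b i)" by (simp add: cocycle_mod_def)
  have "cocycle_mod I i (\<lambda>y. x * h y)"
    using h colon functionalsD(1)[OF functionals_compose[OF hf d_hom]]
    by (auto simp: cocycle_mod_def functionals_scale x)
  then show "coboundary_mod I' i h"
    using assms hf by (intro coboundary_mod_colon) (auto simp: vanishing_def)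
qed

text \<open>Exactness at the Ext of R/I''. Writing h (d i y) = x * h' y modulo \<open>I\<close>
  makes \<open>h'\<close> the image of \<open>h\<close> under the connecting homomorphism; if it
  bounds, \<open>h\<close> can be corrected to a cocycle modulo \<open>I\<close>.\<close>

lemma vanishing_plus:
  assumes "vanishing I' (Suc i)" "vanishing I i"
  shows "vanishing I'' i"
  unfolding vanishing_def
proof (intro allI impI)
  fix h assume h: "cocycle_mod I'' i h"
  then have hf: "h \<in> functionals (b i)" by (simp add: cocycle_mod_def)
  obtain h' where h': "h' \<in> functionals (b (Suc i))"
    and hh': "\<And>y. y \<in> carrier (F (b (Suc i))) \<Longrightarrow> h (d i y) - x * h' y \<in> I"
    using lift_functional[OF functionals_compose[OF hf d_hom]] h by (auto simp: cocycle_mod_def)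
  have "cocycle_mod I' (Suc i) h'"
    unfolding cocycle_mod_def
  proof (intro conjI ballI h')
    fix y assume y: "y \<in> carrier (F (b (Suc (Suc i))))"
    note dy = module_homD(1)[OF d_hom y]
    have "0 - (h (d i (d (Suc i) y)) - x * h' (d (Suc i) y)) \<in> I"
      by (intro idealD(4)[OF I] idealD(2)[OF I] hh' dy)
    then show "h' (d (Suc i) y) \<in> I'"
      using colon[OF functionalsD(1)[OF h' dy]] by (simp add: d_d y functional_zero[OF hf])
  qed
  then obtain g' where g': "g' \<in> functionals (b i)"
    and hg': "\<And>y. y \<in> carrier (F (b (Suc i))) \<Longrightarrow> h' y - g' (d i y) \<in> I'"
    using assms(1) by (auto simp: vanishing_def coboundary_mod_def)
  have "cocycle_mod I i (\<lambda>y. h y - x * g' y)"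
    unfolding cocycle_mod_def
  proof (intro conjI ballI)
    show "(\<lambda>y. h y - x * g' y) \<in> functionals (b i)"
      by (intro functionals_diff functionals_scale hf g' x)
    fix y assume y: "y \<in> carrier (F (b (Suc i)))"
    have "x * (h' y - g' (d i y)) \<in> I"
      using hg'[OF y] colon
        functionalsD(1)[OF functionals_diff[OF h' functionals_compose[OF g' d_hom]] y] by auto
    from idealD(3)[OF I hh'[OF y] this]
    show "h (d i y) - x * g' (d i y) \<in> I" by (simp add: algebra_simps)
  qed
  then obtain k where k: "k \<in> functionals (pre_rank i)"
    and hk: "\<And>y. y \<in> carrier (F (b i)) \<Longrightarrow> h y - x * g' y - k (pre_map i y) \<in> I"
    using assms(2) by (auto simp: vanishing_def coboundary_mod_def)
  have "h y - k (pre_map i y) \<in> I''" if y: "y \<in> carrier (F (b i))" for y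
    using plus[OF functionalsD(1)[OF functionals_diff[OF hf functionals_compose[OF k pre_map_hom]] y]]
      hk[OF y] functionalsD(1)[OF g' y] by (auto simp: algebra_simps)
  with k show "coboundary_mod I'' i h"
    by (auto simp: coboundary_mod_def)
qed

end

end

section \<open>Comparison of the cohomology groups with lifted functionals\<close>

lemma (in comm_group) trivial_Mod_iff:
  assumes "subgroup N G"
  shows "trivial_group (G Mod N) \<longleftrightarrow> carrier G \<subseteq> N"
proof -
  have "N \<lhd> G" using assms by (rule subgroup_imp_normal)
  then have G: "group (G Mod N)" by (rule normal.factorgroup_is_group)
  have c: "carrier (G Mod N) = (\<lambda>a. N #>\<^bsub>G\<^esub> a) ` carrier G"
    by (auto simp: FactGroup_def RCOSETS_def)
  have "(N #>\<^bsub>G\<^esub> a = N) \<longleftrightarrow> a \<in> N" if "a \<in> carrier G" for a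
    using that assms coset_join1 coset_join2 subgroup.subset by blast
  then show ?thesis
    using group.trivial_group_subset[OF G] unfolding c by auto
qed

context class_ring
begin

lemma hom_group_comm_group:
  assumes "module R M"
  shows "comm_group (hom_group R (F n) M)"
proof -
  interpret M: module R M by fact
  show ?thesis
  proof (rule comm_groupI)
    fix g h assume "g \<in> carrier (hom_group R (F n) M)" "h \<in> carrier (hom_group R (F n) M)"
    then have g: "g \<in> module_hom R (F n) M" and h: "h \<in> module_hom R (F n) M"
      by (simp_all add: hom_group_def)
    show "g \<otimes>\<^bsub>hom_group R (F n) M\<^esub> h \<in> carrier (hom_group R (F n) M)"
      using module_homD(1-3)[OF g] module_homD(1-3)[OF h]
      by (simp add: hom_group_def module_hom_def PiE_iff M.smult_r_distr M.a_ac)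
    show "g \<otimes>\<^bsub>hom_group R (F n) M\<^esub> h = h \<otimes>\<^bsub>hom_group R (F n) M\<^esub> g"
      using module_homD(1)[OF g] module_homD(1)[OF h]
      by (auto simp: hom_group_def fun_eq_iff restrict_def M.a_comm)
  next
    show "\<one>\<^bsub>hom_group R (F n) M\<^esub> \<in> carrier (hom_group R (F n) M)"
      by (simp add: hom_group_def module_hom_def PiE_iff)
  next
    fix g h k
    assume "g \<in> carrier (hom_group R (F n) M)" "h \<in> carrier (hom_group R (F n) M)"
      "k \<in> carrier (hom_group R (F n) M)"
    then have g: "g \<in> module_hom R (F n) M" and h: "h \<in> module_hom R (F n) M"
      and k: "k \<in> module_hom R (F n) M"
      by (simp_all add: hom_group_def)
    show "g \<otimes>\<^bsub>hom_group R (F n) M\<^esub> h \<otimes>\<^bsub>hom_group R (F n) M\<^esub> k =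
        g \<otimes>\<^bsub>hom_group R (F n) M\<^esub> (h \<otimes>\<^bsub>hom_group R (F n) M\<^esub> k)"
      using module_homD(1)[OF g] module_homD(1)[OF h] module_homD(1)[OF k]
      by (auto simp: hom_group_def fun_eq_iff restrict_def M.a_assoc)
  next
    fix g assume "g \<in> carrier (hom_group R (F n) M)"
    then have g: "g \<in> module_hom R (F n) M" by (simp add: hom_group_def)
    show "\<one>\<^bsub>hom_group R (F n) M\<^esub> \<otimes>\<^bsub>hom_group R (F n) M\<^esub> g = g"
      using module_homD(1)[OF g] extensional_arb[OF module_homD(4)[OF g]]
      by (auto simp: hom_group_def fun_eq_iff restrict_def)
    define g' where "g' = (\<lambda>x\<in>carrier (F n). \<ominus>\<^bsub>M\<^esub> g x)"
    have "g' \<in> module_hom R (F n) M"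
      using module_homD(1-3)[OF g]
      by (simp add: g'_def module_hom_def PiE_iff M.minus_add M.smult_r_minus)
    moreover have "g' \<otimes>\<^bsub>hom_group R (F n) M\<^esub> g = \<one>\<^bsub>hom_group R (F n) M\<^esub>"
      using module_homD(1)[OF g]
      by (auto simp: g'_def hom_group_def fun_eq_iff restrict_def M.l_neg)
    ultimately show "\<exists>h\<in>carrier (hom_group R (F n) M).
        h \<otimes>\<^bsub>hom_group R (F n) M\<^esub> g = \<one>\<^bsub>hom_group R (F n) M\<^esub>"
      by (auto simp: hom_group_def)
  qed
qed

lemma module_hom_zero:
  assumes "module R M" and g: "g \<in> module_hom R (F n) M"
  shows "g (zero (F n)) = \<zero>\<^bsub>M\<^esub>"
proof -
  interpret M: module R M by fact
  have "g (0 \<odot>\<^bsub>F n\<^esub> zero (F n)) = 0 \<odot>\<^bsub>M\<^esub> g (zero (F n))"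
    by (rule module_homD(3)[OF g]) auto
  then show ?thesis
    using module_homD(1)[OF g, of "zero (F n)"] M.smult_l_null by (simp add: F_smult_zero)
qed

lemma module_hom_compose:
  assumes h: "h \<in> module_hom R (F a) M" and d: "d \<in> module_hom R (F n) (F a)"
  shows "compose (carrier (F n)) h d \<in> module_hom R (F n) M"
  using module_homD(1-3)[OF h] module_homD(1-3)[OF d]
  by (simp add: module_hom_def PiE_iff compose_def)

lemma compose_group_hom:
  assumes M: "module R M" and d: "d \<in> module_hom R (F n) (F a)"
  shows "group_hom (hom_group R (F a) M) (hom_group R (F n) M) (\<lambda>h. compose (carrier (F n)) h d)"
proof (rule group_hom.intro)
  show "Group.group (hom_group R (F a) M)" "Group.group (hom_group R (F n) M)"
    using hom_group_comm_group[OF M] by (simp_all add: comm_group.axioms(2))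
  have "(\<lambda>h. compose (carrier (F n)) h d) \<in> hom (hom_group R (F a) M) (hom_group R (F n) M)"
  proof (rule homI)
    fix g h assume "g \<in> carrier (hom_group R (F a) M)" "h \<in> carrier (hom_group R (F a) M)"
    then show "compose (carrier (F n)) (g \<otimes>\<^bsub>hom_group R (F a) M\<^esub> h) d =
        compose (carrier (F n)) g d \<otimes>\<^bsub>hom_group R (F n) M\<^esub> compose (carrier (F n)) h d"
      using module_homD(1)[OF d] by (auto simp: hom_group_def compose_def fun_eq_iff restrict_def)
  qed (simp add: hom_group_def module_hom_compose[OF _ d])
  then show "group_hom_axioms (hom_group R (F a) M) (hom_group R (F n) M)
      (\<lambda>h. compose (carrier (F n)) h d)"
    by (rule group_hom_axioms.intro)
qed

end

context free_complex
begin

lemma coboundaries_subgroup: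
  assumes "module R M"
  shows "subgroup (coboundaries R b d M i) (hom_group R (F (b i)) M)"
proof (cases i)
  case 0
  interpret comm_group "hom_group R (F (b 0)) M"
    using assms by (rule hom_group_comm_group)
  show ?thesis using triv_subgroup 0 by simp
next
  case (Suc j)
  interpret group_hom "hom_group R (F (b j)) M" "hom_group R (F (b (Suc j))) M"
    "\<lambda>h. compose (carrier (F (b (Suc j)))) h (d j)"
    using assms d_hom by (rule compose_group_hom)
  show ?thesis using img_is_subgroup Suc by (simp add: hom_group_def)
qed

lemma cocycles_subgroup:
  assumes M: "module R M"
  shows "subgroup (cocycles R b d M i) (hom_group R (F (b i)) M)"
proof -
  interpret M: module R M by fact
  interpret group_hom "hom_group R (F (b i)) M" "hom_group R (F (b (Suc i))) M"
    "\<lambda>h. compose (carrier (F (b (Suc i)))) h (d i)"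
    using assms d_hom by (rule compose_group_hom)
  have "cocycles R b d M i = kernel (hom_group R (F (b i)) M) (hom_group R (F (b (Suc i))) M)
      (\<lambda>h. compose (carrier (F (b (Suc i)))) h (d i))"
    by (auto simp: cocycles_def kernel_def hom_group_def compose_def fun_eq_iff restrict_def)
  then show ?thesis using subgroup_kernel by simp
qed

lemma coboundaries_subset_cocycles:
  assumes M: "module R M"
  shows "coboundaries R b d M i \<subseteq> cocycles R b d M i"
proof (cases i)
  case 0
  then show ?thesis
    using subgroup.one_closed[OF cocycles_subgroup[OF M, of 0]] by simp
next
  case (Suc j)
  show ?thesis
  proof
    fix h assume "h \<in> coboundaries R b d M i"
    then obtain g where g: "g \<in> module_hom R (F (b j)) M"
      and h: "h = compose (carrier (F (b (Suc j)))) g (d j)"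
      by (auto simp: Suc)
    have "g (d j (d (Suc j) y)) = \<zero>\<^bsub>M\<^esub>" if "y \<in> carrier (F (b (Suc (Suc j))))" for y
      using that by (simp add: d_d module_hom_zero[OF M g])
    then show "h \<in> cocycles R b d M i"
      using module_hom_compose[OF g d_hom] module_homD(1)[OF d_hom]
      by (simp add: cocycles_def Suc h compose_def)
  qed
qed

lemma trivial_cohomology_iff:
  assumes M: "module R M"
  shows "trivial_group (cohomology R b d M i) \<longleftrightarrow> cocycles R b d M i \<subseteq> coboundaries R b d M i"
proof -
  define Z where "Z = (hom_group R (F (b i)) M)\<lparr>carrier := cocycles R b d M i\<rparr>"
  interpret H: comm_group "hom_group R (F (b i)) M"
    using M by (rule hom_group_comm_group)
  interpret Z: comm_group Z
    unfolding Z_def using cocycles_subgroup[OF M]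
    by (intro group.group_comm_groupI H.subgroup_imp_group)
      (auto simp: H.m_comm subgroup.mem_carrier[OF cocycles_subgroup[OF M]])
  have "subgroup (coboundaries R b d M i) Z"
    unfolding Z_def using M
    by (intro H.subgroup_incl coboundaries_subgroup cocycles_subgroup coboundaries_subset_cocycles)
  from Z.trivial_Mod_iff[OF this] show ?thesis
    by (simp add: cohomology_def Z_def)
qed

end

context class_ring
begin

abbreviation coset :: "'r set \<Rightarrow> 'r \<Rightarrow> 'r set" where
  "coset I r \<equiv> I +>\<^bsub>R\<^esub> r"

lemma coset_eq_iff:
  assumes "ideal I R" "r \<in> carrier R" "s \<in> carrier R"
  shows "coset I r = coset I s \<longleftrightarrow> r - s \<in> I"
  using ring.quotient_eq_iff_same_a_r_cos[OF ring_R assms] assms by (simp add: a_minus_def)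

lemma quotient_module_simps:
  assumes I: "ideal I R"
  shows "carrier (quotient_module R I) = coset I ` carrier R"
    and "\<zero>\<^bsub>quotient_module R I\<^esub> = coset I 0"
    and "r \<in> carrier R \<Longrightarrow> s \<in> carrier R \<Longrightarrow>
      coset I r \<oplus>\<^bsub>quotient_module R I\<^esub> coset I s = coset I (r + s)"
    and "r \<in> carrier R \<Longrightarrow> s \<in> carrier R \<Longrightarrow>
      r \<odot>\<^bsub>quotient_module R I\<^esub> coset I s = coset I (r * s)"
proof -
  interpret ideal I R by fact
  show "carrier (quotient_module R I) = coset I ` carrier R"
    by (auto simp: quotient_module_def FactRing_def A_RCOSETS_def')
  have "coset I 0 = I"
    using a_coset_join2[of 0 I] a_subgroup additive_subgroup.zero_closed[OF additive_subgroup_axioms]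
    by simp
  then show "\<zero>\<^bsub>quotient_module R I\<^esub> = coset I 0"
    by (simp add: quotient_module_def FactRing_simps)
  show "coset I r \<oplus>\<^bsub>quotient_module R I\<^esub> coset I s = coset I (r + s)"
    if "r \<in> carrier R" "s \<in> carrier R"
    using a_rcos_sum[OF that] by (simp add: quotient_module_def FactRing_simps)
  show "r \<odot>\<^bsub>quotient_module R I\<^esub> coset I s = coset I (r * s)"
    if "r \<in> carrier R" "s \<in> carrier R"
    using rcoset_mult_add[OF that] by (simp add: quotient_module_def FactRing_simps)
qed

lemma quotient_module_module:
  assumes I: "ideal I R"
  shows "module R (quotient_module R I)"
proof (rule moduleI[OF cring_R])
  show "abelian_group (quotient_module R I)"
  proof (rule abelian_groupI)
    fix X assume "X \<in> carrier (quotient_module R I)"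
    then obtain r where "r \<in> carrier R" "X = coset I r"
      by (auto simp: quotient_module_simps[OF I])
    then show "\<exists>Y\<in>carrier (quotient_module R I). Y \<oplus>\<^bsub>quotient_module R I\<^esub> X = \<zero>\<^bsub>quotient_module R I\<^esub>"
      by (intro bexI[of _ "coset I (- r)"]) (auto simp: quotient_module_simps[OF I])
  qed (auto simp: quotient_module_simps[OF I] algebra_simps)
qed (auto simp: quotient_module_simps[OF I] algebra_simps)

lemma coset_functional_hom:
  assumes I: "ideal I R" and h: "h \<in> functionals n"
  shows "(\<lambda>y\<in>carrier (F n). coset I (h y)) \<in> module_hom R (F n) (quotient_module R I)"
  using functionalsD[OF h] by (simp add: module_hom_def PiE_iff quotient_module_simps[OF I])

lemma module_hom_lift:
  assumes I: "ideal I R" and g: "g \<in> module_hom R (F n) (quotient_module R I)"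
  obtains h where "h \<in> functionals n" "\<And>y. y \<in> carrier (F n) \<Longrightarrow> g y = coset I (h y)"
proof -
  have "\<exists>r\<in>carrier R. g (basis_vec n j) = coset I r" if "j < n" for j
    using module_homD(1)[OF g, of "basis_vec n j"] by (auto simp: quotient_module_simps[OF I])
  then obtain c where c: "\<And>j. j < n \<Longrightarrow> c j \<in> carrier R \<and> g (basis_vec n j) = coset I (c j)"
    by metis
  have f: "dot n c \<in> functionals n" using c by (intro dot_functional) auto
  have "g y = coset I (dot n c y)" if "y \<in> carrier (F n)" for y
    using that
    by (rule free_module_induct)
      (simp_all add: module_hom_zero[OF quotient_module_module[OF I] g] functional_zero[OF f]
        quotient_module_simps[OF I] module_homD(1-3)[OF g] functionalsD[OF f] c)
  with f show thesis by (rule that)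
qed

end

context free_complex
begin

lemma cocycle_mod_iff:
  assumes I: "ideal I R" and h: "h \<in> functionals (b i)"
  shows "cocycle_mod I i h \<longleftrightarrow>
    (\<lambda>y\<in>carrier (F (b i)). coset I (h y)) \<in> cocycles R b d (quotient_module R I) i"
  using h coset_functional_hom[OF I h] module_homD(1)[OF d_hom]
    functionalsD(1)[OF functionals_compose[OF h d_hom]]
  by (auto simp: cocycle_mod_def cocycles_def quotient_module_simps[OF I] coset_eq_iff[OF I])

lemma coboundary_mod_iff:
  assumes I: "ideal I R" and h: "h \<in> functionals (b i)"
  shows "coboundary_mod I i h \<longleftrightarrow>
    (\<lambda>y\<in>carrier (F (b i)). coset I (h y)) \<in> coboundaries R b d (quotient_module R I) i"
    (is "_ \<longleftrightarrow> ?h \<in> _")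
proof (cases i)
  case 0
  have "coboundary_mod I i h \<longleftrightarrow> (\<forall>y\<in>carrier (F (b 0)). h y \<in> I)"
    using functionals_zero
    by (auto simp: coboundary_mod_def 0 functional_zero intro!: bexI[of _ "\<lambda>_. 0"])
  also have "\<dots> \<longleftrightarrow> ?h \<in> coboundaries R b d (quotient_module R I) i"
    using functionalsD(1)[OF h] 0
    by (auto simp: hom_group_def fun_eq_iff restrict_def quotient_module_simps[OF I]
        coset_eq_iff[OF I])
  finally show ?thesis .
next
  case (Suc j)
  have eq: "h y - g (d j y) \<in> I \<longleftrightarrow> coset I (h y) = coset I (g (d j y))"
    if "g \<in> functionals (b j)" "y \<in> carrier (F (b i))" for g y
    using coset_eq_iff[OF I] functionalsD(1)[OF h that(2)]
      functionalsD(1)[OF functionals_compose[OF that(1) d_hom]] that(2) Suc by auto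
  show ?thesis
  proof
    assume "coboundary_mod I i h"
    then obtain g where g: "g \<in> functionals (b j)"
      and hg: "\<And>y. y \<in> carrier (F (b i)) \<Longrightarrow> coset I (h y) = coset I (g (d j y))"
      using eq by (auto simp: coboundary_mod_def Suc)
    have "?h = compose (carrier (F (b i))) (\<lambda>y\<in>carrier (F (b j)). coset I (g y)) (d j)"
      using hg module_homD(1)[OF d_hom] Suc by (auto simp: compose_def fun_eq_iff restrict_def)
    then show "?h \<in> coboundaries R b d (quotient_module R I) i"
      using coset_functional_hom[OF I g] Suc by auto
  next
    assume "?h \<in> coboundaries R b d (quotient_module R I) i"
    then obtain g' where g': "g' \<in> module_hom R (F (b j)) (quotient_module R I)"
      and hg': "?h = compose (carrier (F (b i))) g' (d j)"
      by (auto simp: Suc)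
    obtain g where g: "g \<in> functionals (b j)"
      and gg': "\<And>y. y \<in> carrier (F (b j)) \<Longrightarrow> g' y = coset I (g y)"
      using module_hom_lift[OF I g'] by blast
    have "coset I (h y) = coset I (g (d j y))" if "y \<in> carrier (F (b i))" for y
      using fun_cong[OF hg', of y] that gg' module_homD(1)[OF d_hom] Suc
      by (simp add: compose_def)
    then show "coboundary_mod I i h"
      using g eq by (auto simp: coboundary_mod_def Suc)
  qed
qed

lemma trivial_cohomology_vanishing:
  assumes I: "ideal I R"
  shows "trivial_group (cohomology R b d (quotient_module R I) i) \<longleftrightarrow> vanishing I i"
  unfolding trivial_cohomology_iff[OF quotient_module_module[OF I]]
proof
  assume "cocycles R b d (quotient_module R I) i \<subseteq> coboundaries R b d (quotient_module R I) i"
  then show "vanishing I i"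
    using cocycle_mod_iff[OF I] coboundary_mod_iff[OF I]
    by (auto simp: vanishing_def cocycle_mod_def)
next
  assume van: "vanishing I i"
  show "cocycles R b d (quotient_module R I) i \<subseteq> coboundaries R b d (quotient_module R I) i"
  proof
    fix h' assume h': "h' \<in> cocycles R b d (quotient_module R I) i"
    then have hom: "h' \<in> module_hom R (F (b i)) (quotient_module R I)"
      by (simp add: cocycles_def)
    obtain h where h: "h \<in> functionals (b i)"
      and hh': "\<And>y. y \<in> carrier (F (b i)) \<Longrightarrow> h' y = coset I (h y)"
      using module_hom_lift[OF I hom] by blast
    have eq: "h' = (\<lambda>y\<in>carrier (F (b i)). coset I (h y))"
      using hh' extensional_arb[OF module_homD(4)[OF hom]] by (auto simp: fun_eq_iff restrict_def)
    with h' van show "h' \<in> coboundaries R b d (quotient_module R I) i"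
      using cocycle_mod_iff[OF I h] coboundary_mod_iff[OF I h] by (simp add: vanishing_def)
  qed
qed

end

section \<open>Multiplication by an element that kills the resolved module\<close>

context free_complex
begin

text \<open>Only two consecutive components of the null-homotopy of multiplication by \<open>x\<close> matter in
  each degree.\<close>

context
  fixes x :: 'r
  assumes x: "x \<in> carrier R"
    and exact: "\<And>i y. y \<in> carrier (F (b (Suc i))) \<Longrightarrow> d i y = zero (F (b i)) \<Longrightarrow>
      \<exists>z\<in>carrier (F (b (Suc (Suc i)))). d (Suc i) z = y"
    and kills: "\<And>y. y \<in> carrier (F (b 0)) \<Longrightarrow> \<exists>z\<in>carrier (F (b (Suc 0))). d 0 z = x \<odot>\<^bsub>F (b 0)\<^esub> y"
begin

lemma homotopy_start:
  obtains s where "s \<in> module_hom R (F (b 0)) (F (b (Suc 0)))"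
    "\<And>y. y \<in> carrier (F (b 0)) \<Longrightarrow> d 0 (s y) = x \<odot>\<^bsub>F (b 0)\<^esub> y"
proof -
  obtain s where s: "s \<in> module_hom R (F (b 0)) (F (b (Suc 0)))"
    and basis: "\<And>j. j < b 0 \<Longrightarrow> d 0 (s (basis_vec (b 0) j)) = x \<odot>\<^bsub>F (b 0)\<^esub> basis_vec (b 0) j"
    by (rule module_hom_basis_exists
        [of "b 0" "b (Suc 0)" "\<lambda>j z. d 0 z = x \<odot>\<^bsub>F (b 0)\<^esub> basis_vec (b 0) j"]) (use kills in auto)
  have d0: "d 0 \<in> module_hom R (F (b (Suc 0))) (F (b 0))" using d_hom[of 0] by simp
  have "d 0 (s y) = x \<odot>\<^bsub>F (b 0)\<^esub> y" if "y \<in> carrier (F (b 0))" for y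
    using that
  proof (rule free_module_induct)
    show "d 0 (s (zero (F (b 0)))) = x \<odot>\<^bsub>F (b 0)\<^esub> zero (F (b 0))"
      unfolding F_hom_zero[OF s] F_hom_zero[OF d0] by (simp add: F_simps cong: restrict_cong)
  next
    fix y r j assume y: "y \<in> carrier (F (b 0))" "d 0 (s y) = x \<odot>\<^bsub>F (b 0)\<^esub> y"
      and r: "r \<in> carrier R" and j: "j < b 0"
    show "d 0 (s (y \<oplus>\<^bsub>F (b 0)\<^esub> r \<odot>\<^bsub>F (b 0)\<^esub> basis_vec (b 0) j)) =
        x \<odot>\<^bsub>F (b 0)\<^esub> (y \<oplus>\<^bsub>F (b 0)\<^esub> r \<odot>\<^bsub>F (b 0)\<^esub> basis_vec (b 0) j)"
      by (simp add: module_homD(1-3)[OF s] module_homD(1-3)[OF d0] y r basis j)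
        (simp add: F_simps algebra_simps cong: restrict_cong)
  qed
  with s show thesis by (rule that)
qed

text \<open>The invariant carried upwards is only that d s d equals x d. It makes x y - s (d y) a
  cycle, exactness lifts it to define \<open>s'\<close>, and the last conclusion is the same
  invariant one degree higher.\<close>

lemma homotopy_step:
  assumes s: "s \<in> module_hom R (F (b i)) (F (b (Suc i)))"
    and dsd: "\<And>y. y \<in> carrier (F (b (Suc i))) \<Longrightarrow> d i (s (d i y)) = x \<odot>\<^bsub>F (b i)\<^esub> d i y"
  obtains s' where "s' \<in> module_hom R (F (b (Suc i))) (F (b (Suc (Suc i))))"
    "\<And>y. y \<in> carrier (F (b (Suc i))) \<Longrightarrow> d (Suc i) (s' y) \<oplus>\<^bsub>F (b (Suc i))\<^esub> s (d i y) = x \<odot>\<^bsub>F (b (Suc i))\<^esub> y"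
    "\<And>y. y \<in> carrier (F (b (Suc (Suc i)))) \<Longrightarrow>
      d (Suc i) (s' (d (Suc i) y)) = x \<odot>\<^bsub>F (b (Suc i))\<^esub> d (Suc i) y"
proof -
  define n where "n = b (Suc i)"
  have s: "s \<in> module_hom R (F (b i)) (F n)" using s by (simp add: n_def)
  have di: "d i \<in> module_hom R (F n) (F (b i))" using d_hom by (simp add: n_def)
  have dS: "d (Suc i) \<in> module_hom R (F (b (Suc (Suc i)))) (F n)" using d_hom by (simp add: n_def)
  have "\<exists>z\<in>carrier (F (b (Suc (Suc i)))). d (Suc i) z \<oplus>\<^bsub>F n\<^esub> s (d i y) = x \<odot>\<^bsub>F n\<^esub> y"
    if y: "y \<in> carrier (F n)" for y
  proof -
    define u where "u = x \<odot>\<^bsub>F n\<^esub> y \<oplus>\<^bsub>F n\<^esub> (- 1) \<odot>\<^bsub>F n\<^esub> s (d i y)"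
    have sdy: "s (d i y) \<in> carrier (F n)" using y s di by (simp add: module_homD)
    have u: "u \<in> carrier (F n)" using y sdy x by (simp add: u_def)
    have "d i u = x \<odot>\<^bsub>F (b i)\<^esub> d i y \<oplus>\<^bsub>F (b i)\<^esub> (- 1) \<odot>\<^bsub>F (b i)\<^esub> d i (s (d i y))"
      using y sdy x by (simp add: u_def module_homD(2,3)[OF di])
    also have "\<dots> = zero (F (b i))"
      using dsd y by (simp add: n_def F_simps cong: restrict_cong)
    finally obtain z where z: "z \<in> carrier (F (b (Suc (Suc i))))" "d (Suc i) z = u"
      using exact u by (auto simp: n_def)
    have "u \<oplus>\<^bsub>F n\<^esub> s (d i y) = x \<odot>\<^bsub>F n\<^esub> y"
      unfolding u_def F_simps by (rule restrict_ext) simp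
    with z show ?thesis by auto
  qed
  then obtain s' where s': "s' \<in> module_hom R (F n) (F (b (Suc (Suc i))))"
    and basis: "\<And>j. j < n \<Longrightarrow> d (Suc i) (s' (basis_vec n j)) \<oplus>\<^bsub>F n\<^esub> s (d i (basis_vec n j)) =
      x \<odot>\<^bsub>F n\<^esub> basis_vec n j"
    by (rule module_hom_basis_exists[of n "b (Suc (Suc i))"
        "\<lambda>j z. d (Suc i) z \<oplus>\<^bsub>F n\<^esub> s (d i (basis_vec n j)) = x \<odot>\<^bsub>F n\<^esub> basis_vec n j"]) auto
  have main: "d (Suc i) (s' y) \<oplus>\<^bsub>F n\<^esub> s (d i y) = x \<odot>\<^bsub>F n\<^esub> y" if "y \<in> carrier (F n)" for y
    using that
  proof (rule free_module_induct)
    show "d (Suc i) (s' (zero (F n))) \<oplus>\<^bsub>F n\<^esub> s (d i (zero (F n))) = x \<odot>\<^bsub>F n\<^esub> zero (F n)"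
      by (simp add: F_hom_zero[OF s] F_hom_zero[OF s'] F_hom_zero[OF di] F_hom_zero[OF dS])
        (simp add: F_simps cong: restrict_cong)
  next
    fix y r j assume y: "y \<in> carrier (F n)"
      and IH: "d (Suc i) (s' y) \<oplus>\<^bsub>F n\<^esub> s (d i y) = x \<odot>\<^bsub>F n\<^esub> y"
      and r: "r \<in> carrier R" and j: "j < n"
    let ?e = "basis_vec n j"
    have "d (Suc i) (s' (y \<oplus>\<^bsub>F n\<^esub> r \<odot>\<^bsub>F n\<^esub> ?e)) \<oplus>\<^bsub>F n\<^esub> s (d i (y \<oplus>\<^bsub>F n\<^esub> r \<odot>\<^bsub>F n\<^esub> ?e)) =
      (d (Suc i) (s' y) \<oplus>\<^bsub>F n\<^esub> r \<odot>\<^bsub>F n\<^esub> d (Suc i) (s' ?e)) \<oplus>\<^bsub>F n\<^esub>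
      (s (d i y) \<oplus>\<^bsub>F n\<^esub> r \<odot>\<^bsub>F n\<^esub> s (d i ?e))"
      by (simp add: module_homD(1-3)[OF s] module_homD(1-3)[OF s'] module_homD(1-3)[OF di]
          module_homD(1-3)[OF dS] y r)
    also have "\<dots> = (d (Suc i) (s' y) \<oplus>\<^bsub>F n\<^esub> s (d i y)) \<oplus>\<^bsub>F n\<^esub>
        r \<odot>\<^bsub>F n\<^esub> (d (Suc i) (s' ?e) \<oplus>\<^bsub>F n\<^esub> s (d i ?e))"
      unfolding F_simps by (rule restrict_ext) (simp add: algebra_simps)
    also have "\<dots> = x \<odot>\<^bsub>F n\<^esub> (y \<oplus>\<^bsub>F n\<^esub> r \<odot>\<^bsub>F n\<^esub> ?e)"
      unfolding IH basis[OF j] unfolding F_simps by (rule restrict_ext) (simp add: algebra_simps)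
    finally show "d (Suc i) (s' (y \<oplus>\<^bsub>F n\<^esub> r \<odot>\<^bsub>F n\<^esub> ?e)) \<oplus>\<^bsub>F n\<^esub> s (d i (y \<oplus>\<^bsub>F n\<^esub> r \<odot>\<^bsub>F n\<^esub> ?e)) =
        x \<odot>\<^bsub>F n\<^esub> (y \<oplus>\<^bsub>F n\<^esub> r \<odot>\<^bsub>F n\<^esub> ?e)" .
  qed
  have "d (Suc i) (s' (d (Suc i) y)) = x \<odot>\<^bsub>F n\<^esub> d (Suc i) y"
    if y: "y \<in> carrier (F (b (Suc (Suc i))))" for y
  proof -
    have dy: "d (Suc i) y \<in> carrier (F n)" using y dS by (simp add: module_homD)
    have m: "d (Suc i) (s' (d (Suc i) y)) \<in> carrier (F n)"
      using dy s' dS by (simp add: module_homD)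
    have "d (Suc i) (s' (d (Suc i) y)) = d (Suc i) (s' (d (Suc i) y)) \<oplus>\<^bsub>F n\<^esub> zero (F n)"
      by (rule F_eqI[OF m F_add_mem[OF m F_zero_mem]]) (simp add: F_simps)
    also have "zero (F n) = s (d i (d (Suc i) y))"
      using y by (simp add: d_d F_hom_zero[OF s])
    finally show ?thesis using main[OF dy] by simp
  qed
  then show thesis using that s' main by (simp add: n_def)
qed

lemma homotopy_exists:
  "\<exists>s. s \<in> module_hom R (F (b i)) (F (b (Suc i))) \<and>
    (\<forall>y\<in>carrier (F (b (Suc i))). d i (s (d i y)) = x \<odot>\<^bsub>F (b i)\<^esub> d i y)"
proof (induction i)
  case 0
  show ?case
    using homotopy_start module_homD(1)[OF d_hom[of 0]] by metis
next
  case (Suc i)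
  then obtain s where "s \<in> module_hom R (F (b i)) (F (b (Suc i)))"
    "\<And>y. y \<in> carrier (F (b (Suc i))) \<Longrightarrow> d i (s (d i y)) = x \<odot>\<^bsub>F (b i)\<^esub> d i y"
    by blast
  then show ?case using homotopy_step by metis
qed

text \<open>Since x = d s' + s d, a cocycle satisfies x h = h d s' + h s d; the first summand lies
  in \<open>I\<close> and the second is a coboundary. So \<open>x\<close> annihilates the
  cohomology.\<close>

lemma coboundary_mod_mult:
  assumes h: "cocycle_mod I i h"
  shows "coboundary_mod I i (\<lambda>y. x * h y)"
proof -
  have hf: "h \<in> functionals (b i)" and hd: "\<And>y. y \<in> carrier (F (b (Suc i))) \<Longrightarrow> h (d i y) \<in> I"
    using h by (auto simp: cocycle_mod_def)
  show ?thesis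
  proof (cases i)
    case 0
    obtain s where s: "s \<in> module_hom R (F (b 0)) (F (b (Suc 0)))"
      and ds: "\<And>y. y \<in> carrier (F (b 0)) \<Longrightarrow> d 0 (s y) = x \<odot>\<^bsub>F (b 0)\<^esub> y"
      using homotopy_start by blast
    have "x * h y \<in> I" if y: "y \<in> carrier (F (b 0))" for y
      using hd[of "s y"] ds[OF y] module_homD(1)[OF s y] functionalsD(3)[OF hf x, of y] y 0 by simp
    then show ?thesis
      unfolding coboundary_mod_def 0 by (intro bexI[of _ "\<lambda>_. 0"]) (simp_all add: functionals_zero)
  next
    case (Suc j)
    obtain s where s: "s \<in> module_hom R (F (b j)) (F (b (Suc j)))"
      and dsd: "\<And>y. y \<in> carrier (F (b (Suc j))) \<Longrightarrow> d j (s (d j y)) = x \<odot>\<^bsub>F (b j)\<^esub> d j y"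
      using homotopy_exists by blast
    obtain s' where s': "s' \<in> module_hom R (F (b (Suc j))) (F (b (Suc (Suc j))))"
      and hom: "\<And>y. y \<in> carrier (F (b (Suc j))) \<Longrightarrow>
        d (Suc j) (s' y) \<oplus>\<^bsub>F (b (Suc j))\<^esub> s (d j y) = x \<odot>\<^bsub>F (b (Suc j))\<^esub> y"
      using homotopy_step[OF s dsd] by metis
    have "x * h y - h (s (d j y)) \<in> I" if y: "y \<in> carrier (F (b (Suc j)))" for y
    proof -
      note dj = module_homD(1)[OF d_hom[of j] y]
      note s'y = module_homD(1)[OF s' y]
      have "x * h y = h (d (Suc j) (s' y)) + h (s (d j y))"
        using functionalsD(3)[OF hf x, of y] hom[OF y, symmetric] y Suc
          functionalsD(2)[OF hf, of "d (Suc j) (s' y)" "s (d j y)"]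
          module_homD(1)[OF s dj] module_homD(1)[OF d_hom s'y] by simp
      then show ?thesis using hd[of "s' y"] s'y Suc by simp
    qed
    then show ?thesis
      unfolding coboundary_mod_def Suc using functionals_compose[OF _ s, of h] hf Suc
      by (intro bexI[of _ "\<lambda>z. h (s z)"]) simp_all
  qed
qed

text \<open>Multiplication by \<open>x\<close> is zero on Ext; it is also injective there when (I :
  x) = I and the preceding Ext of R/I'' vanishes. Both together leave only zero.\<close>

lemma vanishing_regular:
  assumes I: "ideal I R"
    and reg: "\<And>r. r \<in> carrier R \<Longrightarrow> x * r \<in> I \<Longrightarrow> r \<in> I"
    and plus: "\<And>r. r \<in> carrier R \<Longrightarrow> r \<in> I'' \<longleftrightarrow> (\<exists>s\<in>carrier R. r - x * s \<in> I)"
    and van: "\<And>j. i = Suc j \<Longrightarrow> vanishing I'' j"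
  shows "vanishing I i"
  unfolding vanishing_def
proof (intro allI impI)
  fix h assume h: "cocycle_mod I i h"
  show "coboundary_mod I i h"
  proof (rule coboundary_mod_colon[OF I x _ plus van])
    show "r \<in> I \<longleftrightarrow> x * r \<in> I" if "r \<in> carrier R" for r
      using reg[OF that] idealD(5)[OF I x] by blast
    show "h \<in> functionals (b i)" using h by (simp add: cocycle_mod_def)
    show "coboundary_mod I i (\<lambda>y. x * h y)" using h by (rule coboundary_mod_mult)
  qed
qed

end

end

section \<open>Resolutions of cyclic modules by iterated mapping cones\<close>

context class_ring
begin

text \<open>A resolution of R/L whose augmentation is implicit: \<open>F 1\<close> is read as
  \<open>R\<close> through the coordinate 0. The equivalence in the last clause contains both d d =
  0 and exactness.\<close>

definition cyclic_resolution ::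
  "'r set \<Rightarrow> (nat \<Rightarrow> nat) \<Rightarrow> (nat \<Rightarrow> (nat \<Rightarrow> 'r) \<Rightarrow> (nat \<Rightarrow> 'r)) \<Rightarrow> bool" where
  "cyclic_resolution L b d \<longleftrightarrow>
     b 0 = 1 \<and> (\<forall>i. d i \<in> module_hom R (F (b (Suc i))) (F (b i))) \<and>
     (\<forall>y\<in>carrier (F 1). y \<in> d 0 ` carrier (F (b 1)) \<longleftrightarrow> y 0 \<in> L) \<and>
     (\<forall>i. \<forall>y\<in>carrier (F (b (Suc i))).
       y \<in> d (Suc i) ` carrier (F (b (Suc (Suc i)))) \<longleftrightarrow> d i y = zero (F (b i)))"

lemma cyclic_resolution_zero: "\<exists>b d. cyclic_resolution {0} b d"
proof (intro exI)
  define b where "b = (\<lambda>i::nat. if i = 0 then 1 else 0 :: nat)"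
  define d where "d = (\<lambda>i. \<lambda>y\<in>carrier (F 0). zero (F (b i)))"
  have "z \<oplus>\<^bsub>F n\<^esub> z = z" "r \<odot>\<^bsub>F n\<^esub> z = z" if "z = zero (F n)" for z n r
    unfolding that by (simp_all add: F_simps cong: restrict_cong)
  then have hom: "d i \<in> module_hom R (F 0) (F (b i))" for i
    by (simp add: module_hom_def PiE_iff d_def)
  have F0: "y = zero (F 0)" if "y \<in> carrier (F 0)" for y
    by (rule F_eqI[OF that]) auto
  have "y = zero (F 1) \<longleftrightarrow> y 0 = 0" if "y \<in> carrier (F 1)" for y
  proof
    assume "y 0 = 0"
    then show "y = zero (F 1)"
      by (intro F_eqI[OF that F_zero_mem]) (auto simp: F_simps(2))
  qed (simp add: F_simps)
  moreover have "d 0 ` carrier (F 0) = {zero (F 1)}"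
    by (auto simp: d_def b_def intro!: image_eqI[of _ _ "zero (F 0)"])
  moreover have "y \<in> d (Suc i) ` carrier (F 0)" "d i y = zero (F (b i))" if "y \<in> carrier (F 0)" for y i
    using F0[OF that] by (auto simp: d_def b_def intro!: image_eqI[of _ _ "zero (F 0)"])
  ultimately show "cyclic_resolution {0} b d"
    using hom by (simp add: cyclic_resolution_def b_def)
qed

definition left_part :: "nat \<Rightarrow> nat \<Rightarrow> (nat \<Rightarrow> 'r) \<Rightarrow> (nat \<Rightarrow> 'r)" where
  "left_part a n w = (\<lambda>j\<in>{..<a}. w j)"

definition right_part :: "nat \<Rightarrow> nat \<Rightarrow> (nat \<Rightarrow> 'r) \<Rightarrow> (nat \<Rightarrow> 'r)" where
  "right_part a n w = (\<lambda>j\<in>{..<n}. w (a + j))"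

definition join :: "nat \<Rightarrow> nat \<Rightarrow> (nat \<Rightarrow> 'r) \<Rightarrow> (nat \<Rightarrow> 'r) \<Rightarrow> (nat \<Rightarrow> 'r)" where
  "join a n y z = (\<lambda>j\<in>{..<a + n}. if j < a then y j else z (j - a))"

lemma parts_mem [simp]:
  "w \<in> carrier (F (a + n)) \<Longrightarrow> left_part a n w \<in> carrier (F a)"
  "w \<in> carrier (F (a + n)) \<Longrightarrow> right_part a n w \<in> carrier (F n)"
  "y \<in> carrier (F a) \<Longrightarrow> z \<in> carrier (F n) \<Longrightarrow> join a n y z \<in> carrier (F (a + n))"
  by (simp_all add: F_simps left_part_def right_part_def join_def PiE_iff)

lemma parts_linear:
  "left_part a n (v \<oplus>\<^bsub>F (a + n)\<^esub> w) = left_part a n v \<oplus>\<^bsub>F a\<^esub> left_part a n w"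
  "right_part a n (v \<oplus>\<^bsub>F (a + n)\<^esub> w) = right_part a n v \<oplus>\<^bsub>F n\<^esub> right_part a n w"
  "left_part a n (r \<odot>\<^bsub>F (a + n)\<^esub> w) = r \<odot>\<^bsub>F a\<^esub> left_part a n w"
  "right_part a n (r \<odot>\<^bsub>F (a + n)\<^esub> w) = r \<odot>\<^bsub>F n\<^esub> right_part a n w"
  "join a n (y \<oplus>\<^bsub>F a\<^esub> y') (z \<oplus>\<^bsub>F n\<^esub> z') = join a n y z \<oplus>\<^bsub>F (a + n)\<^esub> join a n y' z'"
  "join a n (r \<odot>\<^bsub>F a\<^esub> y) (r \<odot>\<^bsub>F n\<^esub> z) = r \<odot>\<^bsub>F (a + n)\<^esub> join a n y z"
  "join a n (zero (F a)) (zero (F n)) = zero (F (a + n))"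
  by (auto simp: F_simps left_part_def right_part_def join_def fun_eq_iff restrict_def)

lemma parts_join [simp]:
  "y \<in> carrier (F a) \<Longrightarrow> left_part a n (join a n y z) = y"
  "z \<in> carrier (F n) \<Longrightarrow> right_part a n (join a n y z) = z"
  "w \<in> carrier (F (a + n)) \<Longrightarrow> join a n (left_part a n w) (right_part a n w) = w"
  unfolding F_simps
  by (auto simp: left_part_def right_part_def join_def fun_eq_iff restrict_def PiE_iff extensional_def)

text \<open>Ranks of the mapping cone of multiplication by \<open>x\<close>: the shifted copy of the
  complex starts in degree 1, so degree 0 has only the old \<open>F 1\<close>.\<close>

definition cone_rank :: "(nat \<Rightarrow> nat) \<Rightarrow> nat \<Rightarrow> nat" where
  "cone_rank b i = (case i of 0 \<Rightarrow> 1 | Suc j \<Rightarrow> b (Suc j) + b j)"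

text \<open>The cone differential sends (y, z) to (d y + x z, - d z); the sign makes its square
  vanish. For \<open>i = 0\<close> the second component has no target.\<close>

definition cone_map :: "'r \<Rightarrow> (nat \<Rightarrow> nat) \<Rightarrow> (nat \<Rightarrow> (nat \<Rightarrow> 'r) \<Rightarrow> (nat \<Rightarrow> 'r)) \<Rightarrow>
    nat \<Rightarrow> (nat \<Rightarrow> 'r) \<Rightarrow> (nat \<Rightarrow> 'r)" where
  "cone_map x b d i = (\<lambda>w\<in>carrier (F (b (Suc i) + b i)).
     let y = left_part (b (Suc i)) (b i) w; z = right_part (b (Suc i)) (b i) w;
       u = d i y \<oplus>\<^bsub>F (b i)\<^esub> x \<odot>\<^bsub>F (b i)\<^esub> z
     in case i of 0 \<Rightarrow> u | Suc j \<Rightarrow> join (b (Suc j)) (b j) u ((- 1) \<odot>\<^bsub>F (b j)\<^esub> d j z))"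

text \<open>Regularity of \<open>x\<close> on R/L enters for exactness in degree 1, where a cycle
  (y, z) satisfies x * z 0 \<in> L, hence z 0 \<in> L. In higher degrees exactness of the given
  resolution does the same work.\<close>

lemma cone_cyclic_resolution:
  assumes L: "ideal L R" and res: "cyclic_resolution L b d" and x: "x \<in> carrier R"
    and reg: "\<And>r. r \<in> carrier R \<Longrightarrow> x * r \<in> L \<Longrightarrow> r \<in> L"
    and plus: "\<And>r. r \<in> carrier R \<Longrightarrow> r \<in> L' \<longleftrightarrow> (\<exists>s\<in>carrier R. r - x * s \<in> L)"
  shows "cyclic_resolution L' (cone_rank b) (cone_map x b d)"
proof -
  let ?c = "cone_map x b d"
  have b0: "b 0 = 1" and hom: "\<And>i. d i \<in> module_hom R (F (b (Suc i))) (F (b i))"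
    and im0: "\<And>y. y \<in> carrier (F (b 0)) \<Longrightarrow> y \<in> d 0 ` carrier (F (b (Suc 0))) \<longleftrightarrow> y 0 \<in> L"
    and ex: "\<And>i y. y \<in> carrier (F (b (Suc i))) \<Longrightarrow>
      y \<in> d (Suc i) ` carrier (F (b (Suc (Suc i)))) \<longleftrightarrow> d i y = zero (F (b i))"
    using res by (auto simp: cyclic_resolution_def)
  note dmem = module_homD(1)[OF hom]
  have dd: "d i (d (Suc i) y) = zero (F (b i))" if "y \<in> carrier (F (b (Suc (Suc i))))" for i y
    using ex[of "d (Suc i) y" i] dmem that by blast
  have rank: "cone_rank b 0 = b 0" "cone_rank b (Suc i) = b (Suc i) + b i" for i
    by (simp_all add: cone_rank_def b0)
  have c0: "?c 0 w = d 0 (left_part (b 1) (b 0) w) \<oplus>\<^bsub>F (b 0)\<^esub> x \<odot>\<^bsub>F (b 0)\<^esub> right_part (b 1) (b 0) w"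
    if "w \<in> carrier (F (b 1 + b 0))" for w
    using that by (simp add: cone_map_def Let_def)
  have cS: "?c (Suc i) w = join (b (Suc i)) (b i)
      (d (Suc i) (left_part (b (Suc (Suc i))) (b (Suc i)) w) \<oplus>\<^bsub>F (b (Suc i))\<^esub>
        x \<odot>\<^bsub>F (b (Suc i))\<^esub> right_part (b (Suc (Suc i))) (b (Suc i)) w)
      ((- 1) \<odot>\<^bsub>F (b i)\<^esub> d i (right_part (b (Suc (Suc i))) (b (Suc i)) w))"
    if "w \<in> carrier (F (b (Suc (Suc i)) + b (Suc i)))" for i w
    using that by (simp add: cone_map_def Let_def)
  have add4: "(p \<oplus>\<^bsub>F m\<^esub> q) \<oplus>\<^bsub>F m\<^esub> (p' \<oplus>\<^bsub>F m\<^esub> q') = (p \<oplus>\<^bsub>F m\<^esub> p') \<oplus>\<^bsub>F m\<^esub> (q \<oplus>\<^bsub>F m\<^esub> q')"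
    "r \<odot>\<^bsub>F m\<^esub> (p \<oplus>\<^bsub>F m\<^esub> q) = r \<odot>\<^bsub>F m\<^esub> p \<oplus>\<^bsub>F m\<^esub> r \<odot>\<^bsub>F m\<^esub> q"
    "r \<odot>\<^bsub>F m\<^esub> (r' \<odot>\<^bsub>F m\<^esub> p) = r' \<odot>\<^bsub>F m\<^esub> (r \<odot>\<^bsub>F m\<^esub> p)" for m p q p' q' r r'
    unfolding F_simps by (rule restrict_ext, simp add: algebra_simps)+
  have c_hom: "?c i \<in> module_hom R (F (cone_rank b (Suc i))) (F (cone_rank b i))" for i
  proof -
    have 1: "?c i w \<in> carrier (F (cone_rank b i))" if "w \<in> carrier (F (b (Suc i) + b i))" for w
      using that x by (cases i) (simp_all add: c0 cS rank dmem)
    have 2: "?c i (v \<oplus>\<^bsub>F (b (Suc i) + b i)\<^esub> w) = ?c i v \<oplus>\<^bsub>F (cone_rank b i)\<^esub> ?c i w"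
      if "v \<in> carrier (F (b (Suc i) + b i))" "w \<in> carrier (F (b (Suc i) + b i))" for v w
      using that by (cases i)
        (simp_all add: c0 cS rank dmem parts_linear(1-4) parts_linear(5)[symmetric]
          module_homD(2)[OF hom] add4)
    have 3: "?c i (r \<odot>\<^bsub>F (b (Suc i) + b i)\<^esub> w) = r \<odot>\<^bsub>F (cone_rank b i)\<^esub> ?c i w"
      if "r \<in> carrier R" "w \<in> carrier (F (b (Suc i) + b i))" for r w
      using that by (cases i)
        (simp_all add: c0 cS rank dmem parts_linear(1-4) parts_linear(6)[symmetric]
          module_homD(3)[OF hom] add4(2) add4(3)[of _ r])
    show ?thesis
      using 1 2 3 by (simp add: module_hom_def PiE_iff rank(2)) (simp add: cone_map_def)
  qed
  \<comment> \<open>Choosing \<open>z'\<close> with d z' = - z makes y - x z' a cycle, say d y'; the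
    pair (y', z') is then sent to (y, z).\<close>
  have lift: "\<exists>w\<in>carrier (F (b (Suc (Suc i)) + b (Suc i))). ?c (Suc i) w = join (b (Suc i)) (b i) y z"
    if y: "y \<in> carrier (F (b (Suc i)))" and z: "z \<in> carrier (F (b i))"
      and eq: "d i y \<oplus>\<^bsub>F (b i)\<^esub> x \<odot>\<^bsub>F (b i)\<^esub> z = zero (F (b i))"
      and z': "z' \<in> carrier (F (b (Suc i)))" "d i z' = (- 1) \<odot>\<^bsub>F (b i)\<^esub> z" for i y z z'
  proof -
    define u where "u = y \<oplus>\<^bsub>F (b (Suc i))\<^esub> (- x) \<odot>\<^bsub>F (b (Suc i))\<^esub> z'"
    have u: "u \<in> carrier (F (b (Suc i)))" using y z' x by (simp add: u_def)
    have "d i u = d i y \<oplus>\<^bsub>F (b i)\<^esub> (- x) \<odot>\<^bsub>F (b i)\<^esub> ((- 1) \<odot>\<^bsub>F (b i)\<^esub> z)"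
      using y z' x by (simp add: u_def module_homD(2,3)[OF hom])
    also have "\<dots> = d i y \<oplus>\<^bsub>F (b i)\<^esub> x \<odot>\<^bsub>F (b i)\<^esub> z"
      unfolding F_simps by (rule restrict_ext) simp
    finally obtain y' where y': "y' \<in> carrier (F (b (Suc (Suc i))))" "d (Suc i) y' = u"
      using ex[OF u] eq by auto
    have "?c (Suc i) (join (b (Suc (Suc i))) (b (Suc i)) y' z') =
      join (b (Suc i)) (b i) (u \<oplus>\<^bsub>F (b (Suc i))\<^esub> x \<odot>\<^bsub>F (b (Suc i))\<^esub> z')
        ((- 1) \<odot>\<^bsub>F (b i)\<^esub> ((- 1) \<odot>\<^bsub>F (b i)\<^esub> z))"
      using y' z' by (simp add: cS)
    also have "(- 1) \<odot>\<^bsub>F (b i)\<^esub> ((- 1) \<odot>\<^bsub>F (b i)\<^esub> z) = z"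
      by (rule F_eqI[OF _ z]) (use z in simp, simp add: F_simps(4))
    also have "u \<oplus>\<^bsub>F (b (Suc i))\<^esub> x \<odot>\<^bsub>F (b (Suc i))\<^esub> z' = y"
      by (rule F_eqI[OF _ y]) (use u z' x in simp, simp add: u_def F_simps(3,4))
    finally show ?thesis using y' z' by (intro bexI[of _ "join (b (Suc (Suc i))) (b (Suc i)) y' z'"]) simp_all
  qed
  have c_im0: "y \<in> ?c 0 ` carrier (F (b 1 + b 0)) \<longleftrightarrow> y 0 \<in> L'" if y: "y \<in> carrier (F 1)" for y
  proof
    assume "y \<in> ?c 0 ` carrier (F (b 1 + b 0))"
    then obtain w where w: "w \<in> carrier (F (b 1 + b 0))" and yw: "y = ?c 0 w" by blast
    define p q where "p = d 0 (left_part (b 1) (b 0) w)" and "q = right_part (b 1) (b 0) w"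
    have p: "p \<in> carrier (F (b 0))" "p 0 \<in> L"
      using w dmem[of _ 0] im0[of p] by (auto simp: p_def)
    have q: "q 0 \<in> carrier R" using w F_coord[of q "b 0" 0] b0 by (simp add: q_def)
    have "y 0 = p 0 + x * q 0"
      unfolding yw c0[OF w] p_def q_def using b0 by (simp add: F_simps)
    then show "y 0 \<in> L'"
      using plus[of "y 0"] F_coord[OF y, of 0] p(2) q by (auto intro!: bexI[of _ "q 0"])
  next
    assume "y 0 \<in> L'"
    then obtain s where s: "s \<in> carrier R" "y 0 - x * s \<in> L"
      using plus F_coord[OF y, of 0] by auto
    define u where "u = (\<lambda>j\<in>{..<b 0}. y 0 - x * s)"
    define z where "z = (\<lambda>j\<in>{..<b 0}. s)"
    have z: "z \<in> carrier (F (b 0))" using s by (simp add: z_def F_simps)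
    have u: "u \<in> carrier (F (b 0))" "u 0 \<in> L"
      using s F_coord[OF y, of 0] x by (auto simp: u_def F_simps b0)
    then obtain v where v: "v \<in> carrier (F (b 1))" "u = d 0 v"
      using im0 by auto
    have "?c 0 (join (b 1) (b 0) v z) = u \<oplus>\<^bsub>F (b 0)\<^esub> x \<odot>\<^bsub>F (b 0)\<^esub> z"
      using v z by (simp add: c0)
    also have "\<dots> = y"
      by (rule F_eqI[OF _ y])
        (use u(1) z x b0 F_add_mem F_smult_mem in metis, simp add: F_simps(3,4) u_def z_def b0)
    finally show "y \<in> ?c 0 ` carrier (F (b 1 + b 0))"
      using v z by (intro image_eqI[of _ _ "join (b 1) (b 0) v z"]) simp_all
  qed
  have c_exact: "w \<in> ?c (Suc i) ` carrier (F (cone_rank b (Suc (Suc i)))) \<longleftrightarrow>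
      ?c i w = zero (F (cone_rank b i))" if w: "w \<in> carrier (F (cone_rank b (Suc i)))" for w i
  proof
    assume "w \<in> ?c (Suc i) ` carrier (F (cone_rank b (Suc (Suc i))))"
    then obtain v where v: "v \<in> carrier (F (b (Suc (Suc i)) + b (Suc i)))" and wv: "w = ?c (Suc i) v"
      by (auto simp: rank)
    define y where "y = left_part (b (Suc (Suc i))) (b (Suc i)) v"
    define z where "z = right_part (b (Suc (Suc i))) (b (Suc i)) v"
    have y: "y \<in> carrier (F (b (Suc (Suc i))))" and z: "z \<in> carrier (F (b (Suc i)))"
      using v by (simp_all add: y_def z_def)
    have w_eq: "w = join (b (Suc i)) (b i) (d (Suc i) y \<oplus>\<^bsub>F (b (Suc i))\<^esub> x \<odot>\<^bsub>F (b (Suc i))\<^esub> z)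
        ((- 1) \<odot>\<^bsub>F (b i)\<^esub> d i z)"
      unfolding wv cS[OF v] y_def z_def ..
    have first: "d i (d (Suc i) y \<oplus>\<^bsub>F (b (Suc i))\<^esub> x \<odot>\<^bsub>F (b (Suc i))\<^esub> z) \<oplus>\<^bsub>F (b i)\<^esub>
        x \<odot>\<^bsub>F (b i)\<^esub> ((- 1) \<odot>\<^bsub>F (b i)\<^esub> d i z) = zero (F (b i))"
      using y z x by (simp add: module_homD(2,3)[OF hom] dmem dd)
        (simp add: F_simps cong: restrict_cong)
    show "?c i w = zero (F (cone_rank b i))"
    proof (cases i)
      case 0
      then show ?thesis
        using first y z x w by (simp add: c0 w_eq rank dmem)
    next
      case (Suc j)
      have "(- 1) \<odot>\<^bsub>F (b j)\<^esub> d j ((- 1) \<odot>\<^bsub>F (b i)\<^esub> d i z) = zero (F (b j))"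
        using z Suc by (simp add: module_homD(3)[OF hom] dmem dd) (simp add: F_simps cong: restrict_cong)
      then show ?thesis
        using first y z x w Suc by (simp add: cS w_eq rank dmem parts_linear(7))
    qed
  next
    assume cw: "?c i w = zero (F (cone_rank b i))"
    define y where "y = left_part (b (Suc i)) (b i) w"
    define z where "z = right_part (b (Suc i)) (b i) w"
    have w': "w \<in> carrier (F (b (Suc i) + b i))" using w by (simp add: rank)
    have y: "y \<in> carrier (F (b (Suc i)))" and z: "z \<in> carrier (F (b i))"
      using w' by (simp_all add: y_def z_def)
    define u where "u = d i y \<oplus>\<^bsub>F (b i)\<^esub> x \<odot>\<^bsub>F (b i)\<^esub> z"
    have u: "u \<in> carrier (F (b i))" using y z x by (simp add: u_def dmem)
    have nz: "(- 1) \<odot>\<^bsub>F (b i)\<^esub> z \<in> carrier (F (b i))" using z by simp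
    have "u = zero (F (b i)) \<and> (\<exists>z'\<in>carrier (F (b (Suc i))). d i z' = (- 1) \<odot>\<^bsub>F (b i)\<^esub> z)"
    proof (cases i)
      case 0
      have u0: "u = zero (F (b i))"
        using cw w' 0 by (simp add: c0 rank u_def y_def z_def)
      then have "u 0 = 0" using 0 b0 by (simp add: F_simps)
      then have "x * z 0 = - (d 0 y 0)"
        using 0 b0 by (simp add: u_def F_simps eq_neg_iff_add_eq_0 add.commute)
      moreover have "d 0 y 0 \<in> L" using im0[of "d 0 y"] y dmem[of y 0] 0 by auto
      ultimately have "x * z 0 \<in> L" using idealD(5)[OF L, of "- 1"] by force
      then have "z 0 \<in> L" using reg F_coord[OF z, of 0] 0 b0 by simp
      then have "((- 1) \<odot>\<^bsub>F (b i)\<^esub> z) 0 \<in> L"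
        using idealD(5)[OF L, of "- 1" "z 0"] 0 b0 by (simp add: F_simps)
      then show ?thesis using im0 nz u0 0 by (metis (no_types, lifting) imageE)
    next
      case (Suc j)
      have v: "(- 1) \<odot>\<^bsub>F (b j)\<^esub> d j z \<in> carrier (F (b j))" using z Suc by (simp add: dmem)
      have jn: "join (b i) (b j) u ((- 1) \<odot>\<^bsub>F (b j)\<^esub> d j z) = join (b i) (b j) (zero (F (b i))) (zero (F (b j)))"
        using cw w' Suc by (simp add: cS rank u_def y_def z_def parts_linear(7))
      have u0: "u = zero (F (b i))"
        using arg_cong[OF jn, of "left_part (b i) (b j)"] u by simp
      have "(- 1) \<odot>\<^bsub>F (b j)\<^esub> d j z = zero (F (b j))"
        using arg_cong[OF jn, of "right_part (b i) (b j)"] v by simp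
      then have "d j ((- 1) \<odot>\<^bsub>F (b i)\<^esub> z) = zero (F (b j))"
        using z Suc by (simp add: module_homD(3)[OF hom])
      then show ?thesis using ex[of "(- 1) \<odot>\<^bsub>F (b i)\<^esub> z" j] nz u0 Suc by auto
    qed
    then obtain z' where u0: "d i y \<oplus>\<^bsub>F (b i)\<^esub> x \<odot>\<^bsub>F (b i)\<^esub> z = zero (F (b i))"
      and z': "z' \<in> carrier (F (b (Suc i)))" "d i z' = (- 1) \<odot>\<^bsub>F (b i)\<^esub> z"
      unfolding u_def by blast
    obtain v where "v \<in> carrier (F (b (Suc (Suc i)) + b (Suc i)))"
      "?c (Suc i) v = join (b (Suc i)) (b i) y z"
      using lift[OF y z u0 z'] by blast
    then show "w \<in> ?c (Suc i) ` carrier (F (cone_rank b (Suc (Suc i))))"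
      using w' by (intro image_eqI[of _ _ v]) (simp_all add: rank y_def z_def)
  qed
  show ?thesis
    unfolding cyclic_resolution_def
    using c_hom c_im0 c_exact by (simp add: rank b0)
qed

end

section \<open>Squarefree monomial ideals\<close>

lemma keys_plus_nat: "Poly_Mapping.keys (m + m' :: 'v \<Rightarrow>\<^sub>0 nat) = Poly_Mapping.keys m \<union> Poly_Mapping.keys m'"
  by (auto simp: in_keys_iff lookup_add)

lemma keys_mult_subset:
  fixes p q :: "('v \<Rightarrow>\<^sub>0 nat) \<Rightarrow>\<^sub>0 'k::comm_semiring_0"
  assumes "m \<in> Poly_Mapping.keys (p * q)"
  obtains a c where "a \<in> Poly_Mapping.keys p" "c \<in> Poly_Mapping.keys q"
    "Poly_Mapping.keys m = Poly_Mapping.keys a \<union> Poly_Mapping.keys c"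
proof -
  have "m \<in> {a + c | a c. a \<in> Poly_Mapping.keys p \<and> c \<in> Poly_Mapping.keys q}"
    using assms keys_mult by (rule rev_subsetD)
  then obtain a c where "m = a + c" "a \<in> Poly_Mapping.keys p" "c \<in> Poly_Mapping.keys q"
    by auto
  then show thesis by (intro that[of a c]) (simp_all add: keys_plus_nat)
qed

lemma poly_ring_class_ring: "class_ring (poly_ring V :: ('v, 'k::field) mpoly ring)"
proof
  fix p q :: "('v, 'k) mpoly"
  assume p: "p \<in> carrier (poly_ring V)" and q: "q \<in> carrier (poly_ring V)"
  show "p + q \<in> carrier (poly_ring V)"
    using p q keys_add[of p q] by (auto simp: poly_ring_def)
  show "p * q \<in> carrier (poly_ring V)"
    using p q by (fastforce simp: poly_ring_def elim!: keys_mult_subset)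
qed (auto simp: poly_ring_def)

lemma poly_eq_sum_monomials:
  fixes p :: "'a \<Rightarrow>\<^sub>0 'b::comm_monoid_add"
  shows "p = (\<Sum>m\<in>Poly_Mapping.keys p. Poly_Mapping.single m (Poly_Mapping.lookup p m))"
  by (rule poly_mapping_eqI)
    (auto simp: lookup_sum lookup_single when_def sum.delta in_keys_iff)

lemma lookup_var_mult:
  "Poly_Mapping.lookup (var u * p) (Poly_Mapping.single u 1 + m) = Poly_Mapping.lookup p m"
proof -
  have "var u * p = (\<Sum>m\<in>Poly_Mapping.keys p.
      Poly_Mapping.single (Poly_Mapping.single u 1 + m) (Poly_Mapping.lookup p m))"
    by (subst poly_eq_sum_monomials[of p]) (simp add: sum_distrib_left var_def mult_single)
  then show ?thesis
    by (auto simp: lookup_sum lookup_single when_def sum.delta in_keys_iff)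
qed

lemma keys_var_mult:
  "m \<in> Poly_Mapping.keys p \<Longrightarrow> Poly_Mapping.single u 1 + m \<in> Poly_Mapping.keys (var u * p)"
  by (simp add: in_keys_iff lookup_var_mult del: One_nat_def)

lemma keys_var: "Poly_Mapping.keys (var u :: ('v, 'k::field) mpoly) = {Poly_Mapping.single u 1}"
  by (simp add: var_def)

lemma var_mem: "u \<in> V \<Longrightarrow> var u \<in> carrier (poly_ring V)"
  by (simp add: poly_ring_def keys_var)

definition up_closed :: "('v set \<Rightarrow> bool) \<Rightarrow> bool" where
  "up_closed Q \<longleftrightarrow> (\<forall>S T. S \<subseteq> T \<longrightarrow> Q S \<longrightarrow> Q T)"

lemma up_closedD: "up_closed Q \<Longrightarrow> Q S \<Longrightarrow> S \<subseteq> T \<Longrightarrow> Q T"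
  by (auto simp: up_closed_def)

text \<open>The Stanley--Reisner ideal whose nonfaces are the sets satisfying \<open>Q\<close>.\<close>

definition sr_ideal :: "'v set \<Rightarrow> ('v set \<Rightarrow> bool) \<Rightarrow> ('v, 'k::field) mpoly set" where
  "sr_ideal V Q =
     {p \<in> carrier (poly_ring V). \<forall>m\<in>Poly_Mapping.keys p. Q (Poly_Mapping.keys m)}"

lemma sr_ideal_cong:
  assumes "\<And>S. S \<subseteq> V \<Longrightarrow> Q S \<longleftrightarrow> Q' S"
  shows "sr_ideal V Q = sr_ideal V Q'"
  using assms by (auto simp: sr_ideal_def poly_ring_def)

lemma sr_ideal_ideal:
  assumes "up_closed Q"
  shows "ideal (sr_ideal V Q) (poly_ring V :: ('v, 'k::field) mpoly ring)"
proof -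
  interpret class_ring "poly_ring V :: ('v, 'k) mpoly ring" by (rule poly_ring_class_ring)
  show ?thesis
  proof (rule class_idealI)
    fix p q :: "('v, 'k) mpoly"
    assume "p \<in> sr_ideal V Q" "q \<in> sr_ideal V Q"
    then show "p + q \<in> sr_ideal V Q"
      using keys_add[of p q] by (auto simp: sr_ideal_def)
  next
    fix p q :: "('v, 'k) mpoly"
    assume "p \<in> carrier (poly_ring V)" "q \<in> sr_ideal V Q"
    then show "p * q \<in> sr_ideal V Q"
      by (auto simp: sr_ideal_def elim!: keys_mult_subset intro: up_closedD[OF assms])
  qed (auto simp: sr_ideal_def)
qed

text \<open>Membership is tested on the support of each monomial, and multiplication by
  \<open>var u\<close> is injective on monomials and adds \<open>u\<close> to the support.\<close>

lemma sr_ideal_colon: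
  assumes Q: "up_closed Q" and u: "u \<in> V" and p: "p \<in> carrier (poly_ring V)"
  shows "p \<in> sr_ideal V (\<lambda>S. Q (insert u S)) \<longleftrightarrow> var u * p \<in> sr_ideal V Q"
proof
  assume "p \<in> sr_ideal V (\<lambda>S. Q (insert u S))"
  then show "var u * p \<in> sr_ideal V Q"
    using class_ring.mult_mem[OF poly_ring_class_ring var_mem[OF u] p]
    by (auto simp: sr_ideal_def keys_var elim!: keys_mult_subset)
next
  assume *: "var u * p \<in> sr_ideal V Q"
  have "Q (insert u (Poly_Mapping.keys m))" if "m \<in> Poly_Mapping.keys p" for m
    using keys_var_mult[OF that, of u] * by (auto simp: sr_ideal_def keys_plus_nat simp del: One_nat_def)
  then show "p \<in> sr_ideal V (\<lambda>S. Q (insert u S))"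
    using p by (simp add: sr_ideal_def)
qed

lemma single_mem_poly_ring:
  "Poly_Mapping.keys m \<subseteq> V \<Longrightarrow> Poly_Mapping.single m c \<in> carrier (poly_ring V)"
  by (simp add: poly_ring_def)

lemma single_var_factor:
  assumes "u \<in> Poly_Mapping.keys m"
  shows "Poly_Mapping.single m c = var u * Poly_Mapping.single (m - Poly_Mapping.single u 1) c"
    and "Poly_Mapping.keys m - {u} \<subseteq> Poly_Mapping.keys (m - Poly_Mapping.single u 1)"
    and "Poly_Mapping.keys (m - Poly_Mapping.single u 1) \<subseteq> Poly_Mapping.keys m"
proof -
  have "Poly_Mapping.single u 1 + (m - Poly_Mapping.single u 1) = m"
    using assms
    by (intro poly_mapping_eqI)
      (auto simp: lookup_add lookup_minus lookup_single when_def in_keys_iff split: if_splits)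
  then show "Poly_Mapping.single m c = var u * Poly_Mapping.single (m - Poly_Mapping.single u 1) c"
    by (simp add: var_def mult_single)
  show "Poly_Mapping.keys m - {u} \<subseteq> Poly_Mapping.keys (m - Poly_Mapping.single u 1)"
    "Poly_Mapping.keys (m - Poly_Mapping.single u 1) \<subseteq> Poly_Mapping.keys m"
    by (auto simp: in_keys_iff lookup_minus lookup_single when_def split: if_splits)
qed

text \<open>Term by term: a monomial outside the smaller ideal contains \<open>u\<close>, hence is
  divisible by \<open>var u\<close>; the quotients add up to \<open>s\<close>.\<close>

lemma sr_ideal_plus:
  fixes p :: "('v, 'k::field) mpoly"
  assumes Q: "up_closed Q" and u: "u \<in> V" and p: "p \<in> carrier (poly_ring V)"
  shows "p \<in> sr_ideal V (\<lambda>S. Q S \<or> u \<in> S) \<longleftrightarrow>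
    (\<exists>s\<in>carrier (poly_ring V). p - var u * s \<in> sr_ideal V Q)"
proof -
  interpret class_ring "poly_ring V :: ('v, 'k) mpoly ring" by (rule poly_ring_class_ring)
  have Q': "up_closed (\<lambda>S. Q S \<or> u \<in> S)" using Q by (auto simp: up_closed_def)
  note I = sr_ideal_ideal[OF Q, of V, where 'k = 'k] and I' = sr_ideal_ideal[OF Q', of V, where 'k = 'k]
  show ?thesis
  proof
    assume *: "p \<in> sr_ideal V (\<lambda>S. Q S \<or> u \<in> S)"
    have "\<exists>s\<in>carrier (poly_ring V).
        Poly_Mapping.single m (Poly_Mapping.lookup p m) - var u * s \<in> sr_ideal V Q"
      if m: "m \<in> Poly_Mapping.keys p" for m
    proof (cases "Q (Poly_Mapping.keys m)")
      case True
      then show ?thesis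
        using p m by (intro bexI[of _ 0]) (auto simp: sr_ideal_def poly_ring_def)
    next
      case False
      then have um: "u \<in> Poly_Mapping.keys m" and mV: "Poly_Mapping.keys m \<subseteq> V"
        using * m by (auto simp: sr_ideal_def poly_ring_def)
      let ?s = "Poly_Mapping.single (m - Poly_Mapping.single u 1) (Poly_Mapping.lookup p m)"
      have "Poly_Mapping.single m (Poly_Mapping.lookup p m) - var u * ?s = 0"
        by (simp only: single_var_factor(1)[OF um, symmetric] diff_self)
      moreover have "?s \<in> carrier (poly_ring V)"
        using single_var_factor(3)[OF um] mV by (intro single_mem_poly_ring) blast
      ultimately show ?thesis using idealD(2)[OF I] by metis
    qed
    then obtain s where s: "\<And>m. m \<in> Poly_Mapping.keys p \<Longrightarrow> s m \<in> carrier (poly_ring V) \<and>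
        Poly_Mapping.single m (Poly_Mapping.lookup p m) - var u * s m \<in> sr_ideal V Q"
      by metis
    have sum_I: "sum f A \<in> sr_ideal V Q" if "\<And>m. m \<in> A \<Longrightarrow> f m \<in> sr_ideal V Q"
      for A and f :: "('v \<Rightarrow>\<^sub>0 nat) \<Rightarrow> ('v, 'k) mpoly"
      using that by (induction A rule: infinite_finite_induct) (auto simp: idealD[OF I])
    have "(\<Sum>m\<in>Poly_Mapping.keys p. Poly_Mapping.single m (Poly_Mapping.lookup p m) - var u * s m)
        \<in> sr_ideal V Q"
      using s by (intro sum_I) auto
    then have "p - var u * (\<Sum>m\<in>Poly_Mapping.keys p. s m) \<in> sr_ideal V Q"
      by (simp add: sum_subtractf poly_eq_sum_monomials[symmetric] sum_distrib_left)
    moreover have "(\<Sum>m\<in>Poly_Mapping.keys p. s m) \<in> carrier (poly_ring V)"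
      using s by (intro sum_mem) auto
    ultimately show "\<exists>s\<in>carrier (poly_ring V). p - var u * s \<in> sr_ideal V Q" by blast
  next
    assume "\<exists>s\<in>carrier (poly_ring V). p - var u * s \<in> sr_ideal V Q"
    then obtain s where s: "s \<in> carrier (poly_ring V)" "p - var u * s \<in> sr_ideal V Q" by blast
    have "var u \<in> sr_ideal V (\<lambda>S. Q S \<or> u \<in> S)"
      using var_mem[OF u] by (auto simp: sr_ideal_def keys_var)
    then have "s * var u \<in> sr_ideal V (\<lambda>S. Q S \<or> u \<in> S)"
      by (rule idealD(5)[OF I' s(1)])
    moreover have "p - var u * s \<in> sr_ideal V (\<lambda>S. Q S \<or> u \<in> S)"
      using s(2) by (auto simp: sr_ideal_def)
    ultimately show "p \<in> sr_ideal V (\<lambda>S. Q S \<or> u \<in> S)"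
      using idealD(3)[OF I', of "p - var u * s" "s * var u"] by (simp add: algebra_simps)
  qed
qed

text \<open>The generators are squarefree, so divisibility by one of them can be read off the
  support.\<close>

lemma edge_ideal_sr_ideal:
  assumes G: "simple_graph G"
  shows "(edge_ideal G :: ('v, 'k::field) mpoly set) = sr_ideal (verts G) (\<lambda>S. \<exists>e\<in>edges G. e \<subseteq> S)"
    (is "_ = ?I")
proof -
  let ?V = "verts G"
  interpret class_ring "poly_ring ?V :: ('v, 'k) mpoly ring" by (rule poly_ring_class_ring)
  interpret ring "poly_ring ?V :: ('v, 'k) mpoly ring" by (rule ring_R)
  define gens :: "('v, 'k) mpoly set" where "gens = {var u * var v | u v. {u, v} \<in> edges G}"
  have edge: "u \<in> ?V \<and> v \<in> ?V \<and> u \<noteq> v" if "{u, v} \<in> edges G" for u v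
    using G that by (auto simp: simple_graph_def complete_edges_def)
  have up: "up_closed (\<lambda>S. \<exists>e\<in>edges G. e \<subseteq> S)"
    by (auto simp: up_closed_def)
  have gens: "gens \<subseteq> carrier (poly_ring ?V)"
    using mult_mem[OF var_mem var_mem] edge unfolding gens_def by blast
  note J = genideal_ideal[OF gens]
  show ?thesis
  proof
    have "gens \<subseteq> ?I"
    proof
      fix p assume "p \<in> gens"
      then obtain u v where p: "p = var u * var v" and e: "{u, v} \<in> edges G"
        by (auto simp: gens_def)
      have "{u, v} \<subseteq> Poly_Mapping.keys m" if m: "m \<in> Poly_Mapping.keys p" for m
      proof -
        obtain a c where "a \<in> Poly_Mapping.keys (var u :: ('v, 'k) mpoly)"
          "c \<in> Poly_Mapping.keys (var v :: ('v, 'k) mpoly)"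
          "Poly_Mapping.keys m = Poly_Mapping.keys a \<union> Poly_Mapping.keys c"
          using m unfolding p by (rule keys_mult_subset)
        then show ?thesis by (simp add: keys_var)
      qed
      then have "\<forall>m\<in>Poly_Mapping.keys p. \<exists>e\<in>edges G. e \<subseteq> Poly_Mapping.keys m"
        using e by blast
      then show "p \<in> ?I"
        unfolding sr_ideal_def using \<open>p \<in> gens\<close> gens by blast
    qed
    then show "edge_ideal G \<subseteq> ?I"
      unfolding edge_ideal_def gens_def[symmetric] by (intro genideal_minimal sr_ideal_ideal up)
  next
    show "?I \<subseteq> edge_ideal G"
      unfolding edge_ideal_def gens_def[symmetric]
    proof
      fix p :: "('v, 'k) mpoly" assume p: "p \<in> ?I"
      have "Poly_Mapping.single m (Poly_Mapping.lookup p m) \<in> Idl\<^bsub>poly_ring ?V\<^esub> gens"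
        if m: "m \<in> Poly_Mapping.keys p" for m
      proof -
        obtain e where e: "e \<in> edges G" "e \<subseteq> Poly_Mapping.keys m" and mV: "Poly_Mapping.keys m \<subseteq> ?V"
          using p m by (auto simp: sr_ideal_def poly_ring_def)
        have "card e = 2" using G e by (auto simp: simple_graph_def complete_edges_def)
        then obtain u v where uv: "e = {u, v}" "u \<noteq> v" by (auto simp: card_2_iff)
        define m' where "m' = m - Poly_Mapping.single u 1"
        define m'' where "m'' = m' - Poly_Mapping.single v 1"
        have um: "u \<in> Poly_Mapping.keys m" using e uv by auto
        \<comment> \<open>Removing one factor \<open>u\<close> keeps \<open>v\<close> in the support
          because u \<noteq> v.\<close>
        have vm: "v \<in> Poly_Mapping.keys m'"
          using single_var_factor(2)[OF um] e uv by (auto simp: m'_def)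
        have "Poly_Mapping.keys m'' \<subseteq> ?V"
          using single_var_factor(3)[OF um] single_var_factor(3)[OF vm] mV
          by (auto simp: m'_def m''_def)
        moreover have "Poly_Mapping.single m c = Poly_Mapping.single m'' c * (var u * var v)" for c :: 'k
          using single_var_factor(1)[OF um, of c] single_var_factor(1)[OF vm, of c]
          by (simp add: m'_def m''_def mult_ac)
        moreover have "var u * var v \<in> Idl\<^bsub>poly_ring ?V\<^esub> gens"
          using genideal_self[OF gens] e uv by (auto simp: gens_def)
        ultimately show ?thesis
          using idealD(5)[OF J single_mem_poly_ring] by metis
      qed
      note mono = this
      have sum_J: "sum f A \<in> Idl\<^bsub>poly_ring ?V\<^esub> gens" if "\<And>m. m \<in> A \<Longrightarrow> f m \<in> Idl\<^bsub>poly_ring ?V\<^esub> gens"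
        for A and f :: "('v \<Rightarrow>\<^sub>0 nat) \<Rightarrow> ('v, 'k) mpoly"
        using that by (induction A rule: infinite_finite_induct) (auto simp: idealD[OF J])
      have "(\<Sum>m\<in>Poly_Mapping.keys p. Poly_Mapping.single m (Poly_Mapping.lookup p m)) \<in> Idl\<^bsub>poly_ring ?V\<^esub> gens"
        by (rule sum_J) (rule mono)
      then show "p \<in> Idl\<^bsub>poly_ring ?V\<^esub> gens"
        by (simp only: poly_eq_sum_monomials[symmetric])
    qed
  qed
qed

section \<open>Depth from an arbitrary free resolution of the ground field\<close>

text \<open>The ideal generated by the variables of \<open>V\<close> that lie in \<open>X\<close>;
  its quotient is the polynomial ring in the remaining ones.\<close>

abbreviation vars_ideal :: "'v set \<Rightarrow> 'v set \<Rightarrow> ('v, 'k::field) mpoly set" where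
  "vars_ideal V X \<equiv> sr_ideal V (\<lambda>S. S \<inter> X \<noteq> {})"

lemma vars_up_closed: "up_closed (\<lambda>S. S \<inter> X \<noteq> {})"
  by (auto simp: up_closed_def)

lemma vars_ideal_regular:
  assumes "u \<in> V" "u \<notin> X" "p \<in> carrier (poly_ring V)" "var u * p \<in> vars_ideal V X"
  shows "p \<in> vars_ideal V X"
  using sr_ideal_colon[OF vars_up_closed assms(1,3), of X] assms(2,4) by simp

lemma vars_ideal_insert:
  assumes "u \<in> V" "p \<in> carrier (poly_ring V)"
  shows "p \<in> vars_ideal V (insert u X) \<longleftrightarrow>
    (\<exists>s\<in>carrier (poly_ring V). p - var u * s \<in> vars_ideal V X)"
proof -
  have "(\<lambda>S. S \<inter> insert u X \<noteq> {}) = (\<lambda>S. S \<inter> X \<noteq> {} \<or> u \<in> S)" by auto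
  then show ?thesis using sr_ideal_plus[OF vars_up_closed assms, of X] by simp
qed

text \<open>Each variable is regular modulo the preceding ones, so iterating the cone gives the
  Koszul complex on \<open>X\<close>.\<close>

lemma vars_ideal_resolution:
  assumes "finite X" "X \<subseteq> V"
  shows "\<exists>b d. class_ring.cyclic_resolution (poly_ring V) (vars_ideal V X :: ('v, 'k::field) mpoly set) b d"
  using assms
proof (induction X rule: finite_induct)
  case empty
  have "vars_ideal V {} = ({0} :: ('v, 'k) mpoly set)"
    by (auto simp: sr_ideal_def poly_ring_def)
  then show ?case
    using class_ring.cyclic_resolution_zero[OF poly_ring_class_ring] by metis
next
  case (insert u X)
  then obtain b d
    where res: "class_ring.cyclic_resolution (poly_ring V) (vars_ideal V X :: ('v, 'k) mpoly set) b d"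
    by auto
  have u: "u \<in> V" using insert.prems by simp
  show ?case
    by (intro exI, rule class_ring.cone_cyclic_resolution
        [OF poly_ring_class_ring sr_ideal_ideal[OF vars_up_closed] res var_mem[OF u]
          vars_ideal_regular[OF u insert.hyps(2)] vars_ideal_insert[OF u]])
qed

lemma vars_ideal_all:
  assumes "p \<in> carrier (poly_ring V)"
  shows "p \<in> vars_ideal V V \<longleftrightarrow> Poly_Mapping.lookup p 0 = 0"
proof -
  have "Poly_Mapping.keys m \<inter> V = Poly_Mapping.keys m" if "m \<in> Poly_Mapping.keys p" for m
    using assms that by (auto simp: poly_ring_def)
  then show ?thesis using assms by (force simp: sr_ideal_def in_keys_iff)
qed

text \<open>Modulo the ideal of all variables a polynomial equals its constant term; the two
  congruences are multiplied.\<close>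

lemma lookup_mult_0:
  fixes p q :: "('v, 'k::field) mpoly"
  shows "Poly_Mapping.lookup (p * q) 0 = Poly_Mapping.lookup p 0 * Poly_Mapping.lookup q 0"
proof -
  interpret class_ring "poly_ring UNIV :: ('v, 'k) mpoly ring" by (rule poly_ring_class_ring)
  let ?c = "\<lambda>p :: ('v, 'k) mpoly. Poly_Mapping.single 0 (Poly_Mapping.lookup p 0)"
  have c: "r \<in> carrier (poly_ring UNIV)" for r :: "('v, 'k) mpoly" by (simp add: poly_ring_def)
  note L = idealD[OF sr_ideal_ideal[OF vars_up_closed, of UNIV UNIV, where 'k = 'k]]
  have "p - ?c p \<in> vars_ideal UNIV UNIV" "q - ?c q \<in> vars_ideal UNIV UNIV"
    by (subst vars_ideal_all[OF c], simp add: lookup_minus)+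
  then have "q * (p - ?c p) + ?c p * (q - ?c q) \<in> vars_ideal UNIV UNIV"
    by (intro L(3) L(5) c)
  also have "q * (p - ?c p) + ?c p * (q - ?c q) = p * q - ?c p * ?c q"
    by (simp add: algebra_simps)
  finally have "Poly_Mapping.lookup (p * q - ?c p * ?c q) 0 = 0"
    by (subst (asm) vars_ideal_all[OF c])
  then show ?thesis by (simp add: lookup_minus mult_single)
qed

text \<open>Guarantees that the choice in \<open>Ext\<close> picks a genuine resolution. The witness
  is the Koszul complex on all variables, augmented by taking constant terms.\<close>

lemma ground_field_resolution:
  assumes V: "finite V"
  shows "\<exists>b d \<epsilon>. free_resolution (poly_ring V) (ground_field :: (('v, 'k::field) mpoly, 'k) module) b d \<epsilon>"
proof -
  interpret class_ring "poly_ring V :: ('v, 'k) mpoly ring" by (rule poly_ring_class_ring)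
  obtain b d where res: "cyclic_resolution (vars_ideal V V) b d"
    using vars_ideal_resolution[OF V order_refl] by blast
  then have b0: "b 0 = 1" and hom: "\<And>i. d i \<in> module_hom (poly_ring V) (F (b (Suc i))) (F (b i))"
    and im0: "\<And>y. y \<in> carrier (F 1) \<Longrightarrow> y \<in> d 0 ` carrier (F (b (Suc 0))) \<longleftrightarrow> y 0 \<in> vars_ideal V V"
    and ex: "\<And>i y. y \<in> carrier (F (b (Suc i))) \<Longrightarrow>
      y \<in> d (Suc i) ` carrier (F (b (Suc (Suc i)))) \<longleftrightarrow> d i y = zero (F (b i))"
    by (simp_all add: cyclic_resolution_def)
  note dmem = module_homD(1)[OF hom]
  define \<epsilon> where "\<epsilon> = (\<lambda>y\<in>carrier (F 1). Poly_Mapping.lookup (y 0) 0)"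
  have "\<epsilon> \<in> module_hom (poly_ring V) (F 1) (ground_field :: (_, 'k) module)"
    by (simp add: module_hom_def PiE_iff ground_field_def \<epsilon>_def del: One_nat_def)
      (simp add: F_simps(3,4) lookup_add lookup_mult_0)
  moreover have "\<epsilon> ` carrier (F 1) = UNIV"
  proof -
    have "c \<in> \<epsilon> ` carrier (F 1)" for c :: 'k
    proof -
      let ?y = "\<lambda>j\<in>{..<1}. Poly_Mapping.single 0 c"
      have "?y \<in> carrier (F 1)"
        unfolding F_simps by (auto intro: single_mem_poly_ring)
      then show ?thesis by (intro image_eqI[of _ _ ?y]) (simp_all add: \<epsilon>_def)
    qed
    then show ?thesis by blast
  qed
  moreover have "d 0 ` carrier (F (b (Suc 0))) = {x \<in> carrier (F 1). \<epsilon> x = 0}"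
  proof -
    have "x \<in> d 0 ` carrier (F (b (Suc 0))) \<longleftrightarrow> \<epsilon> x = 0" if x: "x \<in> carrier (F 1)" for x
      using im0[OF x] vars_ideal_all[OF F_coord[OF x, of 0]] x by (simp add: \<epsilon>_def)
    moreover have "d 0 ` carrier (F (b (Suc 0))) \<subseteq> carrier (F 1)"
      using dmem[of _ 0] b0 by auto
    ultimately show ?thesis by blast
  qed
  moreover have "d (Suc i) ` carrier (F (b (Suc (Suc i)))) =
      {x \<in> carrier (F (b (Suc i))). d i x = zero (F (b i))}" for i
    using ex[of _ i] dmem[of _ "Suc i"] by blast
  ultimately have "free_resolution (poly_ring V) (ground_field :: (_, 'k) module) b d \<epsilon>"
    using hom by (simp add: free_resolution_def b0 ground_field_def)
  then show ?thesis by blast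
qed

section \<open>Arbitrary resolutions of the ground field and quotients by variables\<close>

locale residue_resolution =
  fixes V :: "'v set" and b :: "nat \<Rightarrow> nat"
    and d :: "nat \<Rightarrow> (nat \<Rightarrow> ('v, 'k::field) mpoly) \<Rightarrow> (nat \<Rightarrow> ('v, 'k) mpoly)"
    and \<epsilon> :: "(nat \<Rightarrow> ('v, 'k) mpoly) \<Rightarrow> 'k"
  assumes finV: "finite V"
    and res: "free_resolution (poly_ring V) ground_field b d \<epsilon>"

sublocale residue_resolution \<subseteq> free_complex "poly_ring V :: ('v, 'k::field) mpoly ring" b d
proof -
  interpret class_ring "poly_ring V :: ('v, 'k) mpoly ring" by (rule poly_ring_class_ring)
  show "free_complex (poly_ring V) b d"
  proof
    show hom: "d i \<in> module_hom (poly_ring V) (F (b (Suc i))) (F (b i))" for i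
      using res by (simp add: free_resolution_def)
    have "d (Suc i) ` carrier (F (b (Suc (Suc i)))) =
        {x \<in> carrier (F (b (Suc i))). d i x = zero (F (b i))}" for i
      using res by (simp add: free_resolution_def)
    then show "d i (d (Suc i) y) = zero (F (b i))" if "y \<in> carrier (F (b (Suc (Suc i))))" for i y
      using that by blast
  qed
qed

context residue_resolution
begin

lemma d_exact:
  assumes "y \<in> carrier (F (b (Suc i)))" "d i y = zero (F (b i))"
  shows "\<exists>z\<in>carrier (F (b (Suc (Suc i)))). d (Suc i) z = y"
proof -
  have "d (Suc i) ` carrier (F (b (Suc (Suc i)))) =
      {x \<in> carrier (F (b (Suc i))). d i x = zero (F (b i))}"
    using res by (simp add: free_resolution_def)
  then have "y \<in> d (Suc i) ` carrier (F (b (Suc (Suc i))))" using assms by blast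
  then show ?thesis by (metis imageE)
qed

lemma \<epsilon>_hom:
  assumes "x \<in> carrier (F (b 0))"
  shows "y \<in> carrier (F (b 0)) \<Longrightarrow> \<epsilon> (x \<oplus>\<^bsub>F (b 0)\<^esub> y) = \<epsilon> x + \<epsilon> y"
    and "p \<in> carrier (poly_ring V) \<Longrightarrow> \<epsilon> (p \<odot>\<^bsub>F (b 0)\<^esub> x) = Poly_Mapping.lookup p 0 * \<epsilon> x"
  using res assms by (auto simp: free_resolution_def module_hom_def ground_field_def)

lemma \<epsilon>_kernel:
  "y \<in> carrier (F (b 0)) \<Longrightarrow> \<epsilon> y = 0 \<longleftrightarrow> y \<in> d 0 ` carrier (F (b (Suc 0)))"
  using res by (auto simp: free_resolution_def ground_field_def)

lemma var_kills:
  assumes "u \<in> V" "y \<in> carrier (F (b 0))"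
  shows "\<exists>z\<in>carrier (F (b (Suc 0))). d 0 z = var u \<odot>\<^bsub>F (b 0)\<^esub> y"
proof -
  have "Poly_Mapping.single u (1::nat) \<noteq> 0"
    by (metis lookup_single_eq lookup_zero zero_neq_one)
  then have "Poly_Mapping.lookup (var u :: ('v, 'k) mpoly) 0 = 0"
    by (simp add: var_def lookup_single when_def)
  then have "\<epsilon> (var u \<odot>\<^bsub>F (b 0)\<^esub> y) = 0"
    using assms by (simp add: \<epsilon>_hom var_mem)
  then have "var u \<odot>\<^bsub>F (b 0)\<^esub> y \<in> d 0 ` carrier (F (b (Suc 0)))"
    by (subst \<epsilon>_kernel[symmetric]) (use assms in \<open>simp_all add: var_mem\<close>)
  then obtain z where "z \<in> carrier (F (b (Suc 0)))" "var u \<odot>\<^bsub>F (b 0)\<^esub> y = d 0 z"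
    by (rule imageE)
  then show ?thesis by (intro bexI[of _ z]) simp_all
qed

text \<open>This is Hom(K, K) \<noteq> 0. The augmentation is lifted to a functional through
  constant polynomials; if that were a coboundary in degree 0, the augmentation would vanish,
  against surjectivity.\<close>

lemma not_vanishing_maximal: "\<not> vanishing (vars_ideal V V) 0"
proof
  assume van: "vanishing (vars_ideal V V) 0"
  define c :: "nat \<Rightarrow> ('v, 'k) mpoly"
    where "c j = Poly_Mapping.single 0 (\<epsilon> (basis_vec (b 0) j))" for j
  have h: "dot (b 0) c \<in> functionals (b 0)"
    by (intro dot_functional) (simp add: c_def poly_ring_def)
  have zero: "\<epsilon> (zero (F (b 0))) = 0"
    using \<epsilon>_hom(2)[of "zero (F (b 0))" 0] by (simp add: F_smult_zero)
  have c: "Poly_Mapping.lookup (c j) 0 = \<epsilon> (basis_vec (b 0) j)" for j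
    by (simp add: c_def)
  have eq: "Poly_Mapping.lookup (dot (b 0) c y) 0 = \<epsilon> y" if "y \<in> carrier (F (b 0))" for y
    using that
    by (rule free_module_induct)
      (simp_all add: functional_zero[OF h] functionalsD[OF h] zero \<epsilon>_hom lookup_add lookup_mult_0 c)
  have "cocycle_mod (vars_ideal V V) 0 (dot (b 0) c)"
    unfolding cocycle_mod_def
  proof (intro conjI ballI h)
    fix y assume y: "y \<in> carrier (F (b (Suc 0)))"
    note dy = module_homD(1)[OF d_hom y]
    show "dot (b 0) c (d 0 y) \<in> vars_ideal V V"
      using vars_ideal_all[OF functionalsD(1)[OF h dy]] eq[OF dy] \<epsilon>_kernel[OF dy] y by auto
  qed
  then obtain g where g: "g \<in> functionals 0"
    "\<And>y. y \<in> carrier (F (b 0)) \<Longrightarrow> dot (b 0) c y - g (zero (F 0)) \<in> vars_ideal V V"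
    using van by (auto simp: vanishing_def coboundary_mod_def)
  have "\<epsilon> y = 0" if y: "y \<in> carrier (F (b 0))" for y
    using g(2)[OF y] vars_ideal_all[OF functionalsD(1)[OF h y]] eq[OF y]
    by (simp add: functional_zero[OF g(1)])
  moreover have "\<epsilon> ` carrier (F (b 0)) = UNIV"
    using res by (simp add: free_resolution_def ground_field_def)
  ultimately show False by (metis imageE one_neq_zero UNIV_I)
qed

text \<open>The depth of a polynomial ring. Going back from \<open>insert u X\<close> to
  \<open>X\<close> makes \<open>var u\<close> regular, which raises the first nonzero degree by
  one.\<close>

lemma vanishing_vars_ideal:
  assumes "X \<subseteq> V"
  shows "(\<forall>i<card (V - X). vanishing (vars_ideal V X) i) \<and> \<not> vanishing (vars_ideal V X) (card (V - X))"
  using assms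
proof (induction "card (V - X)" arbitrary: X)
  case 0
  then have "X = V" using finV by auto
  then show ?case using not_vanishing_maximal 0 by simp
next
  case (Suc n)
  then obtain u where u: "u \<in> V" "u \<notin> X"
    by (metis Diff_iff card.empty ex_in_conv nat.distinct(1))
  have n: "n = card (V - insert u X)"
  proof -
    have "V - insert u X = (V - X) - {u}" by auto
    then show ?thesis using Suc.hyps(2) u finV by simp
  qed
  note I = sr_ideal_ideal[OF vars_up_closed, of V X, where 'k = 'k]
  have IH: "\<forall>i<n. vanishing (vars_ideal V (insert u X)) i" "\<not> vanishing (vars_ideal V (insert u X)) n"
    using Suc.hyps(1)[OF n] Suc.prems u n by auto
  have reg: "r \<in> vars_ideal V X" if "r \<in> carrier (poly_ring V)" "var u * r \<in> vars_ideal V X"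
    for r :: "('v, 'k) mpoly"
    using vars_ideal_regular[OF u that] .
  have van: "vanishing (vars_ideal V X) i" if "i < Suc n" for i
    by (rule vanishing_regular[OF var_mem[OF u(1)] d_exact var_kills[OF u(1)] I reg vars_ideal_insert[OF u(1)]])
      (use IH that in auto)
  moreover have "\<not> vanishing (vars_ideal V X) (Suc n)"
  proof
    assume "vanishing (vars_ideal V X) (Suc n)"
    \<comment> \<open>Here (I : var u) = I, so both outer terms of the exact sequence are Ext groups
      of the same quotient.\<close>
    then have "vanishing (vars_ideal V (insert u X)) n"
      using van[of n] idealD(5)[OF I var_mem[OF u(1)]] reg
      by (intro vanishing_plus[OF I var_mem[OF u(1)] _ vars_ideal_insert[OF u(1)]]) auto
    with IH(2) show False by blast
  qed
  ultimately show ?case using Suc.hyps(2) by simp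
qed

end

lemma depth_eqI:
  fixes I :: "('v, 'k::field) mpoly set"
  assumes V: "finite V" and I: "ideal I (poly_ring V)"
    and van: "\<And>b d (\<epsilon> :: (nat \<Rightarrow> ('v, 'k) mpoly) \<Rightarrow> 'k). residue_resolution V b d \<epsilon> \<Longrightarrow>
      (\<forall>i<n. free_complex.vanishing (poly_ring V) b d I i) \<and>
      \<not> free_complex.vanishing (poly_ring V) b d I n"
  shows "depth V (quotient_module (poly_ring V) I) = n"
proof -
  let ?R = "poly_ring V :: ('v, 'k) mpoly ring" and ?K = "ground_field :: (_, 'k) module"
  let ?P = "\<lambda>(b, d). \<exists>\<epsilon>. free_resolution ?R ?K b d \<epsilon>"
  obtain b d where bd: "(SOME p. ?P p) = (b, d)" by fastforce
  have "?P (SOME p. ?P p)"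
    using ground_field_resolution[OF V, where 'k = 'k] by (intro someI_ex[of ?P]) auto
  then obtain \<epsilon> where \<epsilon>: "free_resolution ?R ?K b d \<epsilon>" unfolding bd by auto
  interpret residue_resolution V b d \<epsilon>
    using V \<epsilon> by unfold_locales
  have "Ext ?R ?K (quotient_module ?R I) i = cohomology ?R b d (quotient_module ?R I) i" for i
    using bd by (simp add: Ext_def)
  then have "trivial_group (Ext ?R ?K (quotient_module ?R I) i) \<longleftrightarrow> vanishing I i" for i
    using trivial_cohomology_vanishing[OF I] by simp
  then show ?thesis
    unfolding depth_def using van[OF residue_resolution_axioms]
    by (intro Least_equality) (auto simp: not_less[symmetric])
qed

section \<open>Edge ideals and minimal maximal independent sets\<close>

definition neighbours :: "'v ugraph \<Rightarrow> 'v \<Rightarrow> 'v set" where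
  "neighbours G x = {y. {x, y} \<in> edges G}"

definition independent :: "'v ugraph \<Rightarrow> 'v set \<Rightarrow> bool" where
  "independent G A \<longleftrightarrow> (\<forall>e\<in>edges G. \<not> e \<subseteq> A)"

text \<open>The set \<open>X\<close> lists deleted vertices: \<open>A\<close> is a maximal
  independent set of G - X, expressed inside the fixed graph \<open>G\<close>.\<close>

definition max_indep :: "'v ugraph \<Rightarrow> 'v set \<Rightarrow> 'v set \<Rightarrow> bool" where
  "max_indep G X A \<longleftrightarrow> A \<subseteq> verts G - X \<and> independent G A \<and>
     (\<forall>y\<in>verts G - X - A. \<exists>a\<in>A. {a, y} \<in> edges G)"

text \<open>Holds for chordal graphs: take for \<open>v\<close> a simplicial vertex of the induced subgraph.\<close>

definition dismantlable :: "'v ugraph \<Rightarrow> bool" where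
  "dismantlable G \<longleftrightarrow> (\<forall>X\<subseteq>verts G. (\<exists>e\<in>edges G. e \<subseteq> verts G - X) \<longrightarrow>
     (\<exists>x\<in>verts G - X. \<exists>v\<in>verts G - X. {x, v} \<in> edges G \<and>
       (\<forall>y\<in>verts G - X. {v, y} \<in> edges G \<longrightarrow> y = x \<or> {x, y} \<in> edges G)))"

lemma simple_graph_edgeD:
  assumes "simple_graph G" "{u, v} \<in> edges G"
  shows "u \<in> verts G" "v \<in> verts G" "u \<noteq> v"
  using assms by (auto simp: simple_graph_def complete_edges_def)

lemma simple_graph_edgeE:
  assumes "simple_graph G" "e \<in> edges G"
  obtains u v where "e = {u, v}" "u \<noteq> v" "u \<in> verts G" "v \<in> verts G"
proof -
  have "card e = 2" "e \<subseteq> verts G" using assms by (auto simp: simple_graph_def complete_edges_def)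
  then show thesis using that by (auto simp: card_2_iff)
qed

text \<open>A perfect elimination order: the neighbours of a vertex that have no smaller rank form a
  clique. After the deletion of \<open>X\<close>, a non-isolated vertex of least rank is therefore
  simplicial, and any neighbour of it can serve as \<open>x\<close>.\<close>

lemma dismantlable_rank:
  fixes r :: "'v \<Rightarrow> nat"
  assumes G: "simple_graph G"
    and r: "\<And>v y z. {v, y} \<in> edges G \<Longrightarrow> {v, z} \<in> edges G \<Longrightarrow> r v \<le> r y \<Longrightarrow> r v \<le> r z \<Longrightarrow>
      y \<noteq> z \<Longrightarrow> {y, z} \<in> edges G"
  shows "dismantlable G"
  unfolding dismantlable_def
proof (intro allI impI)
  fix X assume "\<exists>e\<in>edges G. e \<subseteq> verts G - X"
  then obtain a c where ac: "{a, c} \<in> edges G" "a \<in> verts G - X" "c \<in> verts G - X"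
    using simple_graph_edgeE[OF G] by (metis insert_subset)
  define N where "N v \<longleftrightarrow> v \<in> verts G - X \<and> (\<exists>w\<in>verts G - X. {v, w} \<in> edges G)" for v
  have "N a" using ac by (auto simp: N_def)
  then obtain v where v: "N v" "\<And>y. N y \<Longrightarrow> r v \<le> r y"
    using ex_has_least_nat[of N a r] by blast
  then obtain x where x: "x \<in> verts G - X" "{v, x} \<in> edges G" by (auto simp: N_def)
  have "y = x \<or> {x, y} \<in> edges G" if y: "y \<in> verts G - X" "{v, y} \<in> edges G" for y
  proof -
    have "N x" "N y" using v(1) x y by (auto simp: N_def insert_commute)
    then show ?thesis using r[OF x(2) y(2)] v(2) by auto
  qed
  then show "\<exists>x\<in>verts G - X. \<exists>v\<in>verts G - X. {x, v} \<in> edges G \<and>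
       (\<forall>y\<in>verts G - X. {v, y} \<in> edges G \<longrightarrow> y = x \<or> {x, y} \<in> edges G)"
    using v(1) x by (intro bexI[of _ x] bexI[of _ v]) (auto simp: N_def insert_commute)
qed

text \<open>Without its neighbours \<open>x\<close> is isolated, hence lies in \<open>A\<close>, and
  it dominates every neighbour that was deleted.\<close>

lemma max_indep_link:
  assumes G: "simple_graph G" and x: "x \<in> verts G - X" and A: "max_indep G (X \<union> neighbours G x) A"
  shows "max_indep G X A"
proof -
  have "x \<notin> neighbours G x" using simple_graph_edgeD(3)[OF G] by (force simp: neighbours_def)
  then have "x \<in> A"
    using A x by (fastforce simp: max_indep_def neighbours_def insert_commute)
  then show ?thesis
    using A by (fastforce simp: max_indep_def neighbours_def)
qed

text \<open>The deleted vertex \<open>x\<close> stays dominated: either by \<open>v\<close> itself,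
  or by the member of \<open>A\<close> that dominates \<open>v\<close>, which is also a neighbour of
  \<open>x\<close>.\<close>

lemma max_indep_delete:
  assumes G: "simple_graph G" and x: "x \<in> verts G - X" and v: "v \<in> verts G - X"
    and xv: "{x, v} \<in> edges G"
    and dom: "\<And>y. y \<in> verts G - X \<Longrightarrow> {v, y} \<in> edges G \<Longrightarrow> y = x \<or> {x, y} \<in> edges G"
    and A: "max_indep G (insert x X) A"
  shows "max_indep G X A"
proof -
  have sub: "A \<subseteq> verts G - insert x X" and ind: "independent G A"
    and max: "\<And>y. y \<in> verts G - insert x X - A \<Longrightarrow> \<exists>a\<in>A. {a, y} \<in> edges G"
    using A by (auto simp: max_indep_def)
  have "v \<noteq> x" using simple_graph_edgeD(3)[OF G xv] by simp
  have "\<exists>a\<in>A. {a, x} \<in> edges G"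
  proof (cases "v \<in> A")
    case True
    then show ?thesis using xv by (auto simp: insert_commute)
  next
    case False
    then obtain a where "a \<in> A" "{a, v} \<in> edges G" using max[of v] v \<open>v \<noteq> x\<close> by auto
    then have "a \<noteq> x" "{x, a} \<in> edges G" using sub dom[of a] by (auto simp: insert_commute)
    with \<open>a \<in> A\<close> show ?thesis by (auto simp: insert_commute)
  qed
  then show ?thesis
    using sub ind max by (auto simp: max_indep_def)
qed

text \<open>Nonfaces of the edge ideal enlarged by the variables in \<open>X\<close>; the quotient
  is that of G - X, over the unchanged ring.\<close>

definition nonface :: "'v ugraph \<Rightarrow> 'v set \<Rightarrow> 'v set \<Rightarrow> bool" where
  "nonface G X S \<longleftrightarrow> (\<exists>e\<in>edges G. e \<subseteq> S) \<or> S \<inter> X \<noteq> {}"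

lemma nonface_up_closed: "up_closed (nonface G X)"
  by (fastforce simp: up_closed_def nonface_def)

lemma nonface_insert:
  assumes G: "simple_graph G" and x: "x \<notin> X"
  shows "nonface G X (insert x S) \<longleftrightarrow> nonface G (X \<union> neighbours G x) S"
proof
  assume *: "nonface G X (insert x S)"
  show "nonface G (X \<union> neighbours G x) S"
  proof (cases "S \<inter> X = {}")
    case True
    then obtain e where e: "e \<in> edges G" "e \<subseteq> insert x S"
      using * x by (auto simp: nonface_def)
    obtain u v where uv: "e = {u, v}" "u \<noteq> v" using e(1) simple_graph_edgeE[OF G] by metis
    show ?thesis
    proof (cases "x \<in> e")
      case True
      then obtain y where "e = {x, y}" "y \<noteq> x" using uv by auto
      then show ?thesis using e by (auto simp: nonface_def neighbours_def)
    next
      case False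
      then have "e \<subseteq> S" using e by auto
      then show ?thesis using e by (auto simp: nonface_def)
    qed
  qed (auto simp: nonface_def)
next
  assume "nonface G (X \<union> neighbours G x) S"
  then show "nonface G X (insert x S)"
    unfolding nonface_def neighbours_def by fastforce
qed

lemma nonface_delete: "nonface G (insert x X) S \<longleftrightarrow> nonface G X S \<or> x \<in> S"
  by (auto simp: nonface_def)

section \<open>Vanishing and nonvanishing of Ext for edge ideals\<close>

locale residue_resolution_graph = residue_resolution "verts G" b d \<epsilon>
  for G :: "'v ugraph" and b :: "nat \<Rightarrow> nat"
    and d :: "nat \<Rightarrow> (nat \<Rightarrow> ('v, 'k::field) mpoly) \<Rightarrow> (nat \<Rightarrow> ('v, 'k) mpoly)"
    and \<epsilon> :: "(nat \<Rightarrow> ('v, 'k) mpoly) \<Rightarrow> 'k" +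
  assumes simple: "simple_graph G"
begin

abbreviation graph_ideal :: "'v set \<Rightarrow> ('v, 'k) mpoly set" where
  "graph_ideal X \<equiv> sr_ideal (verts G) (nonface G X)"

lemma graph_ideal_independent:
  assumes "independent G (verts G - X)"
  shows "graph_ideal X = vars_ideal (verts G) X"
  using assms by (intro sr_ideal_cong) (auto simp: nonface_def independent_def)

context
  fixes x X assumes x: "x \<in> verts G - X"
begin

lemma graph_ideal_link:
  "r \<in> carrier (poly_ring (verts G)) \<Longrightarrow>
    r \<in> graph_ideal (X \<union> neighbours G x) \<longleftrightarrow> var x * r \<in> graph_ideal X"
  using x nonface_insert[OF simple, of x X]
  by (subst sr_ideal_colon[OF nonface_up_closed, symmetric]) (auto intro!: arg_cong2[where f = "(\<in>)"])

lemma graph_ideal_delete: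
  "r \<in> carrier (poly_ring (verts G)) \<Longrightarrow>
    r \<in> graph_ideal (insert x X) \<longleftrightarrow> (\<exists>s\<in>carrier (poly_ring (verts G)). r - var x * s \<in> graph_ideal X)"
  using x unfolding nonface_delete[abs_def]
  by (intro sr_ideal_plus[OF nonface_up_closed]) auto

lemma graph_vanishing_middle:
  assumes "vanishing (graph_ideal (X \<union> neighbours G x)) i" "vanishing (graph_ideal (insert x X)) i"
  shows "vanishing (graph_ideal X) i"
  by (rule vanishing_middle[OF sr_ideal_ideal[OF nonface_up_closed] var_mem
        graph_ideal_link graph_ideal_delete assms]) (use x in auto)

lemma graph_vanishing_colon:
  assumes "\<And>j. i = Suc j \<Longrightarrow> vanishing (graph_ideal (insert x X)) j" "vanishing (graph_ideal X) i"
  shows "vanishing (graph_ideal (X \<union> neighbours G x)) i"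
  by (rule vanishing_colon[OF sr_ideal_ideal[OF nonface_up_closed] var_mem
        graph_ideal_link graph_ideal_delete assms]) (use x in auto)

end

text \<open>Induction on the number of remaining vertices. Maximal independent sets of both smaller
  graphs are maximal in the present one, so they inherit the bound \<open>n\<close> and both ends of
  the exact sequence vanish. An edgeless rest gives a polynomial ring.\<close>

lemma vanishing_below:
  assumes dis: "dismantlable G" and "X \<subseteq> verts G"
    and "\<And>A. max_indep G X A \<Longrightarrow> n \<le> card A" and "i < n"
  shows "vanishing (graph_ideal X) i"
  using assms(2,3)
proof (induction "card (verts G - X)" arbitrary: X rule: less_induct)
  case less
  show ?case
  proof (cases "independent G (verts G - X)")
    case True
    then have "n \<le> card (verts G - X)"
      by (intro less.prems(2)) (simp add: max_indep_def)
    then show ?thesis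
      using vanishing_vars_ideal[OF less.prems(1)] \<open>i < n\<close>
      by (simp add: graph_ideal_independent[OF True])
  next
    case False
    then obtain x v where x: "x \<in> verts G - X" and v: "v \<in> verts G - X" and xv: "{x, v} \<in> edges G"
      and dom: "\<And>y. y \<in> verts G - X \<Longrightarrow> {v, y} \<in> edges G \<Longrightarrow> y = x \<or> {x, y} \<in> edges G"
      using dis less.prems(1) unfolding dismantlable_def independent_def by metis
    have "neighbours G x \<subseteq> verts G"
      using simple_graph_edgeD[OF simple] by (auto simp: neighbours_def)
    moreover have "v \<in> neighbours G x" using xv by (simp add: neighbours_def)
    ultimately have link: "vanishing (graph_ideal (X \<union> neighbours G x)) i"
      using v less.prems finV
      by (intro less.hyps psubset_card_mono) (auto dest: max_indep_link[OF simple x])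
    have delete: "vanishing (graph_ideal (insert x X)) i"
    proof (rule less.hyps)
      show "card (verts G - insert x X) < card (verts G - X)"
        using x finV by (intro psubset_card_mono) auto
      show "n \<le> card A" if "max_indep G (insert x X) A" for A
        using max_indep_delete[OF simple x v xv dom that] by (rule less.prems(2))
    qed (use x less.prems in auto)
    from graph_vanishing_middle[OF x link delete] show ?thesis .
  qed
qed

text \<open>The vertices of \<open>D\<close> are processed one after the other; the private neighbour \<open>p c\<close> survives
  until the turn of \<open>c\<close>, and shows that deleting \<open>c\<close> does not produce smaller maximal
  independent sets.\<close>

lemma not_vanishing_at:
  assumes dis: "dismantlable G" and A: "A \<subseteq> verts G" "independent G A" and CA: "C \<subseteq> A"
    and dom: "\<And>y. y \<in> verts G - A \<Longrightarrow> \<exists>c\<in>C. {c, y} \<in> edges G"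
    and p: "\<And>c. c \<in> C \<Longrightarrow> {c, p c} \<in> edges G"
      "\<And>c y. c \<in> C \<Longrightarrow> {p c, y} \<in> edges G \<Longrightarrow> y = c \<or> {c, y} \<in> edges G"
      "\<And>c a. c \<in> C \<Longrightarrow> a \<in> A \<Longrightarrow> a \<noteq> c \<Longrightarrow> {a, p c} \<notin> edges G"
    and D: "finite D" "D \<subseteq> C"
    and min: "\<And>B. max_indep G (\<Union>c\<in>C - D. neighbours G c) B \<Longrightarrow> card A \<le> card B"
  shows "\<not> vanishing (graph_ideal (\<Union>c\<in>C - D. neighbours G c)) (card A)"
  using D min
proof (induction D rule: finite_induct)
  case empty
  \<comment> \<open>With no vertex left to process, exactly \<open>A\<close> survives; it carries no
    edges, so the quotient is a polynomial ring in card A variables.\<close>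
  have "(\<Union>c\<in>C. neighbours G c) = verts G - A"
    using dom CA A simple_graph_edgeD[OF simple] by (fastforce simp: neighbours_def independent_def)
  moreover have "verts G - (verts G - A) = A" using A by auto
  ultimately show ?case
    using vanishing_vars_ideal[of "verts G - A"] A by (simp add: graph_ideal_independent)
next
  case (insert c D)
  let ?X = "\<Union>c\<in>C - insert c D. neighbours G c"
  have c: "c \<in> C" using insert.prems by simp
  \<comment> \<open>As \<open>A\<close> is independent, no other vertex of \<open>C\<close> has
    deleted \<open>c\<close>.\<close>
  then have cV: "c \<in> verts G - ?X"
    using CA A by (fastforce simp: neighbours_def independent_def)
  have pV: "p c \<in> verts G - ?X"
    using simple_graph_edgeD[OF simple p(1)[OF c]] p(3)[OF c] CA by (auto simp: neighbours_def)
  have X: "?X \<union> neighbours G c = (\<Union>c\<in>C - D. neighbours G c)"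
    using c insert.hyps by auto
  have sub: "?X \<subseteq> verts G" using simple_graph_edgeD[OF simple] by (auto simp: neighbours_def)
  have link: "\<not> vanishing (graph_ideal (?X \<union> neighbours G c)) (card A)"
    unfolding X
    using insert.IH insert.prems max_indep_link[OF simple cV] unfolding X by blast
  \<comment> \<open>The connecting homomorphism into degree card A starts in degree card A - 1,
    which is below the size of every maximal independent set left after deleting
    \<open>c\<close>.\<close>
  have delete: "vanishing (graph_ideal (insert c ?X)) j" if "card A = Suc j" for j
  proof (rule vanishing_below[OF dis])
    show "insert c ?X \<subseteq> verts G" using sub cV by auto
    show "card A \<le> card B" if "max_indep G (insert c ?X) B" for B
      using insert.prems(2) max_indep_delete[OF simple cV pV p(1)[OF c] p(2)[OF c] that] by blast
    show "j < card A" using that by simp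
  qed
  from graph_vanishing_colon[OF cV delete] link show ?case by blast
qed

end

text \<open>\<open>C\<close> may be smaller than \<open>A\<close>: vertices of \<open>A\<close>
  without a private neighbour can be left out as long as \<open>C\<close> still dominates the
  complement of \<open>A\<close>. Taking D = C starts the elimination with nothing deleted.\<close>

theorem edge_depth_eq:
  fixes G :: "'v ugraph"
  assumes G: "simple_graph G" and dis: "dismantlable G"
    and A: "A \<subseteq> verts G" "independent G A" and CA: "C \<subseteq> A"
    and dom: "\<And>y. y \<in> verts G - A \<Longrightarrow> \<exists>c\<in>C. {c, y} \<in> edges G"
    and p: "\<And>c. c \<in> C \<Longrightarrow> \<exists>p. {c, p} \<in> edges G \<and>
      (\<forall>y. {p, y} \<in> edges G \<longrightarrow> y = c \<or> {c, y} \<in> edges G) \<and>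
      (\<forall>a\<in>A - {c}. {a, p} \<notin> edges G)"
    and min: "\<And>B. max_indep G {} B \<Longrightarrow> card A \<le> card B"
  shows "edge_depth TYPE('k::field) G = card A"
proof -
  have fin: "finite (verts G)" using G by (simp add: simple_graph_def)
  obtain p where p: "\<And>c. c \<in> C \<Longrightarrow> {c, p c} \<in> edges G \<and>
      (\<forall>y. {p c, y} \<in> edges G \<longrightarrow> y = c \<or> {c, y} \<in> edges G) \<and>
      (\<forall>a\<in>A - {c}. {a, p c} \<notin> edges G)"
    using p by metis
  let ?I = "sr_ideal (verts G) (nonface G {}) :: ('v, 'k) mpoly set"
  have I: "(edge_ideal G :: ('v, 'k) mpoly set) = ?I"
    unfolding edge_ideal_sr_ideal[OF G] by (intro sr_ideal_cong) (simp add: nonface_def)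
  have "depth (verts G) (quotient_module (poly_ring (verts G)) ?I) = card A"
  proof (rule depth_eqI[OF fin sr_ideal_ideal[OF nonface_up_closed]])
    fix b d and \<epsilon> :: "(nat \<Rightarrow> ('v, 'k) mpoly) \<Rightarrow> 'k"
    assume "residue_resolution (verts G) b d \<epsilon>"
    then interpret residue_resolution_graph G b d \<epsilon>
      using G by (simp add: residue_resolution_graph_def residue_resolution_graph_axioms_def)
    have "vanishing ?I i" if "i < card A" for i
      using min that by (intro vanishing_below[OF dis]) auto
    moreover have "\<not> vanishing ?I (card A)"
      using not_vanishing_at[OF dis A CA dom, of p C] p min finite_subset[OF _ fin] A CA by auto
    ultimately show "(\<forall>i<card A. vanishing ?I i) \<and> \<not> vanishing ?I (card A)" by blast
  qed
  then show ?thesis by (simp add: edge_depth_def I)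
qed

section \<open>Cliques with branches\<close>

text \<open>\<open>K s\<close> and \<open>N s\<close> are the old and the new vertices of an attached clique.  Fan graphs arise with
  \<open>B2 = {}\<close>, their \<open>\<circ>\<close>-composites with \<open>B1 \<inter> B2 = {v}\<close>.\<close>

definition branch_graph :: "'a set \<Rightarrow> 'a set \<Rightarrow> 's set \<Rightarrow> ('s \<Rightarrow> 'a set) \<Rightarrow> ('s \<Rightarrow> 'a set) \<Rightarrow> 'a ugraph" where
  "branch_graph B1 B2 S K N =
     \<lparr>verts = B1 \<union> B2 \<union> (\<Union>s\<in>S. N s),
      edges = complete_edges B1 \<union> complete_edges B2 \<union> (\<Union>s\<in>S. complete_edges (K s \<union> N s))\<rparr>"

lemma pair_complete_edges [simp]: "{x, y} \<in> complete_edges A \<longleftrightarrow> x \<in> A \<and> y \<in> A \<and> x \<noteq> y"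
  by (auto simp: complete_edges_def card_insert_if)

lemma complete_edges_mono: "A \<subseteq> B \<Longrightarrow> complete_edges A \<subseteq> complete_edges B"
  by (auto simp: complete_edges_def)

text \<open>Counts attached cliques, not edges: the number of new vertices that an independent set
  saves by containing the base vertex \<open>u\<close>.\<close>

definition branch_degree :: "'s set \<Rightarrow> ('s \<Rightarrow> 'a set) \<Rightarrow> 'a \<Rightarrow> nat" where
  "branch_degree S K u = card {s \<in> S. u \<in> K s}"

locale branched_cliques =
  fixes B1 B2 :: "'a set" and S :: "'s set" and K N :: "'s \<Rightarrow> 'a set"
  assumes fin: "finite B1" "finite B2" "finite S" "\<And>s. s \<in> S \<Longrightarrow> finite (N s)"
    and K: "\<And>s. s \<in> S \<Longrightarrow> K s \<subseteq> B1 \<or> K s \<subseteq> B2"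
    and N_nonempty: "\<And>s. s \<in> S \<Longrightarrow> N s \<noteq> {}"
    and N_base: "\<And>s. s \<in> S \<Longrightarrow> N s \<inter> (B1 \<union> B2) = {}"
    and N_disjoint: "\<And>s s'. s \<in> S \<Longrightarrow> s' \<in> S \<Longrightarrow> s \<noteq> s' \<Longrightarrow> N s \<inter> N s' = {}"
    and overlap: "\<And>x y. x \<in> B1 \<inter> B2 \<Longrightarrow> y \<in> B1 \<inter> B2 \<Longrightarrow> x = y"
begin

abbreviation "H \<equiv> branch_graph B1 B2 S K N"

abbreviation "deg \<equiv> branch_degree S K"

lemma adj_iff: "{x, y} \<in> edges H \<longleftrightarrow> x \<noteq> y \<and>
    (x \<in> B1 \<and> y \<in> B1 \<or> x \<in> B2 \<and> y \<in> B2 \<or> (\<exists>s\<in>S. x \<in> K s \<union> N s \<and> y \<in> K s \<union> N s))"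
  by (auto simp: branch_graph_def)

lemma no_loop [simp]: "{x} \<notin> edges H"
  using adj_iff[of x x] by simp

lemma adj_new:
  assumes "s \<in> S" "x \<in> N s"
  shows "{x, y} \<in> edges H \<longleftrightarrow> x \<noteq> y \<and> y \<in> K s \<union> N s"
proof -
  have "s' = s" if "s' \<in> S" "x \<in> K s' \<union> N s'" for s'
    using K[OF that(1)] N_base[OF assms(1)] N_disjoint[OF that(1) assms(1)] assms(2) that(2) by blast
  then show ?thesis
    using assms N_base[OF assms(1)] unfolding adj_iff by blast
qed

lemma adj_base:
  assumes "x \<in> B1 \<union> B2" "y \<in> B1 \<union> B2"
  shows "{x, y} \<in> edges H \<longleftrightarrow> x \<noteq> y \<and> (x \<in> B1 \<and> y \<in> B1 \<or> x \<in> B2 \<and> y \<in> B2)"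
  using assms K N_base unfolding adj_iff by blast

lemma verts_H: "verts H = B1 \<union> B2 \<union> (\<Union>s\<in>S. N s)"
  by (simp add: branch_graph_def)

lemma simple: "simple_graph H"
proof -
  have "complete_edges (K s \<union> N s) \<subseteq> complete_edges (verts H)" if "s \<in> S" for s
    unfolding verts_H using K[OF that] that by (intro complete_edges_mono) auto
  moreover have "complete_edges B1 \<subseteq> complete_edges (verts H)" "complete_edges B2 \<subseteq> complete_edges (verts H)"
    unfolding verts_H by (intro complete_edges_mono; blast)+
  moreover have "edges H = complete_edges B1 \<union> complete_edges B2 \<union> (\<Union>s\<in>S. complete_edges (K s \<union> N s))"
    by (simp add: branch_graph_def)
  ultimately show ?thesis
    unfolding simple_graph_def using fin by (auto simp: verts_H)
qed

lemma dismantlable: "dismantlable H"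
\<comment> \<open>New vertices are eliminated first, then those only in \<open>B1\<close>, then
  \<open>B2\<close>. The shared vertex belongs to the last group, so its neighbours outside
  \<open>B2\<close> no longer count.\<close>
proof (rule dismantlable_rank[OF simple, of "\<lambda>x. if x \<in> B2 then 2 else if x \<in> B1 then 1 else 0"])
  let ?r = "\<lambda>x. if x \<in> B2 then 2 else if x \<in> B1 then 1 else (0::nat)"
  fix v y z
  assume vy: "{v, y} \<in> edges H" and vz: "{v, z} \<in> edges H"
    and r: "?r v \<le> ?r y" "?r v \<le> ?r z" and yz: "y \<noteq> z"
  have v: "v \<in> verts H" using simple_graph_edgeD[OF simple vy] by simp
  show "{y, z} \<in> edges H"
  proof (cases "v \<in> B1 \<union> B2")
    case True
    then have "y \<in> B1 \<union> B2" "z \<in> B1 \<union> B2" using r by (auto split: if_splits)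
    then show ?thesis
      using vy vz r yz True by (auto simp: adj_base split: if_splits)
  next
    case False
    then obtain s where s: "s \<in> S" "v \<in> N s" using v by (auto simp: verts_H)
    then have "y \<in> K s \<union> N s" "z \<in> K s \<union> N s" using vy vz by (simp_all only: adj_new)
    then show ?thesis
      using yz s(1) unfolding adj_iff by blast
  qed
qed

lemma independent_iff: "independent H A \<longleftrightarrow> (\<forall>x\<in>A. \<forall>y\<in>A. {x, y} \<notin> edges H)"
  unfolding independent_def using simple_graph_edgeE[OF simple]
  by (metis empty_subsetI insert_subset)

text \<open>The neighbours of a new vertex all lie in its own attached clique. So maximality forces
  exactly one new vertex of that clique into \<open>A\<close>, unless an old one already belongs to
  \<open>A\<close>.\<close>

lemma card_max_indep:
  assumes A: "max_indep H {} A"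
  shows "card A = card (A \<inter> (B1 \<union> B2)) + card {s \<in> S. K s \<inter> A = {}}"
proof -
  have sub: "A \<subseteq> B1 \<union> B2 \<union> (\<Union>s\<in>S. N s)" and ind: "\<And>x y. x \<in> A \<Longrightarrow> y \<in> A \<Longrightarrow> {x, y} \<notin> edges H"
    and max: "\<And>y. y \<in> verts H - A \<Longrightarrow> \<exists>a\<in>A. {a, y} \<in> edges H"
    using A by (auto simp: max_indep_def verts_H independent_iff)
  have finA: "finite A" using sub by (rule finite_subset) (use fin in auto)
  have one: "card (A \<inter> N s) = (if K s \<inter> A = {} then 1 else 0)" if s: "s \<in> S" for s
  proof (cases "K s \<inter> A = {}")
    case True
    have "A \<inter> N s \<noteq> {}"
    proof -
      obtain y where y: "y \<in> N s" using N_nonempty[OF s] by blast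
      show ?thesis
      proof (cases "y \<in> A")
        case False
        then obtain a where "a \<in> A" "{y, a} \<in> edges H"
          using max[of y] y s by (auto simp: verts_H insert_commute)
        then show ?thesis using True by (auto simp: adj_new[OF s y])
      qed (use y in auto)
    qed
    then obtain y where y: "y \<in> A" "y \<in> N s" by blast
    have "A \<inter> N s = {y}" using y ind[OF y(1)] by (auto simp: adj_new[OF s y(2)])
    then show ?thesis using True by simp
  next
    case False
    then obtain u where "u \<in> K s" "u \<in> A" by blast
    then have "A \<inter> N s = {}"
      using ind K[OF s] N_base[OF s] by (force simp: adj_new[OF s])
    then show ?thesis using False by simp
  qed
  have "A = A \<inter> (B1 \<union> B2) \<union> (\<Union>s\<in>S. A \<inter> N s)" using sub by blast
  then have "card A = card (A \<inter> (B1 \<union> B2) \<union> (\<Union>s\<in>S. A \<inter> N s))" by simp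
  also have "\<dots> = card (A \<inter> (B1 \<union> B2)) + card (\<Union>s\<in>S. A \<inter> N s)"
    using finA fin N_base by (intro card_Un_disjoint) auto
  also have "card (\<Union>s\<in>S. A \<inter> N s) = (\<Sum>s\<in>S. card (A \<inter> N s))"
    using fin finA N_disjoint by (intro card_UN_disjoint) blast+
  also have "\<dots> = (\<Sum>s\<in>S. if K s \<inter> A = {} then 1 else 0)"
    by (intro sum.cong) (simp_all add: one)
  also have "\<dots> = card {s \<in> S. K s \<inter> A = {}}"
    using sum.inter_filter[OF fin(3), of "\<lambda>_. 1 :: nat" "\<lambda>s. K s \<inter> A = {}"] by simp
  finally show ?thesis .
qed

text \<open>Given the base part \<open>F\<close> of an independent set, one new vertex is added in every branch not
  met by \<open>F\<close>; \<open>F'\<close> is the part of \<open>F\<close> used for dominating.\<close>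

lemma edge_depth_from_base:
  assumes F: "F \<subseteq> B1 \<union> B2" "independent H F" and F': "F' \<subseteq> F"
    and dom: "\<And>y. y \<in> (B1 \<union> B2) - F \<Longrightarrow> \<exists>c\<in>F'. {c, y} \<in> edges H"
    and branch: "\<And>s. s \<in> S \<Longrightarrow> K s \<inter> F \<noteq> {} \<Longrightarrow> K s \<inter> F' \<noteq> {}"
    and priv: "\<And>c. c \<in> F' \<Longrightarrow> \<exists>p. {c, p} \<in> edges H \<and>
      (\<forall>y. {p, y} \<in> edges H \<longrightarrow> y = c \<or> {c, y} \<in> edges H) \<and>
      (\<forall>a\<in>F - {c}. {a, p} \<notin> edges H) \<and> (\<forall>s\<in>S. K s \<inter> F = {} \<longrightarrow> p \<notin> K s \<union> N s)"
    and lower: "\<And>A. max_indep H {} A \<Longrightarrow> card F + card {s \<in> S. K s \<inter> F = {}} \<le> card A"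
  shows "edge_depth TYPE('k::field) H = card F + card {s \<in> S. K s \<inter> F = {}}"
proof -
  define w where "w s = (SOME x. x \<in> N s)" for s
  have w: "w s \<in> N s" if "s \<in> S" for s
    using N_nonempty[OF that] unfolding w_def by (rule some_in_eq[THEN iffD2])
  define S0 where "S0 = {s \<in> S. K s \<inter> F = {}}"
  define A where "A = F \<union> w ` S0"
  \<comment> \<open>A lone new vertex \<open>w s\<close> of an unmet clique has all its neighbours
    in \<open>K s\<close>, where they are dominated by \<open>F'\<close>; it has no private
    neighbour and is left out.\<close>
  define C where "C = F' \<union> w ` {s \<in> S0. N s \<noteq> {w s}}"
  have base_new: "x \<notin> N s" if "x \<in> B1 \<union> B2" "s \<in> S" for x s
    using N_base[OF that(2)] that(1) by blast
  have FN: "x \<notin> N s" if "x \<in> F" "s \<in> S" for x s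
    using base_new F that by blast
  have w_adj: "{a, x} \<notin> edges H" if s: "s \<in> S0" and a: "a \<in> A" "a \<noteq> w s" and x: "x \<in> N s" for s a x
  proof
    assume "{a, x} \<in> edges H"
    then have aKN: "a \<in> K s \<union> N s"
      using s x adj_new[of s x a] by (auto simp: S0_def insert_commute)
    have sS: "s \<in> S" "K s \<inter> F = {}" using s by (auto simp: S0_def)
    show False
    proof (cases "a \<in> F")
      case True
      then show ?thesis using aKN sS FN by blast
    next
      case False
      then obtain s' where s': "s' \<in> S" "a = w s'" using a by (auto simp: A_def S0_def)
      then have "a \<in> N s'" "s' \<noteq> s" using a w by auto
      then show ?thesis
        using aKN N_disjoint[OF s'(1) sS(1)] K[OF sS(1)] base_new[of a s'] s'(1) by blast
    qed
  qed
  have AV: "A \<subseteq> verts H" using F w by (auto simp: A_def S0_def verts_H)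
  have indA: "independent H A"
    unfolding independent_iff
  proof (intro ballI)
    fix x y assume x: "x \<in> A" and y: "y \<in> A"
    show "{x, y} \<notin> edges H"
    proof (cases "x = y \<or> x \<in> F \<and> y \<in> F")
      case True
      then show ?thesis using F(2) by (auto simp: independent_iff adj_iff)
    next
      case False
      then obtain s where s: "s \<in> S0" "x = w s \<or> y = w s" using x y by (auto simp: A_def)
      then have "w s \<in> N s" using w by (simp add: S0_def)
      then show ?thesis
        using w_adj[OF s(1) y, of x] w_adj[OF s(1) x, of y] s(2) False by (auto simp: insert_commute)
    qed
  qed
  have CA: "C \<subseteq> A" using F' by (auto simp: C_def A_def)
  have domA: "\<exists>c\<in>C. {c, y} \<in> edges H" if y: "y \<in> verts H - A" for y
  proof (cases "y \<in> B1 \<union> B2")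
    case True
    then show ?thesis using dom[of y] y by (auto simp: A_def C_def)
  next
    case False
    then obtain s where s: "s \<in> S" "y \<in> N s" using y by (auto simp: verts_H)
    show ?thesis
    proof (cases "K s \<inter> F = {}")
      case True
      then have "s \<in> S0" using s by (simp add: S0_def)
      moreover from this have "y \<noteq> w s" using y by (auto simp: A_def)
      ultimately have "w s \<in> C" "{w s, y} \<in> edges H"
        using s w[OF s(1)] by (auto simp: C_def adj_new[OF s(1)])
      then show ?thesis by blast
    next
      case False
      then obtain u where "u \<in> K s" "u \<in> F'" using branch[OF s(1)] by blast
      moreover from this have "u \<noteq> y" using F F' \<open>y \<notin> B1 \<union> B2\<close> by blast
      ultimately show ?thesis using s by (auto simp: C_def adj_iff)
    qed
  qed
  have privA: "\<exists>p. {c, p} \<in> edges H \<and> (\<forall>y. {p, y} \<in> edges H \<longrightarrow> y = c \<or> {c, y} \<in> edges H) \<and>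
      (\<forall>a\<in>A - {c}. {a, p} \<notin> edges H)" if c: "c \<in> C" for c
  proof (cases "c \<in> F'")
    case True
    obtain p where p: "{c, p} \<in> edges H" "\<forall>y. {p, y} \<in> edges H \<longrightarrow> y = c \<or> {c, y} \<in> edges H"
      "\<forall>a\<in>F - {c}. {a, p} \<notin> edges H" "\<forall>s\<in>S. K s \<inter> F = {} \<longrightarrow> p \<notin> K s \<union> N s"
      using priv[OF True] by blast
    \<comment> \<open>The last condition on \<open>p\<close> keeps it away from the new vertices
      that were added to \<open>F\<close>.\<close>
    have "{w s, p} \<notin> edges H" if "s \<in> S0" for s
      using that p(4) w[of s] adj_new[of s "w s" p] by (auto simp: S0_def)
    then have "\<forall>a\<in>A - {c}. {a, p} \<notin> edges H" using p(3) by (auto simp: A_def)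
    with p show ?thesis by blast
  next
    case False
    then obtain s where s: "s \<in> S0" "c = w s" "N s \<noteq> {w s}" using c by (auto simp: C_def)
    then have sS: "s \<in> S" and cN: "c \<in> N s" using w by (auto simp: S0_def)
    then obtain p where p: "p \<in> N s" "p \<noteq> c" using s by blast
    have "\<forall>a\<in>A - {c}. {a, p} \<notin> edges H" using w_adj[OF s(1) _ _ p(1)] s(2) by blast
    then show ?thesis
      using p by (intro exI[of _ p]) (auto simp: adj_new[OF sS p(1)] adj_new[OF sS cN])
  qed
  have inj: "inj_on w S0"
    using w N_disjoint by (intro inj_onI) (metis (no_types, lifting) S0_def disjoint_iff mem_Collect_eq)
  have "card A = card F + card (w ` S0)"
    unfolding A_def
  proof (rule card_Un_disjoint)
    show "finite F" using F(1) by (rule finite_subset) (use fin in auto)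
    show "F \<inter> w ` S0 = {}" using FN w by (auto simp: S0_def)
  qed (use fin in \<open>simp add: S0_def\<close>)
  then have cardA: "card A = card F + card S0" using inj by (simp add: card_image)
  show ?thesis
    unfolding S0_def[symmetric] cardA[symmetric]
    by (rule edge_depth_eq[OF simple dismantlable AV indA CA domA privA])
      (use lower in \<open>simp_all add: cardA S0_def\<close>)
qed

text \<open>A new vertex of the clique has no neighbour outside it, and every vertex inside is
  \<open>c\<close> or a neighbour of \<open>c\<close>.\<close>

lemma private_in_branch:
  assumes s: "s \<in> S" "K s \<inter> F = {c}" and F: "F \<subseteq> B1 \<union> B2"
  shows "\<exists>p. {c, p} \<in> edges H \<and> (\<forall>y. {p, y} \<in> edges H \<longrightarrow> y = c \<or> {c, y} \<in> edges H) \<and>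
    (\<forall>a\<in>F - {c}. {a, p} \<notin> edges H) \<and> (\<forall>s'\<in>S. K s' \<inter> F = {} \<longrightarrow> p \<notin> K s' \<union> N s')"
proof -
  obtain p where p: "p \<in> N s" using N_nonempty[OF s(1)] by blast
  have c: "c \<in> K s" using s(2) by blast
  have nbr: "{p, y} \<in> edges H \<longleftrightarrow> p \<noteq> y \<and> y \<in> K s \<union> N s" for y
    using adj_new[OF s(1) p] .
  have pc: "p \<noteq> c" using p c K[OF s(1)] N_base[OF s(1)] by blast
  have "p \<notin> K s' \<union> N s'" if "s' \<in> S" "K s' \<inter> F = {}" for s'
  proof -
    have "s' \<noteq> s" using s(2) that(2) by auto
    then show ?thesis
      using N_disjoint[OF s(1) that(1)] K[OF that(1)] N_base[OF s(1)] p by blast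
  qed
  moreover have "{a, p} \<notin> edges H" if "a \<in> F - {c}" for a
    using nbr[of a] that s F N_base[OF s(1)] by (auto simp: insert_commute)
  moreover have "{c, p} \<in> edges H" using nbr[of c] c pc by (simp add: insert_commute)
  moreover have "y = c \<or> {c, y} \<in> edges H" if "{p, y} \<in> edges H" for y
    using that nbr c s(1) by (auto simp: adj_iff)
  ultimately show ?thesis by blast
qed

lemma card_unmet:
  assumes "F \<subseteq> B1 \<union> B2"
  shows "card {s \<in> S. K s \<inter> F = {}} + card {s \<in> S. K s \<inter> F \<noteq> {}} = card S"
proof -
  have "card ({s \<in> S. K s \<inter> F = {}} \<union> {s \<in> S. K s \<inter> F \<noteq> {}}) =
      card {s \<in> S. K s \<inter> F = {}} + card {s \<in> S. K s \<inter> F \<noteq> {}}"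
    using fin by (intro card_Un_disjoint) auto
  moreover have "{s \<in> S. K s \<inter> F = {}} \<union> {s \<in> S. K s \<inter> F \<noteq> {}} = S" by auto
  ultimately show ?thesis by simp
qed

lemma met_singleton: "card {s \<in> S. K s \<inter> {u} \<noteq> {}} = deg u"
  unfolding branch_degree_def by (rule arg_cong[where f = card]) auto

lemma met_pair_le: "card {s \<in> S. K s \<inter> {u, w} \<noteq> {}} \<le> deg u + deg w"
proof -
  have "{s \<in> S. K s \<inter> {u, w} \<noteq> {}} = {s \<in> S. u \<in> K s} \<union> {s \<in> S. w \<in> K s}" by auto
  then show ?thesis unfolding branch_degree_def by (simp add: card_Un_le)
qed

end

section \<open>One base clique\<close>

locale branched_clique = branched_cliques B "{}" S K N for B S K N
begin

text \<open>The best base vertex is one lying in most attached cliques. A maximal independent set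
  with empty base part has card S elements, which is no smaller than 1 + card S - T because T \<ge>
  1.\<close>

lemma edge_depth_single:
  assumes T: "\<And>w. w \<in> B \<Longrightarrow> deg w \<le> T" and u: "u \<in> B" "deg u = T" and "T \<ge> 1"
  shows "edge_depth TYPE('k::field) H + T = 1 + card S"
proof -
  obtain s where s: "s \<in> S" "u \<in> K s"
    using u \<open>T \<ge> 1\<close> fin unfolding branch_degree_def
    by (metis (mono_tags, lifting) card.empty empty_Collect_eq not_one_le_zero)
  have unmet: "card {s \<in> S. K s \<inter> {u} = {}} + T = card S"
    using card_unmet[of "{u}"] met_singleton[of u] u by simp
  have "edge_depth TYPE('k) H = card {u} + card {s \<in> S. K s \<inter> {u} = {}}"
  proof (rule edge_depth_from_base[of "{u}" "{u}"])
    fix A assume A: "max_indep H {} A"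
    let ?F = "A \<inter> (B \<union> {})"
    have "K s \<inter> A = K s \<inter> ?F" if "s \<in> S" for s using K[OF that] by auto
    then have eq: "{s \<in> S. K s \<inter> A = {}} = {s \<in> S. K s \<inter> ?F = {}}" by auto
    have "x = y" if "x \<in> ?F" "y \<in> ?F" for x y
      using that A adj_base[of x y] by (auto simp: max_indep_def independent_iff)
    then consider "?F = {}" | w where "?F = {w}" "w \<in> B" by blast
    then have "1 + card S \<le> card A + T"
    proof cases
      case 1
      then show ?thesis using card_max_indep[OF A] eq \<open>T \<ge> 1\<close> by simp
    next
      case 2
      have "card {s \<in> S. K s \<inter> {w} = {}} + deg w = card S"
        using card_unmet[of "{w}"] met_singleton[of w] 2 by simp
      moreover have "card A = 1 + card {s \<in> S. K s \<inter> {w} = {}}"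
        using card_max_indep[OF A] unfolding eq unfolding 2 by simp
      ultimately show ?thesis using T[of w] 2 by linarith
    qed
    then show "card {u} + card {s \<in> S. K s \<inter> {u} = {}} \<le> card A" using unmet by simp
  next
    show "\<exists>p. {c, p} \<in> edges H \<and> (\<forall>y. {p, y} \<in> edges H \<longrightarrow> y = c \<or> {c, y} \<in> edges H) \<and>
      (\<forall>a\<in>{u} - {c}. {a, p} \<notin> edges H) \<and> (\<forall>s\<in>S. K s \<inter> {u} = {} \<longrightarrow> p \<notin> K s \<union> N s)"
      if "c \<in> {u}" for c
      using that s u by (intro private_in_branch[of s]) auto
  qed (use u in \<open>auto simp: independent_iff adj_iff\<close>)
  then show ?thesis using unmet by simp
qed

end

section \<open>Two base cliques with one common vertex\<close>

locale branched_cliques_at = branched_cliques B1 B2 S K N for B1 B2 S K N +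
  fixes v t1 t2
  assumes v: "B1 \<inter> B2 = {v}"
    and t1: "\<And>w. w \<in> B1 - {v} \<Longrightarrow> deg w \<le> t1" and t2: "\<And>w. w \<in> B2 - {v} \<Longrightarrow> deg w \<le> t2"
    and B1: "B1 - {v} \<noteq> {}" and B2: "B2 - {v} \<noteq> {}"
begin

text \<open>If \<open>t1 = 0\<close>, then no branch meets \<open>B1 - {v}\<close>, and a maximal independent set avoiding \<open>v\<close>
  must meet \<open>B1 - {v}\<close>.\<close>

lemma side1:
  assumes A: "max_indep H {} A" and "v \<notin> A"
  obtains F1 where "A \<inter> B1 = F1" "F1 = {} \<and> t1 \<ge> 1 \<or> (\<exists>w. F1 = {w} \<and> w \<in> B1 - {v})"
proof (cases "A \<inter> B1 = {}")
  case True
  have "t1 \<noteq> 0"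
  proof
    assume "t1 = 0"
    obtain w where w: "w \<in> B1 - {v}" using B1 by blast
    then have "{s \<in> S. w \<in> K s} = {}"
      using t1[OF w] \<open>t1 = 0\<close> fin by (simp add: branch_degree_def)
    moreover have "w \<notin> N s" if "s \<in> S" for s using N_base[OF that] w by blast
    moreover have "w \<notin> B2" using w v by blast
    ultimately have "\<And>y. {y, w} \<in> edges H \<Longrightarrow> y \<in> B1"
      by (auto simp: adj_iff)
    moreover have "w \<in> verts H - {} - A" using True w by (auto simp: verts_H)
    then obtain a where "a \<in> A" "{a, w} \<in> edges H"
      using A unfolding max_indep_def by blast
    ultimately show False using True by blast
  qed
  then show thesis using that True by auto
next
  case False
  have "x = y" if "x \<in> A \<inter> B1" "y \<in> A \<inter> B1" for x y
    using that A adj_base[of x y] by (auto simp: max_indep_def independent_iff)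
  then obtain w where "A \<inter> B1 = {w}" using False by blast
  then show thesis using that \<open>v \<notin> A\<close> by (metis Diff_iff Int_iff insertI1 singletonD)
qed

end

text \<open>Exchanging the two base cliques transfers one-sided facts to the other side; the rewrite
  keeps both sides speaking of the same graph.\<close>

sublocale branched_cliques_at \<subseteq> swapped: branched_cliques_at B2 B1 S K N v t2 t1
  rewrites "branch_graph B2 B1 S K N = branch_graph B1 B2 S K N"
proof -
  show "branched_cliques_at B2 B1 S K N v t2 t1"
  proof
    show "finite B2" "finite B1" "finite S" by (fact fin)+
    show "finite (N s)" if "s \<in> S" for s using that by (rule fin(4))
    show "K s \<subseteq> B2 \<or> K s \<subseteq> B1" if "s \<in> S" for s using K[OF that] by (rule disj_commute[THEN iffD1])
    show "N s \<noteq> {}" if "s \<in> S" for s using that by (rule N_nonempty)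
    show "N s \<inter> (B2 \<union> B1) = {}" if "s \<in> S" for s using N_base[OF that] by (simp add: Un_commute)
    show "N s \<inter> N s' = {}" if "s \<in> S" "s' \<in> S" "s \<noteq> s'" for s s' using that by (rule N_disjoint)
    show "x = y" if "x \<in> B2 \<inter> B1" "y \<in> B2 \<inter> B1" for x y
      using overlap[of x y] that by (simp add: Int_commute)
    show "B2 \<inter> B1 = {v}" using v by (simp add: Int_commute)
    show "deg w \<le> t2" if "w \<in> B2 - {v}" for w using that by (rule t2)
    show "deg w \<le> t1" if "w \<in> B1 - {v}" for w using that by (rule t1)
    show "B2 - {v} \<noteq> {}" "B1 - {v} \<noteq> {}" by (fact B1 B2)+
  qed
  show "branch_graph B2 B1 S K N = branch_graph B1 B2 S K N"
    by (simp add: branch_graph_def Un_commute)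
qed

context branched_cliques_at
begin

text \<open>The base part either is {v} or has at most one vertex on each side. An empty side
  contributes one vertex fewer but meets no clique, and its \<open>t\<close> being at least 1
  compensates.\<close>

lemma lower_bound:
  assumes A: "max_indep H {} A"
  shows "1 + card S \<le> card A + deg v \<or> 2 + card S \<le> card A + t1 + t2"
proof -
  define F where "F = A \<inter> (B1 \<union> B2)"
  have F: "F \<subseteq> B1 \<union> B2" by (simp add: F_def)
  have "K s \<inter> A = K s \<inter> F" if "s \<in> S" for s using K[OF that] by (auto simp: F_def)
  then have eq: "{s \<in> S. K s \<inter> A = {}} = {s \<in> S. K s \<inter> F = {}}" by auto
  have card: "card A + card {s \<in> S. K s \<inter> F \<noteq> {}} = card F + card S"
    using card_max_indep[OF A] card_unmet[OF F] unfolding eq F_def[symmetric] by linarith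
  show ?thesis
  proof (cases "v \<in> A")
    case True
    have "x = v" if "x \<in> F" for x
      using that True A adj_base[of v x] v by (auto simp: max_indep_def independent_iff F_def)
    then have "F = {v}" using True v by (auto simp: F_def)
    then show ?thesis using card met_singleton[of v] by simp
  next
    case False
    obtain F1 where F1: "A \<inter> B1 = F1" "F1 = {} \<and> t1 \<ge> 1 \<or> (\<exists>w. F1 = {w} \<and> w \<in> B1 - {v})"
      using side1[OF A False] by blast
    obtain F2 where F2: "A \<inter> B2 = F2" "F2 = {} \<and> t2 \<ge> 1 \<or> (\<exists>w. F2 = {w} \<and> w \<in> B2 - {v})"
      using swapped.side1[OF A False] by blast
    have F12: "F = F1 \<union> F2" using F1 F2 by (auto simp: F_def)
    have disj: "w1 \<noteq> w2" if "w1 \<in> B1 - {v}" "w2 \<in> B2 - {v}" for w1 w2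
      using that v by blast
    from F1(2) F2(2) show ?thesis
    proof (elim disjE exE conjE)
      fix w1 w2 assume "F1 = {w1}" "F2 = {w2}" and w: "w1 \<in> B1 - {v}" "w2 \<in> B2 - {v}"
      then have "F = {w1, w2}" "card F = 2" using F12 disj[OF w] by auto
      then show ?thesis
        using card met_pair_le[of w1 w2] t1[OF w(1)] t2[OF w(2)] by simp
    next
      fix w2 assume "F1 = {}" "t1 \<ge> 1" "F2 = {w2}" and w: "w2 \<in> B2 - {v}"
      then show ?thesis using card F12 met_singleton[of w2] t2[OF w] by simp
    next
      fix w1 assume "F2 = {}" "t2 \<ge> 1" "F1 = {w1}" and w: "w1 \<in> B1 - {v}"
      then show ?thesis using card F12 met_singleton[of w1] t1[OF w] by simp
    qed (use card F12 in simp_all)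
  qed
qed

text \<open>The first hypothesis says that choosing \<open>v\<close> attains the lower bound. The
  second supplies a private neighbour of \<open>v\<close>: a new vertex of a clique through
  \<open>v\<close>, or else a vertex of \<open>B1\<close> in no attached clique.\<close>

lemma edge_depth_centre:
  assumes le: "t1 + t2 \<le> 1 + deg v" and pos: "deg v \<ge> 1 \<or> t1 = 0"
  shows "edge_depth TYPE('k::field) H + deg v = 1 + card S"
proof -
  have vB: "v \<in> B1" "v \<in> B2" using v by auto
  have unmet: "card {s \<in> S. K s \<inter> {v} = {}} + deg v = card S"
    using card_unmet[of "{v}"] met_singleton[of v] vB by simp
  have "\<exists>p. {v, p} \<in> edges H \<and> (\<forall>y. {p, y} \<in> edges H \<longrightarrow> y = v \<or> {v, y} \<in> edges H) \<and>
      (\<forall>a\<in>{v} - {v}. {a, p} \<notin> edges H) \<and> (\<forall>s\<in>S. K s \<inter> {v} = {} \<longrightarrow> p \<notin> K s \<union> N s)"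
  proof (cases "deg v \<ge> 1")
    case True
    then obtain s where "s \<in> S" "v \<in> K s"
      using fin unfolding branch_degree_def
      by (metis (mono_tags, lifting) card.empty empty_Collect_eq not_one_le_zero)
    then show ?thesis using vB by (intro private_in_branch[of s]) auto
  next
    case False
    then have "t1 = 0" using pos by simp
    obtain w where w: "w \<in> B1 - {v}" using B1 by blast
    then have "{s \<in> S. w \<in> K s} = {}"
      using t1[OF w] \<open>t1 = 0\<close> fin by (simp add: branch_degree_def)
    then have wK: "w \<notin> K s \<union> N s" if "s \<in> S" for s using N_base[OF that] w that by blast
    moreover have "w \<notin> B2" using w v by blast
    ultimately have "{w, y} \<in> edges H \<longleftrightarrow> w \<noteq> y \<and> y \<in> B1" for y
      using w by (auto simp: adj_iff)
    then show ?thesis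
      using w wK vB by (intro exI[of _ w]) (auto simp: adj_iff)
  qed
  then have "edge_depth TYPE('k) H = card {v} + card {s \<in> S. K s \<inter> {v} = {}}"
    using vB unmet lower_bound le
    by (intro edge_depth_from_base[of "{v}" "{v}"]) (fastforce simp: independent_iff adj_iff)+
  then show ?thesis using unmet by simp
qed

text \<open>Here two vertices other than \<open>v\<close> attain the bound. The assumption on
  \<open>t1\<close> gives \<open>w1\<close> a private new vertex; the mirrored case comes from
  \<open>swapped\<close>.\<close>

lemma edge_depth_two:
  assumes ge: "1 + deg v \<le> t1 + t2" and w1: "w1 \<in> B1 - {v}" "deg w1 = t1"
    and w2: "w2 \<in> B2 - {v}" "deg w2 = t2" and pos: "t1 \<ge> 1"
  shows "edge_depth TYPE('k::field) H + t1 + t2 = 2 + card S"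
proof -
  let ?F = "{w1, w2}"
  have vB: "v \<in> B1" "v \<in> B2" using v by auto
  have w12: "w1 \<in> B1" "w1 \<notin> B2" "w2 \<in> B2" "w2 \<notin> B1" "w1 \<noteq> w2" using w1 w2 v by blast+
  have disj: "{s \<in> S. w1 \<in> K s} \<inter> {s \<in> S. w2 \<in> K s} = {}" using K w12 by blast
  have "{s \<in> S. K s \<inter> ?F \<noteq> {}} = {s \<in> S. w1 \<in> K s} \<union> {s \<in> S. w2 \<in> K s}" by auto
  then have "card {s \<in> S. K s \<inter> ?F \<noteq> {}} = t1 + t2"
    using disj w1(2) w2(2) fin by (simp add: branch_degree_def card_Un_disjoint)
  then have unmet: "card {s \<in> S. K s \<inter> ?F = {}} + t1 + t2 = card S"
    using card_unmet[of ?F] w12 by simp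
  have in_branch: "\<exists>s\<in>S. K s \<inter> ?F = {w}" if w: "w \<in> ?F" "deg w \<ge> 1" for w
  proof -
    obtain s where "s \<in> S" "w \<in> K s"
      using fin w(2) unfolding branch_degree_def
      by (metis (mono_tags, lifting) card.empty empty_Collect_eq not_one_le_zero)
    then show ?thesis using disj w(1) by (intro bexI[of _ s]) auto
  qed
  \<comment> \<open>If t2 = 0 and B2 = {v, w2}, the only neighbour of \<open>w2\<close> is
    \<open>v\<close>, which is adjacent to \<open>w1\<close> too. Then \<open>w2\<close> has no
    private neighbour and is dropped; \<open>w1\<close> alone dominates the rest of the
    base.\<close>
  define F' where "F' = (if t2 = 0 \<and> B2 = {v, w2} then {w1} else ?F)"
  have "edge_depth TYPE('k) H = card ?F + card {s \<in> S. K s \<inter> ?F = {}}"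
  proof (rule edge_depth_from_base[of ?F F'])
    show "?F \<subseteq> B1 \<union> B2" "F' \<subseteq> ?F" using w12 by (auto simp: F'_def)
    show "independent H ?F"
      using w12 by (simp add: independent_iff adj_base insert_commute)
    show "\<exists>c\<in>F'. {c, y} \<in> edges H" if "y \<in> (B1 \<union> B2) - ?F" for y
    proof (cases "y \<in> B1")
      case True
      then show ?thesis using that w12 by (intro bexI[of _ w1]) (auto simp: adj_iff F'_def)
    next
      case False
      then have "y \<in> B2" "y \<noteq> w2" "y \<noteq> v" using that vB by auto
      then show ?thesis using w12 by (intro bexI[of _ w2]) (auto simp: adj_iff F'_def)
    qed
    show "K s \<inter> F' \<noteq> {}" if "s \<in> S" "K s \<inter> ?F \<noteq> {}" for s
    proof (cases "t2 = 0")
      case True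
      then have "{s \<in> S. w2 \<in> K s} = {}" using w2 fin by (simp add: branch_degree_def)
      then show ?thesis using that by (auto simp: F'_def)
    qed (use that in \<open>simp add: F'_def\<close>)
    show "card ?F + card {s \<in> S. K s \<inter> ?F = {}} \<le> card A" if "max_indep H {} A" for A
    proof -
      have "card ?F = 2" using w12 by simp
      then show ?thesis using lower_bound[OF that] ge unmet by linarith
    qed
    show "\<exists>p. {c, p} \<in> edges H \<and> (\<forall>y. {p, y} \<in> edges H \<longrightarrow> y = c \<or> {c, y} \<in> edges H) \<and>
      (\<forall>a\<in>?F - {c}. {a, p} \<notin> edges H) \<and> (\<forall>s\<in>S. K s \<inter> ?F = {} \<longrightarrow> p \<notin> K s \<union> N s)"
      if c: "c \<in> F'" for c
    proof (cases "deg c \<ge> 1")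
      case True
      have "c \<in> ?F" using c by (auto simp: F'_def split: if_splits)
      then obtain s where "s \<in> S" "K s \<inter> ?F = {c}" using in_branch True by blast
      then show ?thesis using w12 by (intro private_in_branch[of s]) auto
    next
      case False
      then have "c = w2" "t2 = 0" "B2 \<noteq> {v, w2}"
        using c w1 w2 pos by (auto simp: F'_def split: if_splits)
      \<comment> \<open>A further vertex of \<open>B2\<close> lies in no attached clique and is
        private to \<open>w2\<close>.\<close>
      then obtain w where w: "w \<in> B2 - {v}" "w \<noteq> w2" using w12 vB by blast
      then have "{s \<in> S. w \<in> K s} = {}"
        using t2[OF w(1)] \<open>t2 = 0\<close> fin by (simp add: branch_degree_def)
      then have wK: "w \<notin> K s \<union> N s" if "s \<in> S" for s using N_base[OF that] w that by blast
      moreover have "w \<notin> B1" using w v by blast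
      ultimately have "{w, y} \<in> edges H \<longleftrightarrow> w \<noteq> y \<and> y \<in> B2" for y
        using w by (auto simp: adj_iff)
      then show ?thesis
        using w wK w12 \<open>c = w2\<close> by (intro exI[of _ w]) (auto simp: adj_iff)
    qed
  qed
  then show ?thesis using unmet w12 by simp
qed

end

section \<open>Fan graphs as branched cliques\<close>

lemma complete_edges_empty [simp]: "complete_edges {} = {}"
  by (auto simp: complete_edges_def)

locale fan_data =
  fixes n k :: nat and P :: "nat \<Rightarrow> nat set" and u :: "nat \<Rightarrow> nat \<Rightarrow> nat" and A :: "nat \<Rightarrow> nat \<Rightarrow> nat set"
  assumes fan: "\<And>j. j \<in> {1..k} \<Longrightarrow> is_fan {1..n} (P j) (u j) (A j)"
    and A_disjoint: "disjoint_family_on (\<lambda>(j, i). A j i - {1..n}) (SIGMA j:{1..k}. {1..card (P j)})"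
    and P_sub: "\<And>j. j \<in> {1..k} \<Longrightarrow> P j \<subseteq> {1..n}"
    and P_nonempty: "\<And>j. j \<in> {1..k} \<Longrightarrow> P j \<noteq> {}"
    and P_disjoint: "disjoint_family_on P {1..k}"
begin

context
  notes One_nat_def [simp del]
begin

definition branches :: "(nat \<times> nat) set" where
  "branches = (SIGMA j:{1..k}. {1..card (P j)})"

definition old :: "nat \<times> nat \<Rightarrow> nat set" where
  "old = (\<lambda>(j, i). u j ` {1..i})"

definition new :: "nat \<times> nat \<Rightarrow> nat set" where
  "new = (\<lambda>(j, i). A j i - {1..n})"

lemma u_bij: "j \<in> {1..k} \<Longrightarrow> bij_betw (u j) {1..card (P j)} (P j)"
  using fan by (simp add: is_fan_def)

lemma card_P: "j \<in> {1..k} \<Longrightarrow> card (P j) \<ge> 1"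
  using P_nonempty[of j] finite_subset[OF P_sub, of j] card_gt_0_iff[of "P j"] by simp

lemma A_facts:
  assumes "j \<in> {1..k}" "i \<in> {1..card (P j)}"
  shows "finite (A j i)" "i < card (A j i)" "{1..n} \<inter> A j i = u j ` {1..i}"
  using fan[OF assms(1)] assms(2) by (auto simp: is_fan_def)

lemma old_sub: "(j, i) \<in> branches \<Longrightarrow> old (j, i) \<subseteq> P j"
  using u_bij[of j] by (auto simp: branches_def old_def bij_betw_def)

lemma old_un_new: "(j, i) \<in> branches \<Longrightarrow> old (j, i) \<union> new (j, i) = A j i"
  using A_facts(3)[of j i] by (auto simp: branches_def old_def new_def)

lemma new_nonempty: "(j, i) \<in> branches \<Longrightarrow> new (j, i) \<noteq> {}"
proof
  assume ji: "(j, i) \<in> branches" and "new (j, i) = {}"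
  then have "A j i = u j ` {1..i}" using old_un_new[OF ji] by (simp add: old_def)
  then have "card (A j i) \<le> i" using card_image_le[of "{1..i}" "u j"] by simp
  \<comment> \<open>Here the requirement that the i-th clique has more than i vertices
    enters.\<close>
  then show False using A_facts(2)[of j i] ji by (auto simp: branches_def)
qed

lemma branched_clique:
  assumes "S \<subseteq> branches"
  shows "branched_clique {1..n} S old new"
proof -
  have "finite branches" unfolding branches_def by (intro finite_SigmaI) auto
  then show ?thesis
  proof (unfold_locales, goal_cases)
    case 3
    then show ?case using assms by (rule rev_finite_subset)
  next
    case (4 s)
    then show ?case using assms A_facts(1) by (force simp: branches_def new_def)
  next
    case (5 s)
    then obtain j i where s: "s = (j, i)" "(j, i) \<in> branches" using assms by (cases s) auto
    then have "j \<in> {1..k}" by (simp add: branches_def)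
    then show ?case using old_sub[OF s(2)] P_sub[of j] s(1) by blast
  next
    case (6 s)
    then show ?case using assms new_nonempty[of "fst s" "snd s"] by auto
  next
    case (7 s)
    then show ?case by (auto simp: new_def)
  next
    case (8 s s')
    then show ?case
      using disjoint_family_onD[OF A_disjoint, of s s'] assms
      by (auto simp: branches_def new_def case_prod_beta)
  qed auto
qed

lemma u_mem:
  assumes "(j, l) \<in> branches"
  shows "u j l \<in> P j" "u j l \<in> {1..n}"
proof -
  have j: "j \<in> {1..k}" and l: "l \<in> {1..card (P j)}" using assms by (auto simp: branches_def)
  show "u j l \<in> P j" using bij_betw_apply[OF u_bij[OF j] l] .
  then show "u j l \<in> {1..n}" using P_sub[OF j] by blast
qed

lemma u_mem_old:
  assumes "(j, i) \<in> branches" "(j', l) \<in> branches"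
  shows "u j' l \<in> old (j, i) \<longleftrightarrow> j = j' \<and> l \<le> i"
proof
  assume *: "u j' l \<in> old (j, i)"
  have "u j' l \<in> P j'" using assms(2) by (rule u_mem)
  then have j: "j = j'"
    using * old_sub[OF assms(1)] disjoint_family_onD[OF P_disjoint, of j j'] assms
    by (auto simp: branches_def)
  obtain m where m: "m \<in> {1..i}" "u j' l = u j m" using * by (auto simp: old_def)
  then have "l = m"
    using bij_betw_imp_inj_on[OF u_bij[of j]] assms j unfolding branches_def
    by (auto dest!: inj_onD)
  then show "j = j' \<and> l \<le> i" using m j by simp
next
  assume "j = j' \<and> l \<le> i"
  then show "u j' l \<in> old (j, i)" using assms by (auto simp: branches_def old_def)
qed

lemma old_indices:
  assumes "w \<in> {1..n}" "branch_degree branches old w \<noteq> 0"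
  obtains j l where "(j, l) \<in> branches" "w = u j l"
proof -
  obtain s where "s \<in> branches" "w \<in> old s"
    using assms(2) unfolding branch_degree_def by (metis (mono_tags, lifting) card.empty empty_Collect_eq)
  then obtain j i l where "(j, i) \<in> branches" "l \<in> {1..i}" "w = u j l"
    by (cases s) (auto simp: old_def)
  then show thesis by (intro that[of j l]) (auto simp: branches_def)
qed

text \<open>The old vertices of the i-th clique are the first i in the ordering, so the l-th vertex
  lies in the cliques from l on. Their number is largest for l = 1, where it is card (P j).\<close>

lemma met_branches:
  assumes "(j, l) \<in> branches"
  shows "{s \<in> branches. u j l \<in> old s} = {j} \<times> {l..card (P j)}"
  using u_mem_old[OF _ assms] assms by (auto simp: branches_def)

lemma degree_u:
  assumes "(j, l) \<in> branches"
  shows "branch_degree branches old (u j l) = card (P j) - l + 1"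
  unfolding branch_degree_def met_branches[OF assms] using assms
  by (simp add: card_cartesian_product branches_def)

text \<open>A fan on \<open>P j\<close> attaches one clique for each element of
  \<open>P j\<close>.\<close>

lemma card_branches: "card branches = card (\<Union>j\<in>{1..k}. P j)"
proof -
  have "card branches = (\<Sum>j\<in>{1..k}. card (P j))"
    unfolding branches_def by (subst card_SigmaI) auto
  also have "\<dots> = card (\<Union>j\<in>{1..k}. P j)"
    using finite_subset[OF P_sub] P_disjoint
    by (intro card_UN_disjoint[symmetric]) (auto simp: disjoint_family_on_def)
  finally show ?thesis .
qed

lemma fan_branch_graph:
  "\<lparr>verts = {1..n} \<union> (\<Union>j\<in>{1..k}. \<Union>i\<in>{1..card (P j)}. A j i),
    edges = complete_edges {1..n} \<union> (\<Union>j\<in>{1..k}. \<Union>i\<in>{1..card (P j)}. complete_edges (A j i))\<rparr> =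
   branch_graph {1..n} {} branches old new"
proof -
  have un: "(\<Union>j\<in>{1..k}. \<Union>i\<in>{1..card (P j)}. h j i) = (\<Union>s\<in>branches. h (fst s) (snd s))"
    for h :: "nat \<Rightarrow> nat \<Rightarrow> 'a set"
    by (force simp: branches_def)
  have "complete_edges (A (fst s) (snd s)) = complete_edges (old s \<union> new s)" if "s \<in> branches" for s
    using old_un_new[of "fst s" "snd s"] that by simp
  moreover have "{1..n} \<union> (\<Union>s\<in>branches. A (fst s) (snd s)) = {1..n} \<union> (\<Union>s\<in>branches. new s)"
    by (auto simp: new_def case_prod_beta)
  ultimately show ?thesis by (simp add: branch_graph_def un)
qed

end

end

lemma k_fan_graphE:
  assumes "k_fan_graph n W k P G"
  obtains u A where "fan_data n k P u A"
    "G = branch_graph {1..n} {} (fan_data.branches k P) (fan_data.old u) (fan_data.new n A)"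
    "card (fan_data.branches k P) = card W"
proof -
  obtain u A where fan: "\<forall>j\<in>{1..k}. is_fan {1..n} (P j) (u j) (A j)"
    and disj: "disjoint_family_on (\<lambda>(j, i). A j i - {1..n}) (SIGMA j:{1..k}. {1..card (P j)})"
    and V: "verts G = {1..n} \<union> (\<Union>j\<in>{1..k}. \<Union>i\<in>{1..card (P j)}. A j i)"
    and E: "edges G = complete_edges {1..n} \<union>
          (\<Union>j\<in>{1..k}. \<Union>i\<in>{1..card (P j)}. complete_edges (A j i))"
    using assms unfolding k_fan_graph_def by (elim conjE exE)
  have W: "W \<subseteq> {1..n}" "\<forall>j\<in>{1..k}. P j \<noteq> {}" "disjoint_family_on P {1..k}" "(\<Union>j\<in>{1..k}. P j) = W"
    using assms unfolding k_fan_graph_def by - (elim conjE; assumption)+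
  have "fan_data n k P u A"
  proof
    fix j assume j: "j \<in> {1..k}"
    show "is_fan {1..n} (P j) (u j) (A j)" "P j \<noteq> {}" using fan W(2) j by blast+
    show "P j \<subseteq> {1..n}" using W(1,4) j by blast
  qed (fact disj W(3))+
  then interpret fan_data n k P u A .
  have "G = \<lparr>verts = verts G, edges = edges G\<rparr>" by simp
  then have "G = branch_graph {1..n} {} branches old new"
    unfolding V E fan_branch_graph .
  then show thesis
    using that[OF \<open>fan_data n k P u A\<close>] card_branches W by simp
qed

section \<open>Depth of a fan graph and removal of a leaf\<close>

context
  notes One_nat_def [simp del]
begin

lemma edge_depth_fan:
  assumes G: "k_fan_graph n W k P G" and k: "k \<ge> 1"
  shows "edge_depth TYPE('k::field) G + Max ((\<lambda>j. card (P j)) ` {1..k}) = 1 + card W"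
proof -
  obtain u A where data: "fan_data n k P u A"
    and G: "G = branch_graph {1..n} {} (fan_data.branches k P) (fan_data.old u) (fan_data.new n A)"
    and W: "card (fan_data.branches k P) = card W"
    using k_fan_graphE[OF G] by metis
  interpret fan_data n k P u A by fact
  interpret branched_clique "{1..n}" branches old new
    by (rule branched_clique) simp
  let ?T = "Max ((\<lambda>j. card (P j)) ` {1..k})"
  have le: "card (P j) \<le> ?T" if "j \<in> {1..k}" for j using that by (intro Max_ge) auto
  \<comment> \<open>The first vertex in the ordering of a largest part lies in all cliques of its
    fan and so realises \<open>?T\<close>.\<close>
  obtain j0 where j0: "j0 \<in> {1..k}" "card (P j0) = ?T"
    using Max_in[of "(\<lambda>j. card (P j)) ` {1..k}"] k by fastforce
  then have b: "(j0, 1) \<in> branches" using card_P[of j0] by (simp add: branches_def)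
  have T: "?T \<ge> 1" using card_P[OF j0(1)] j0(2) by simp
  show ?thesis
    unfolding G W[symmetric]
  proof (rule edge_depth_single)
    show "branch_degree branches old w \<le> ?T" if w: "w \<in> {1..n}" for w
    proof (cases "branch_degree branches old w = 0")
      case False
      then obtain j l where jl: "(j, l) \<in> branches" "w = u j l" using old_indices[OF w] by blast
      moreover have "card (P j) \<le> ?T" "l \<ge> 1" "l \<le> card (P j)"
        using jl(1) by (auto simp: branches_def intro: le)
      ultimately show ?thesis using degree_u[OF jl(1)] by simp
    qed simp
    show "u j0 1 \<in> {1..n}" using b by (rule u_mem)
    show "branch_degree branches old (u j0 1) = ?T"
      using degree_u[OF b] j0 T by simp
  qed (rule T)
qed

lemma leaf_edge_unique:
  assumes "leaf G f" "{f, v} \<in> edges G" "e \<in> edges G" "f \<in> e"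
  shows "e = {f, v}"
proof -
  have "card {e \<in> edges G. f \<in> e} = 1" using assms(1) by (simp add: leaf_def degree_def)
  then obtain e0 where e0: "{e \<in> edges G. f \<in> e} = {e0}" by (rule card_1_singletonE)
  have "e \<in> {e \<in> edges G. f \<in> e}" "{f, v} \<in> {e \<in> edges G. f \<in> e}"
    using assms(2-4) by simp_all
  then show ?thesis unfolding e0 by simp
qed

text \<open>Generically \<open>f\<close> is the only new vertex of a first clique {v, f}, and
  deleting it deletes that clique: one branch fewer in total and at \<open>v\<close>, none fewer at
  other vertices. If instead \<open>f\<close> is an old vertex, the base is the edge {f, v} with a
  single attached clique, which becomes a base without branches.\<close>

lemma remove_leaf_decomposition:
  assumes n: "n \<ge> 2" and k: "k \<ge> 1" and G: "k_fan_graph n W k P G" and f: "leaf G f"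
    and fv: "{f, v} \<in> edges G" and v: "v \<in> P 1"
  defines "T' \<equiv> Max ({card (P 1) - 1} \<union> (\<lambda>j. card (P j)) ` {2..k})"
  shows "\<exists>B S (K :: nat \<times> nat \<Rightarrow> nat set) N w. branched_clique B S K N \<and>
    remove_vertex G f = branch_graph B {} S K N \<and> v \<in> B \<and> card S + 1 = card W \<and>
    branch_degree S K v + 1 = card (P 1) \<and> (\<forall>w\<in>B - {v}. branch_degree S K w \<le> T') \<and>
    w \<in> B - {v} \<and> branch_degree S K w = T'"
proof -
  obtain u A where data: "fan_data n k P u A"
    and G_eq: "G = branch_graph {1..n} {} (fan_data.branches k P) (fan_data.old u) (fan_data.new n A)"
    and cardW: "card (fan_data.branches k P) = card W"
    using k_fan_graphE[OF G] by metis
  interpret fan_data n k P u A by fact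
  interpret branched_clique "{1..n}" branches old new
    by (rule branched_clique) simp
  have uniq: "y = v" if "{f, y} \<in> edges G" for y
    using leaf_edge_unique[OF f fv that] that unfolding G_eq
    by (metis doubleton_eq_iff insertI1 no_loop)
  have one: "1 \<in> {1..k}" using k by simp
  have vn: "v \<in> {1..n}" using v P_sub[OF one] by blast
  have f_neq: "f \<noteq> v" using fv no_loop[of v] unfolding G_eq by auto
  have fG: "f \<in> verts H" using f unfolding G_eq leaf_def by simp
  have T'_ge: "card (P j) \<le> T'" if "j \<in> {2..k}" for j
    unfolding T'_def using that by (intro Max_ge) auto
  have T'_ge1: "card (P 1) - 1 \<le> T'"
    unfolding T'_def by (intro Max_ge) auto
  have T'_in: "T' = card (P 1) - 1 \<or> (\<exists>j\<in>{2..k}. T' = card (P j))"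
    using Max_in[of "{card (P 1) - 1} \<union> (\<lambda>j. card (P j)) ` {2..k}"] unfolding T'_def by auto
  show ?thesis
  proof (cases "f \<in> {1..n}")
    case True
    \<comment> \<open>The rest of the base is adjacent to the leaf \<open>f\<close>, whose only
      neighbour is \<open>v\<close>.\<close>
    have n2: "{1..n} \<subseteq> {f, v}"
    proof
      fix y assume "y \<in> {1..n}"
      then show "y \<in> {f, v}" using uniq[of y] True unfolding G_eq by (auto simp: adj_iff)
    qed
    \<comment> \<open>As an old vertex of an attached clique, \<open>f\<close> would have a new
      vertex as a second neighbour.\<close>
    have "f \<notin> old s" if s: "s \<in> branches" for s
    proof
      assume "f \<in> old s"
      obtain p where p: "p \<in> new s" using N_nonempty[OF s] by blast
      then have "f \<noteq> p" using True N_base[OF s] by blast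
      then have "{f, p} \<in> edges G" using s p \<open>f \<in> old s\<close> unfolding G_eq by (auto simp: adj_iff)
      then show False using uniq[of p] vn p N_base[OF s] by blast
    qed
    moreover have "w \<in> old (j, card (P j)) \<and> (j, card (P j)) \<in> branches" if "j \<in> {1..k}" "w \<in> P j" for j w
      using that u_bij[OF that(1)] card_P[OF that(1)] by (auto simp: old_def branches_def bij_betw_def)
    ultimately have fP: "f \<notin> P j" if "j \<in> {1..k}" for j using that by blast
    have Pj: "P j = {v}" if "j \<in> {1..k}" for j
      using P_sub[OF that] P_nonempty[OF that] fP[OF that] n2 by blast
    have k1: "k = 1"
    proof (rule ccontr)
      assume "k \<noteq> 1"
      then have "2 \<in> {1..k}" using k by simp
      then show False using Pj[of 1] Pj[of 2] one disjoint_family_onD[OF P_disjoint, of 1 2] by auto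
    qed
    have P1: "P 1 = {v}" using Pj one by blast
    have br: "branches = {(1, 1)}" unfolding branches_def unfolding k1 using P1 by auto
    have old1: "old (1, 1) = {v}"
      using old_sub[of 1 1] P1 by (auto simp: br old_def)
    let ?B = "{v} \<union> new (1, 1)"
    have Nf: "f \<notin> new (1, 1)" using True N_base[of "(1, 1)"] br by auto
    have n_eq: "{1..n} = {f, v}" using n2 True vn by auto
    have rem: "remove_vertex G f = branch_graph ?B {} ({} :: (nat \<times> nat) set) old new"
    proof -
      have "{e \<in> edges G. f \<notin> e} = complete_edges ?B"
      proof -
        have "edges G = {{f, v}} \<union> complete_edges ?B"
          unfolding G_eq branch_graph_def br old1[symmetric] n_eq[symmetric]
          using n_eq f_neq by (auto simp: complete_edges_def card_2_iff old1 br)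
        moreover have "f \<notin> e" if "e \<in> complete_edges ?B" for e
          using that Nf f_neq by (auto simp: complete_edges_def)
        ultimately show ?thesis by auto
      qed
      moreover have "verts G - {f} = ?B"
        unfolding G_eq branch_graph_def br n_eq using Nf f_neq by auto
      ultimately show ?thesis by (simp add: remove_vertex_def branch_graph_def)
    qed
    have T'0: "T' = 0" by (simp add: T'_def P1 k1)
    obtain p where p: "p \<in> new (1, 1)" using N_nonempty[of "(1, 1)"] br by auto
    then have pv: "p \<noteq> v" using N_base[of "(1, 1)"] br vn by auto
    have "branched_clique ?B ({} :: (nat \<times> nat) set) old new"
      using fin(4)[of "(1, 1)"] br by unfold_locales auto
    moreover have "card W = 1" using cardW br by simp
    ultimately show ?thesis
      using rem p pv T'0 P1
      by (intro exI[of _ ?B] exI[of _ "{}"] exI[of _ old] exI[of _ new] exI[of _ p])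
        (simp add: branch_degree_def)
  next
    case False
    then obtain j i where ji: "(j, i) \<in> branches" "f \<in> new (j, i)" using fG by (auto simp: verts_H)
    have jk: "j \<in> {1..k}" "i \<in> {1..card (P j)}" using ji by (auto simp: branches_def)
    have nb: "y = v" if "y \<in> old (j, i) \<union> new (j, i)" "y \<noteq> f" for y
      using uniq[of y] adj_new[OF ji, of y] that unfolding G_eq by auto
    have "v \<in> old (j, i) \<union> new (j, i)"
      using fv adj_new[OF ji, of v] unfolding G_eq by auto
    then have v_old: "v \<in> old (j, i)" using vn N_base[OF ji(1)] by auto
    then have "v \<in> P j" using old_sub[OF ji(1)] by blast
    then have j1: "j = 1"
      using v disjoint_family_onD[OF P_disjoint jk(1) one] by blast
    have "new (j, i) = {f}" using nb ji(2) vn N_base[OF ji(1)] by blast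
    \<comment> \<open>Old vertices of the clique are neighbours of the leaf, so \<open>v\<close> is
      the only one; as there are i of them, i = 1 will follow.\<close>
    have old_v: "old (j, i) \<subseteq> {v}"
      using nb old_sub[OF ji(1)] P_sub[OF jk(1)] False by blast
    have uv: "u 1 l = v" if "l \<in> {1..i}" for l
    proof -
      have "u 1 l \<in> old (j, i)" using that by (simp add: old_def j1)
      then show ?thesis using old_v by blast
    qed
    have i1: "i = 1"
    proof (rule ccontr)
      assume "i \<noteq> 1"
      then have "1 \<in> {1..card (P 1)}" "2 \<in> {1..card (P 1)}" "u 1 1 = u 1 2"
        using jk uv[of 1] uv[of 2] by (auto simp: j1)
      then show False using bij_betw_imp_inj_on[OF u_bij[OF one]] by (auto dest!: inj_onD)
    qed
    have b11: "(1, 1) \<in> branches" using ji by (simp add: j1 i1)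
    have v_eq: "v = u 1 1" using uv[of 1] i1 by simp
    have new11: "new (1, 1) = {f}" and old11: "old (1, 1) = {v}"
      using \<open>new (j, i) = {f}\<close> v_eq by (simp_all add: j1 i1 old_def)
    let ?S = "branches - {(1, 1)}"
    have fnew: "f \<notin> new s" if "s \<in> ?S" for s
      using N_disjoint[OF b11, of s] new11 that by auto
    have fold: "f \<notin> old s" if "s \<in> branches" for s
      using K[OF that] False by blast
    have rem: "remove_vertex G f = branch_graph {1..n} {} ?S old new"
    proof -
      have "complete_edges {f, v} = {{v, f}}"
        using f_neq by (auto simp: complete_edges_def card_2_iff)
      moreover have "(\<Union>s\<in>branches. complete_edges (old s \<union> new s)) =
          complete_edges (old (1, 1) \<union> new (1, 1)) \<union> (\<Union>s\<in>?S. complete_edges (old s \<union> new s))"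
        using b11 by blast
      ultimately have "edges G = edges (branch_graph {1..n} {} ?S old new) \<union> {{v, f}}"
        unfolding G_eq branch_graph_def new11 old11 by simp
      moreover have "f \<notin> e" if "e \<in> edges (branch_graph {1..n} {} ?S old new)" for e
        using that False fnew fold by (fastforce simp: branch_graph_def complete_edges_def)
      ultimately have "{e \<in> edges G. f \<notin> e} = edges (branch_graph {1..n} {} ?S old new)" by auto
      moreover have "verts G - {f} = verts (branch_graph {1..n} {} ?S old new)"
        unfolding G_eq branch_graph_def using False fnew new11 b11 by auto
      ultimately show ?thesis by (simp add: remove_vertex_def branch_graph_def)
    qed
    have deg_S: "branch_degree ?S old w = branch_degree branches old w" if "w \<noteq> v" for w
      unfolding branch_degree_def by (rule arg_cong[where f = card]) (use that old11 in auto)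
    have deg_v: "branch_degree ?S old v + 1 = card (P 1)"
    proof -
      have "{s \<in> ?S. v \<in> old s} = {1} \<times> {1..card (P 1)} - {(1, 1)}"
        using met_branches[OF b11] unfolding v_eq by auto
      then show ?thesis
        using card_P[OF one] by (simp add: branch_degree_def card_cartesian_product)
    qed
    have deg_le: "branch_degree ?S old w \<le> T'" if w: "w \<in> {1..n} - {v}" for w
    proof (cases "branch_degree branches old w = 0")
      case True
      then show ?thesis using deg_S w by simp
    next
      case nonzero: False
      then obtain j' l where jl: "(j', l) \<in> branches" "w = u j' l" using old_indices w by blast
      have deg: "branch_degree ?S old w = card (P j') - l + 1"
        using deg_S w degree_u[OF jl(1)] jl(2) by simp
      show ?thesis
      proof (cases "j' = 1")
        case True
        \<comment> \<open>In the fan on \<open>P 1\<close> the index 1 is taken by \<open>v\<close>,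
          so the other vertices meet at most card (P 1) - 1 cliques; this is the origin of the
          lowered entry in \<open>T'\<close>.\<close>
        then have "l \<noteq> 1" using jl w v_eq by auto
        moreover have "l \<ge> 1" "l \<le> card (P j')" using jl(1) by (auto simp: branches_def)
        ultimately show ?thesis using deg T'_ge1 True by simp
      next
        case False
        then have "j' \<in> {2..k}" "l \<ge> 1" "l \<le> card (P j')" using jl(1) by (auto simp: branches_def)
        then show ?thesis using deg T'_ge[of j'] by simp
      qed
    qed
    have "\<exists>w\<in>{1..n} - {v}. branch_degree ?S old w = T'"
    proof -
      have u_ne: "u j' l \<noteq> v" if "(j', l) \<in> branches" "(j', l) \<noteq> (1, 1)" for j' l
        using u_mem_old[OF b11 that(1)] old11 that by (auto simp: branches_def)
      show ?thesis
      proof (cases "T' = 0")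
        case True
        \<comment> \<open>With \<open>T' = 0\<close> any other base vertex will do; one exists
          because n \<ge> 2.\<close>
        obtain w where "w \<in> {1..n} - {v}"
        proof -
          have "\<not> {1..n} \<subseteq> {v}" using card_mono[of "{v}" "{1..n}"] n by auto
          then show thesis using that by blast
        qed
        then show ?thesis using deg_le[of w] True by auto
      next
        case False
        from T'_in show ?thesis
        proof
          assume T': "T' = card (P 1) - 1"
          \<comment> \<open>The second vertex in the ordering of \<open>P 1\<close> realises card (P
            1) - 1.\<close>
          then have b: "(1, 2) \<in> branches" using False one by (auto simp: branches_def)
          then show ?thesis
            using u_mem(2)[OF b] u_ne[OF b] deg_S[of "u 1 2"] degree_u[OF b] T' False
            by (intro bexI[of _ "u 1 2"]) auto
        next
          assume "\<exists>j\<in>{2..k}. T' = card (P j)"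
          then obtain j' where j': "j' \<in> {2..k}" "T' = card (P j')" by blast
          then have b: "(j', 1) \<in> branches" using False by (auto simp: branches_def)
          then show ?thesis
            using u_mem(2)[OF b] u_ne[OF b] deg_S[of "u j' 1"] degree_u[OF b] j' False
            by (intro bexI[of _ "u j' 1"]) auto
        qed
      qed
    qed
    then obtain w where w: "w \<in> {1..n} - {v}" and deg_w: "branch_degree ?S old w = T'" by blast
    have card_S: "card ?S + 1 = card W"
      using cardW b11 fin(3) by (metis Suc_eq_plus1 card_Suc_Diff1)
    have bc: "branched_clique {1..n} ?S old new" by (rule branched_clique) auto
    show ?thesis
      by (intro exI[of _ "{1..n}"] exI[of _ ?S] exI[of _ old] exI[of _ new] exI[of _ w] conjI ballI)
        (fact bc rem vn card_S deg_v w deg_w | erule deg_le)+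
  qed
qed

end

section \<open>The composite graph\<close>

lemma complete_edges_image:
  assumes "inj_on g A"
  shows "complete_edges (g ` A) = (`) g ` complete_edges A"
proof
  show "(`) g ` complete_edges A \<subseteq> complete_edges (g ` A)"
    using inj_on_subset[OF assms] by (auto simp: complete_edges_def card_image)
next
  show "complete_edges (g ` A) \<subseteq> (`) g ` complete_edges A"
  proof
    fix e assume "e \<in> complete_edges (g ` A)"
    then have e: "e \<subseteq> g ` A" "card e = 2" by (auto simp: complete_edges_def)
    then obtain e' where e': "e' \<subseteq> A" "e = g ` e'" by (auto simp: subset_image_iff)
    then have "card e' = 2" using e card_image[OF inj_on_subset[OF assms e'(1)]] by simp
    then show "e \<in> (`) g ` complete_edges A" using e' by (auto simp: complete_edges_def)
  qed
qed

text \<open>This is \<open>Inr\<close> followed by the identification of \<open>Inr v2\<close> with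
  \<open>Inl v1\<close>; its injectivity carries complete graphs to complete graphs.\<close>

definition glue :: "'a \<Rightarrow> 'b \<Rightarrow> 'b \<Rightarrow> 'a + 'b" where
  "glue v1 v2 y = (if y = v2 then Inl v1 else Inr y)"

lemma inj_glue: "inj (glue v1 v2)"
  by (auto simp: inj_def glue_def)

lemma leaf_circ_branch_graph:
  fixes G1 :: "'a ugraph" and G2 :: "'b ugraph"
  assumes G1: "remove_vertex G1 f1 = branch_graph B1 {} S1 K1 N1"
    and G2: "remove_vertex G2 f2 = branch_graph B2 {} S2 K2 N2"
    and nb: "leaf_neighbour G1 f1 = v1" "leaf_neighbour G2 f2 = v2"
  shows "leaf_circ G1 f1 G2 f2 = branch_graph (Inl ` B1) (glue v1 v2 ` B2) (Inl ` S1 \<union> Inr ` S2)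
     (case_sum (\<lambda>s. Inl ` K1 s) (\<lambda>s. glue v1 v2 ` K2 s))
     (case_sum (\<lambda>s. Inl ` N1 s) (\<lambda>s. glue v1 v2 ` N2 s))"
proof -
  define q where "q = (\<lambda>x :: 'a + 'b. if x = Inr v2 then Inl v1 else x)"
  have q_image: "q ` Inl ` X = Inl ` X" "q ` Inr ` Y = glue v1 v2 ` Y" for X :: "'a set" and Y :: "'b set"
    by (auto simp: q_def glue_def image_iff)
  have e1: "(`) q ` (`) Inl ` complete_edges X = complete_edges (Inl ` X)" for X :: "'a set"
    unfolding complete_edges_image[OF inj_Inl]
    by (simp only: image_image[of "(`) q" "(`) Inl"] q_image)
  have e2: "(`) q ` (`) Inr ` complete_edges Y = complete_edges (glue v1 v2 ` Y)" for Y :: "'b set"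
    unfolding complete_edges_image[OF inj_on_subset[OF inj_glue subset_UNIV]]
    by (simp only: image_image[of "(`) q" "(`) Inr"] q_image)
  have union: "(\<Union>s\<in>Inl ` S1 \<union> Inr ` S2. h s) = (\<Union>s\<in>S1. h (Inl s)) \<union> (\<Union>s\<in>S2. h (Inr s))"
    for h :: "_ \<Rightarrow> 'x set"
    by auto
  show ?thesis
    unfolding leaf_circ_def identify_vertices_def disjoint_union_def Let_def nb G1 G2 branch_graph_def
      q_def[symmetric]
    by (simp add: image_Un image_UN q_image e1 e2 union Un_ac)
qed

lemma leaf_neighbour_eq:
  assumes "leaf G f" "{f, v} \<in> edges G"
  shows "leaf_neighbour G f = v"
  unfolding leaf_neighbour_def
proof (rule the_equality)
  fix y assume "{f, y} \<in> edges G"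
  then have "{f, y} = {f, v}" using leaf_edge_unique[OF assms] by simp
  then show "y = v" by (auto simp: doubleton_eq_iff)
qed (rule assms(2))

locale glued_cliques =
  one: branched_clique B1 S1 K1 N1 + two: branched_clique B2 S2 K2 N2
  for B1 :: "'a set" and S1 :: "'s set" and K1 N1
    and B2 :: "'b set" and S2 :: "'t set" and K2 N2 +
  fixes v1 v2 t1 t2 w1 w2
  assumes v1: "v1 \<in> B1" and v2: "v2 \<in> B2"
    and t1: "\<forall>w\<in>B1 - {v1}. branch_degree S1 K1 w \<le> t1"
    and t2: "\<forall>w\<in>B2 - {v2}. branch_degree S2 K2 w \<le> t2"
    and w1: "w1 \<in> B1 - {v1}" "branch_degree S1 K1 w1 = t1"
    and w2: "w2 \<in> B2 - {v2}" "branch_degree S2 K2 w2 = t2"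
begin

abbreviation "S \<equiv> Inl ` S1 \<union> Inr ` S2"

abbreviation "K \<equiv> case_sum (\<lambda>s. Inl ` K1 s) (\<lambda>s. glue v1 v2 ` K2 s)"

abbreviation "N \<equiv> case_sum (\<lambda>s. Inl ` N1 s) (\<lambda>s. glue v1 v2 ` N2 s)"

lemma degree_split:
  "branch_degree S K x = card {s \<in> S1. x \<in> Inl ` K1 s} + card {s \<in> S2. x \<in> glue v1 v2 ` K2 s}"
proof -
  have "{s \<in> S. x \<in> K s} = Inl ` {s \<in> S1. x \<in> Inl ` K1 s} \<union> Inr ` {s \<in> S2. x \<in> glue v1 v2 ` K2 s}"
    by auto
  moreover have "card (Inl ` {s \<in> S1. x \<in> Inl ` K1 s} \<union> Inr ` {s \<in> S2. x \<in> glue v1 v2 ` K2 s}) =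
      card (Inl ` {s \<in> S1. x \<in> Inl ` K1 s} :: ('s + 't) set) +
      card (Inr ` {s \<in> S2. x \<in> glue v1 v2 ` K2 s} :: ('s + 't) set)"
    using one.fin two.fin by (intro card_Un_disjoint) auto
  ultimately show ?thesis
    unfolding branch_degree_def by (simp add: card_image)
qed

lemma degree_left: "w \<noteq> v1 \<Longrightarrow> branch_degree S K (Inl w) = branch_degree S1 K1 w"
  unfolding degree_split unfolding branch_degree_def by (auto simp: glue_def image_iff split: if_splits)

lemma degree_right: "w \<noteq> v2 \<Longrightarrow> branch_degree S K (Inr w) = branch_degree S2 K2 w"
  unfolding degree_split unfolding branch_degree_def by (auto simp: glue_def image_iff)

lemma degree_centre:
  "branch_degree S K (Inl v1) = branch_degree S1 K1 v1 + branch_degree S2 K2 v2"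
  unfolding degree_split unfolding branch_degree_def by (auto simp: glue_def image_iff)

lemma card_S: "card S = card S1 + card S2"
  using one.fin two.fin by (subst card_Un_disjoint) (auto simp: card_image)

lemma glued: "branched_cliques_at (Inl ` B1) (glue v1 v2 ` B2) S K N (Inl v1) t1 t2"
proof
  note g = inj_on_eq_iff[OF inj_glue]
  show "finite (Inl ` B1)" "finite (glue v1 v2 ` B2)" "finite S"
    using one.fin two.fin by simp_all
  show "finite (N s)" if "s \<in> S" for s
    using that one.fin(4) two.fin(4) by auto
  show "K s \<subseteq> Inl ` B1 \<or> K s \<subseteq> glue v1 v2 ` B2" if "s \<in> S" for s
    using that one.K two.K by fastforce
  show "N s \<noteq> {}" if "s \<in> S" for s
    using that one.N_nonempty two.N_nonempty by auto
  show base: "N s \<inter> (Inl ` B1 \<union> glue v1 v2 ` B2) = {}" if "s \<in> S" for s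
    using that
  proof
    assume "s \<in> Inl ` S1"
    then obtain s' where "s = Inl s'" "s' \<in> S1" by blast
    then show ?thesis using one.N_base[of s'] v1 by (auto simp: glue_def)
  next
    assume "s \<in> Inr ` S2"
    then obtain s' where s': "s = Inr s'" "s' \<in> S2" by blast
    then have "v2 \<notin> N2 s'" using two.N_base[of s'] v2 by blast
    then have "N s = Inr ` N2 s'" using s' by (auto simp: glue_def image_iff)
    then show ?thesis using two.N_base[OF s'(2)] by (auto simp: glue_def)
  qed
  show "N s \<inter> N s' = {}" if "s \<in> S" "s' \<in> S" "s \<noteq> s'" for s s'
  proof -
    have right: "glue v1 v2 ` N2 r = Inr ` N2 r" if "r \<in> S2" for r
      using two.N_base[OF that] v2 by (auto simp: glue_def image_iff)
    have "r = r'" if "r \<in> S1" "r' \<in> S1" "x \<in> N1 r" "x \<in> N1 r'" for r r' x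
      using one.N_disjoint[of r r'] that by blast
    moreover have "r = r'" if "r \<in> S2" "r' \<in> S2" "x \<in> N2 r" "x \<in> N2 r'" for r r' x
      using two.N_disjoint[of r r'] that by blast
    ultimately show ?thesis using that by (auto simp: right)
  qed
  show centre: "Inl ` B1 \<inter> glue v1 v2 ` B2 = {Inl v1}"
    using v1 v2 by (auto simp: glue_def image_iff)
  show "x = y" if "x \<in> Inl ` B1 \<inter> glue v1 v2 ` B2" "y \<in> Inl ` B1 \<inter> glue v1 v2 ` B2" for x y
    using that unfolding centre by simp
  show "branch_degree S K w \<le> t1" if w: "w \<in> Inl ` B1 - {Inl v1}" for w
  proof -
    obtain x where "w = Inl x" "x \<in> B1 - {v1}" using w by blast
    then show ?thesis using t1 degree_left[of x] by simp
  qed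
  show "branch_degree S K w \<le> t2" if w: "w \<in> glue v1 v2 ` B2 - {Inl v1}" for w
  proof -
    obtain x where "w = Inr x" "x \<in> B2 - {v2}"
      using w by (auto simp: glue_def split: if_splits)
    then show ?thesis using t2 degree_right[of x] by simp
  qed
  show "Inl ` B1 - {Inl v1} \<noteq> {}" using w1 by auto
  show "glue v1 v2 ` B2 - {Inl v1} \<noteq> {}" using w2 by (auto simp: glue_def)
qed

sublocale branched_cliques_at "Inl ` B1" "glue v1 v2 ` B2" S K N "Inl v1" t1 t2
  by (rule glued)

text \<open>Equality implies the bound that makes the common vertex optimal, and it yields t1 = 0
  when no clique passes through that vertex.\<close>

lemma edge_depth_glued_centre:
  assumes "branch_degree S1 K1 v1 + branch_degree S2 K2 v2 = t1 + t2"
  shows "edge_depth TYPE('k::field) H + t1 + t2 = 1 + card S1 + card S2"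
  using edge_depth_centre[where 'k = 'k] assms unfolding degree_centre card_S by force

lemma edge_depth_glued_two:
  assumes "branch_degree S1 K1 v1 + branch_degree S2 K2 v2 < t1 + t2" and "t1 \<ge> 1 \<or> t2 \<ge> 1"
  shows "edge_depth TYPE('k::field) H + t1 + t2 = 2 + card S1 + card S2"
proof -
  have w1': "Inl w1 \<in> Inl ` B1 - {Inl v1}" "branch_degree S K (Inl w1) = t1"
    using w1 degree_left[of w1] by simp_all
  have w2': "Inr w2 \<in> glue v1 v2 ` B2 - {Inl v1}" "branch_degree S K (Inr w2) = t2"
    using w2 degree_right[of w2] by (auto simp: glue_def intro!: image_eqI[of _ _ w2])
  have ge: "1 + branch_degree S K (Inl v1) \<le> t1 + t2" "1 + branch_degree S K (Inl v1) \<le> t2 + t1"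
    using assms(1) by (simp_all add: degree_centre)
  from assms(2) show ?thesis
  proof
    assume "t1 \<ge> 1"
    from edge_depth_two[OF ge(1) w1' w2' this, where 'k = 'k] show ?thesis by (simp add: card_S)
  next
    assume "t2 \<ge> 1"
    from swapped.edge_depth_two[OF ge(2) w2' w1' this, where 'k = 'k] show ?thesis by (simp add: card_S)
  qed
qed

end

text \<open>Lowering one entry of a finite family by one lowers the maximum only if that entry is
  the unique largest, and then by exactly one.\<close>

lemma Max_branch_sizes:
  fixes c :: "nat \<Rightarrow> nat"
  assumes "k \<ge> 1" "c 1 \<ge> 1"
  defines "T \<equiv> Max (c ` {1..k})" and "T' \<equiv> Max ({c 1 - 1} \<union> c ` {2..k})"
  shows "T \<ge> 1" "c 1 \<le> T" "c 1 - 1 \<le> T'" "T' = T \<or> T' + 1 = T \<and> c 1 = T"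
proof -
  have le: "c j \<le> T" if "j \<in> {1..k}" for j unfolding T_def using that by (intro Max_ge) auto
  have le': "c j \<le> T'" if "j \<in> {2..k}" for j unfolding T'_def using that by (intro Max_ge) auto
  show c1: "c 1 \<le> T" using le[of 1] assms(1) by simp
  then show "T \<ge> 1" using assms(2) by simp
  show le1: "c 1 - 1 \<le> T'" unfolding T'_def by (intro Max_ge) auto
  have "T \<in> c ` {1..k}" unfolding T_def using assms(1) by (intro Max_in) auto
  then obtain j where j: "j \<in> {1..k}" "T = c j" by blast
  have "T' \<in> {c 1 - 1} \<union> c ` {2..k}" unfolding T'_def by (intro Max_in) auto
  then have "T' \<le> T" using c1 le by fastforce
  \<comment> \<open>A maximum attained at an index other than 1 survives in
    \<open>T'\<close>.\<close>
  moreover have "T \<le> T' \<or> j = 1" using j le'[of j] by force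
  ultimately show "T' = T \<or> T' + 1 = T \<and> c 1 = T" using j le1 by auto
qed

theorem theorem3p6:
  fixes n k :: "nat \<Rightarrow> nat"
    and W :: "nat \<Rightarrow> nat set"
    and P :: "nat \<Rightarrow> nat \<Rightarrow> nat set"
    and G :: "nat \<Rightarrow> nat ugraph"
    and f v :: "nat \<Rightarrow> nat"
    and T T' :: "nat \<Rightarrow> nat"
    and t :: nat
  assumes "\<And>i. i \<in> {1, 2} \<Longrightarrow> n i \<ge> 2"
    and "\<And>i. i \<in> {1, 2} \<Longrightarrow> k i \<ge> 1"
    and "\<And>i. i \<in> {1, 2} \<Longrightarrow> k_fan_graph (n i) (W i) (k i) (P i) (G i)"
    and "\<And>i. i \<in> {1, 2} \<Longrightarrow> leaf (G i) (f i)"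
    and "\<And>i. i \<in> {1, 2} \<Longrightarrow> {f i, v i} \<in> edges (G i)"
    and "\<And>i. i \<in> {1, 2} \<Longrightarrow> degree (G i) (v i) \<ge> 2"
    and "\<And>i. i \<in> {1, 2} \<Longrightarrow> v i \<in> P i 1"
    and "\<And>i. i \<in> {1, 2} \<Longrightarrow> T i = Max ((\<lambda>j. card (P i j)) ` {1..k i})"
    and "\<And>i. i \<in> {1, 2} \<Longrightarrow>
           T' i = Max ({card (P i 1) - 1} \<union> (\<lambda>j. card (P i j)) ` {2..k i})"
    and "t = card {i \<in> {1, 2}. int (T' i) \<noteq> int (T i) - 1}"
  shows "int (edge_depth TYPE('k::field) (leaf_circ (G 1) (f 1) (G 2) (f 2))) =
         int (edge_depth TYPE('k) (G 1)) + int (edge_depth TYPE('k) (G 2))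
           - (if t \<le> 1 then 1 else 2)"
proof -
  have ex: "\<exists>B S (K :: nat \<times> nat \<Rightarrow> nat set) N w. branched_clique B S K N \<and>
    remove_vertex (G i) (f i) = branch_graph B {} S K N \<and> v i \<in> B \<and> card S + 1 = card (W i) \<and>
    branch_degree S K (v i) + 1 = card (P i 1) \<and> (\<forall>w\<in>B - {v i}. branch_degree S K w \<le> T' i) \<and>
    w \<in> B - {v i} \<and> branch_degree S K w = T' i" if i: "i \<in> {1, 2}" for i
    using remove_leaf_decomposition[OF assms(1-5,7)[OF i]] assms(9)[OF i] by simp
  have "edge_depth TYPE('k) (G i) + T i = 1 + card (W i)" if i: "i \<in> {1, 2}" for i
    using edge_depth_fan[OF assms(3,2)[OF i], where 'k = 'k] assms(8)[OF i] by simp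
  then have depth: "edge_depth TYPE('k) (G 1) + T 1 = 1 + card (W 1)"
    "edge_depth TYPE('k) (G 2) + T 2 = 1 + card (W 2)" by simp_all
  obtain B1 S1 and K1 N1 :: "nat \<times> nat \<Rightarrow> nat set" and w1 where
    one: "branched_clique B1 S1 K1 N1" "remove_vertex (G 1) (f 1) = branch_graph B1 {} S1 K1 N1"
      "v 1 \<in> B1" "card S1 + 1 = card (W 1)" "branch_degree S1 K1 (v 1) + 1 = card (P 1 1)"
      "\<forall>w\<in>B1 - {v 1}. branch_degree S1 K1 w \<le> T' 1" "w1 \<in> B1 - {v 1}" "branch_degree S1 K1 w1 = T' 1"
    using ex[of 1] by auto
  obtain B2 S2 and K2 N2 :: "nat \<times> nat \<Rightarrow> nat set" and w2 where
    two: "branched_clique B2 S2 K2 N2" "remove_vertex (G 2) (f 2) = branch_graph B2 {} S2 K2 N2"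
      "v 2 \<in> B2" "card S2 + 1 = card (W 2)" "branch_degree S2 K2 (v 2) + 1 = card (P 2 1)"
      "\<forall>w\<in>B2 - {v 2}. branch_degree S2 K2 w \<le> T' 2" "w2 \<in> B2 - {v 2}" "branch_degree S2 K2 w2 = T' 2"
    using ex[of 2] by auto
  interpret glued_cliques B1 S1 K1 N1 B2 S2 K2 N2 "v 1" "v 2" "T' 1" "T' 2" w1 w2
    using one two by (simp add: glued_cliques_def glued_cliques_axioms_def)
  have G: "leaf_circ (G 1) (f 1) (G 2) (f 2) = H"
  proof (rule leaf_circ_branch_graph[OF one(2) two(2)])
    show "leaf_neighbour (G 1) (f 1) = v 1" "leaf_neighbour (G 2) (f 2) = v 2"
      by (rule leaf_neighbour_eq; rule assms(4,5); simp)+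
  qed
  have max: "T i \<ge> 1 \<and> card (P i 1) \<le> T i \<and> card (P i 1) - 1 \<le> T' i \<and>
      (T' i = T i \<or> T' i + 1 = T i \<and> card (P i 1) = T i)" if i: "i \<in> {1, 2}" for i
    using Max_branch_sizes[OF assms(2)[OF i], of "\<lambda>j. card (P i j)"] assms(8,9)[OF i] one(5) two(5) i
    by auto
  note max1 = max[of 1, simplified] and max2 = max[of 2, simplified]
  \<comment> \<open>As \<open>T' i\<close> is \<open>T i\<close> or \<open>T i - 1\<close>, the
    number \<open>t\<close> counts the sides with T' i = T i.\<close>
  have t: "t = (if T' 1 = T 1 then 1 else 0) + (if T' 2 = T 2 then 1 else 0)"
  proof -
    have "{i \<in> {1, 2}. int (T' i) \<noteq> int (T i) - 1} =
        (if T' 1 = T 1 then {1} else {}) \<union> (if T' 2 = T 2 then {2} else {})"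
      using max1 max2 by auto
    then show ?thesis using assms(10) by auto
  qed
  show ?thesis
  proof (cases "T' 1 = T 1 \<or> T' 2 = T 2")
    case True
    \<comment> \<open>On a side with T' i = T i the share card (P i 1) - 1 of the common vertex is
      strictly below \<open>T' i\<close>, on the other at most \<open>T' i\<close>; so two vertices
      do at least as well. The result is the sum of the depths minus 2, plus one if one side has T'
      i = T i - 1.\<close>
    then have "edge_depth TYPE('k) H + T' 1 + T' 2 = 2 + card S1 + card S2"
      using max1 max2 one(5) two(5) by (intro edge_depth_glued_two) auto
    then show ?thesis
      using True max1 max2 depth one(4) two(4) unfolding G t by (auto split: if_splits)
  next
    case False
    \<comment> \<open>On both sides card (P i 1) - 1 = T' i, so the common vertex meets as many
      cliques as two others together and beats them by one.\<close>
    then have "edge_depth TYPE('k) H + T' 1 + T' 2 = 1 + card S1 + card S2"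
      using max1 max2 one(5) two(5) by (intro edge_depth_glued_centre) auto
    then show ?thesis
      using False max1 max2 depth one(4) two(4) unfolding G t by (auto split: if_splits)
  qed
qed

end
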